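(* Let $K$ be a totally real number field with $\sqrt2\in K$. Assume that at least one of the following holds: (a) $|\mathcal{U}_K^+/\mathcal{U}_K^2|>1$; (b) $2\mathcal{O}_K^+\not\subset\sum^4\square$; (c) there exists an indecomposable $\alpha\in\mathcal{O}_K^+$ with $\alpha\notin \mathcal{U}_K^2\cup(2+\sqrt2)\,\mathcal{U}_K^2$; (d) $K$ contains the field $F_k=\mathbb{Q}(\zeta_k+\zeta_k^{-1})$ for some integer $k\ge1$ with $F_k\neq\mathbb{Q}$ and $F_k\neq\mathbb{Q}(\sqrt2)$. Then there is no ternary classical quadratic form with coefficients in $\mathbb{Q}(\sqrt2)$ that is universal both over $\mathbb{Q}(\sqrt2)$ and over $K$. In other words, none of the forms $Q_1=x^2+y^2+(2+\sqrt2)z^2$, $Q_2=x^2+(2+\sqrt2)y^2+2yz+(2-\sqrt2)z^2$, $Q_3=x^2+(2+\sqrt2)y^2+2yz+3z^2$, $Q_3'=x^2+(2-\sqrt2)y^2+2yz+3z^2$ is universal over $K$.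
   Context: $\mathcal{O}_K$ is the ring of integers of $K$, $\mathcal{O}_K^+$ its totally positive elements, $\mathcal{U}_K$ its unit group, $\mathcal{U}_K^+$ the totally positive units and $\mathcal{U}_K^2=\{\eta^2:\eta\in\mathcal{U}_K\}$. $\sum^4\square=\{a_1^2+a_2^2+a_3^2+a_4^2: a_i\in\mathcal{O}_K\}$. An element $\alpha\in\mathcal{O}_K^+$ is indecomposable if it cannot be written as $\beta+\gamma$ with $\beta,\gamma\in\mathcal{O}_K^+$. $\zeta_k=e^{2\pi i/k}$. A quadratic form $\sum_{i\le j}\alpha_{ij}x_ix_j$ is classical if $\alpha_{ii}\in\mathcal{O}$ and $\alpha_{ij}\in 2\mathcal{O}$ ($i\ne j$) for the relevant ring of integers $\mathcal{O}$; it is universal over a field $F$ if it is positive definite over $F$ and represents (with arguments in $\mathcal{O}_F$) exactly all elements of $\mathcal{O}_F^+$. *)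

theory Defs
  imports "HOL-Computational_Algebra.Polynomial"
begin

definition subfield :: "complex set \<Rightarrow> bool" where
  "subfield L \<longleftrightarrow> 0 \<in> L \<and> 1 \<in> L \<and>
     (\<forall>x\<in>L. \<forall>y\<in>L. x + y \<in> L \<and> x * y \<in> L) \<and>
     (\<forall>x\<in>L. - x \<in> L) \<and> (\<forall>x\<in>L. x \<noteq> 0 \<longrightarrow> inverse x \<in> L)"

definition number_field :: "complex set \<Rightarrow> bool" where
  "number_field K \<longleftrightarrow> subfield K \<and>
     (\<exists>B. finite B \<and> B \<subseteq> K \<and>
          (\<forall>x\<in>K. \<exists>c :: complex \<Rightarrow> rat. x = (\<Sum>b\<in>B. of_rat (c b) * b)))"

text \<open>Field embeddings of K into the complex numbers (only their values on K matter).\<close>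
definition embedding :: "complex set \<Rightarrow> (complex \<Rightarrow> complex) \<Rightarrow> bool" where
  "embedding K \<sigma> \<longleftrightarrow> \<sigma> 1 = 1 \<and>
     (\<forall>x\<in>K. \<forall>y\<in>K. \<sigma> (x + y) = \<sigma> x + \<sigma> y \<and> \<sigma> (x * y) = \<sigma> x * \<sigma> y)"

definition totally_real_field :: "complex set \<Rightarrow> bool" where
  "totally_real_field K \<longleftrightarrow> number_field K \<and>
     (\<forall>\<sigma>. embedding K \<sigma> \<longrightarrow> (\<forall>x\<in>K. \<sigma> x \<in> \<real>))"

definition algebraic_integer :: "complex \<Rightarrow> bool" where
  "algebraic_integer x \<longleftrightarrow>
     (\<exists>p :: int poly. lead_coeff p = 1 \<and> poly (map_poly of_int p) x = 0)"

definition OK :: "complex set \<Rightarrow> complex set" where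
  "OK K = {x \<in> K. algebraic_integer x}"

definition totally_positive :: "complex set \<Rightarrow> complex \<Rightarrow> bool" where
  "totally_positive K x \<longleftrightarrow> x \<in> K \<and>
     (\<forall>\<sigma>. embedding K \<sigma> \<longrightarrow> \<sigma> x \<in> \<real> \<and> Re (\<sigma> x) > 0)"

definition OK_plus :: "complex set \<Rightarrow> complex set" where
  "OK_plus K = {x \<in> OK K. totally_positive K x}"

definition units :: "complex set \<Rightarrow> complex set" where
  "units K = {x \<in> OK K. x \<noteq> 0 \<and> inverse x \<in> OK K}"

definition units_plus :: "complex set \<Rightarrow> complex set" where
  "units_plus K = {x \<in> units K. totally_positive K x}"

definition unit_squares :: "complex set \<Rightarrow> complex set" where
  "unit_squares K = {\<eta>\<^sup>2 | \<eta>. \<eta> \<in> units K}"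

definition unit_quotient :: "complex set \<Rightarrow> complex set set" where
  "unit_quotient K = {(\<lambda>\<eta>. \<epsilon> * \<eta>) ` unit_squares K | \<epsilon>. \<epsilon> \<in> units_plus K}"

definition sum_four_squares :: "complex set \<Rightarrow> complex set" where
  "sum_four_squares K = {a1\<^sup>2 + a2\<^sup>2 + a3\<^sup>2 + a4\<^sup>2 | a1 a2 a3 a4.
      a1 \<in> OK K \<and> a2 \<in> OK K \<and> a3 \<in> OK K \<and> a4 \<in> OK K}"

definition indecomposable :: "complex set \<Rightarrow> complex \<Rightarrow> bool" where
  "indecomposable K \<alpha> \<longleftrightarrow> \<alpha> \<in> OK_plus K \<and>
     \<not> (\<exists>\<beta>\<in>OK_plus K. \<exists>\<gamma>\<in>OK_plus K. \<alpha> = \<beta> + \<gamma>)"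

definition gen_field :: "complex \<Rightarrow> complex set" where
  "gen_field a = \<Inter> {L. subfield L \<and> a \<in> L}"

abbreviation sqrt2 :: complex where
  "sqrt2 \<equiv> complex_of_real (sqrt 2)"

definition F :: "nat \<Rightarrow> complex set" where
  "F k = gen_field (exp (2 * pi * \<i> / of_nat k) + inverse (exp (2 * pi * \<i> / of_nat k)))"

definition tform :: "complex \<Rightarrow> complex \<Rightarrow> complex \<Rightarrow> complex \<Rightarrow> complex \<Rightarrow> complex
    \<Rightarrow> complex \<Rightarrow> complex \<Rightarrow> complex \<Rightarrow> complex" where
  "tform a11 a22 a33 a12 a13 a23 x y z =
     a11 * x\<^sup>2 + a22 * y\<^sup>2 + a33 * z\<^sup>2 + a12 * x * y + a13 * x * z + a23 * y * z"

definition classical :: "complex set \<Rightarrow> complex \<Rightarrow> complex \<Rightarrow> complex \<Rightarrow> complex \<Rightarrow> complex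
    \<Rightarrow> complex \<Rightarrow> bool" where
  "classical R a11 a22 a33 a12 a13 a23 \<longleftrightarrow>
     a11 \<in> R \<and> a22 \<in> R \<and> a33 \<in> R \<and>
     a12 \<in> (\<lambda>b. 2 * b) ` R \<and> a13 \<in> (\<lambda>b. 2 * b) ` R \<and> a23 \<in> (\<lambda>b. 2 * b) ` R"

definition positive_definite :: "complex set \<Rightarrow> (complex \<Rightarrow> complex \<Rightarrow> complex \<Rightarrow> complex) \<Rightarrow> bool" where
  "positive_definite L Q \<longleftrightarrow>
     (\<forall>x\<in>L. \<forall>y\<in>L. \<forall>z\<in>L. (x, y, z) \<noteq> (0, 0, 0) \<longrightarrow> totally_positive L (Q x y z))"

definition universal :: "complex set \<Rightarrow> (complex \<Rightarrow> complex \<Rightarrow> complex \<Rightarrow> complex) \<Rightarrow> bool" where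
  "universal L Q \<longleftrightarrow> positive_definite L Q \<and>
     {Q x y z | x y z. x \<in> OK L \<and> y \<in> OK L \<and> z \<in> OK L \<and> (x, y, z) \<noteq> (0, 0, 0)} = OK_plus L"

end

theory Submission
  imports Defs "Jordan_Normal_Form.Char_Poly" "HOL-Computational_Algebra.Fundamental_Theorem_Algebra" "HOL-Library.FuncSet"
begin

text \<open>Write $\delta = 2 + \sqrt 2$. Universality of one of the forms yields a representation
  $\alpha = x^2 + w^2 + \delta t$ of every totally positive integer, with $2 \delta t$ a sum of two squares.
  This gives four squares for $2 \alpha$, and it forces an indecomposable $\alpha$ to be a square or a
  multiple of $\delta$. By the arithmetic-geometric mean inequality totally positive elements of norm
  below $2^d$, where $d = [K : \mathbb Q]$, are indecomposable; hence totally positive units are squares. A Dirichlet-type count of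
  units modulo $2^n$-th powers then provides units of all signs, and a descent on the norm shows that
  indecomposables lie in $\mathcal U^2 \cup \delta\,\mathcal U^2$. Consequently every nonzero integer of
  absolute norm below $2^d$ is a unit or $\delta$ times a unit, which fails for suitable elements of small
  norm in the fields $F_k$.

  For a general classical form over $\mathbb Z[\sqrt 2]$, vectors representing $1$, $\delta$ and $3$ span
  a sublattice with one of finitely many Gram matrices, and all but one of these reduce to the same
  representation; the exceptional form $x^2 + \delta y^2 + 3 z^2$ misses $3 \delta$.\<close>

section \<open>Algebraic integers\<close>

text \<open>The decomposition arguments only reach totally positive elements, while the elements of
  small norm found in the fields \<open>F k\<close> have arbitrary signs; units of all signs carry
  the result over to them. The element \<delta> is \<open>sqrt2\<close> times a unit, so its
  absolute norm is 2^(d/2), and \<delta>^2 is twice the square of a unit, so that its product with a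
  totally positive integer is a sum of two equal ones. A nonzero integer of absolute norm below 2^d
  thus has absolute norm 1 or 2^(d/2), which excludes powers of odd primes. For an order p >= 7 that
  is prime, and for 9, the element 2 - (\<zeta> + 1/\<zeta>) has such a norm and is small enough,
  because p^2 < 2^(p-1) and 3 < 2^3. For p = 5 the inequality fails (25 > 16), and a factor of 3 =
  (sqrt 5 + sqrt 2)(sqrt 5 - sqrt 2) takes over, as 3 < 4. For 16 and 12 the power of 2 is refined
  instead: some integer would have \<open>sqrt2\<close> times a unit as its square, hence absolute
  norm 2^(d/4).\<close>

lemma algebraic_integer_iff: "algebraic_integer x \<longleftrightarrow> algebraic_int x"
  unfolding algebraic_integer_def algebraic_int_altdef_ipoly by auto

text \<open>The \<open>c i j\<close> form the matrix of multiplication by \<open>x\<close> on the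
  span of the \<open>v i\<close>, and \<open>v\<close> is an eigenvector; so \<open>x\<close> is a
  root of the characteristic polynomial, the image under \<open>h\<close> of a monic one. With
  \<open>of_int\<close> for \<open>h\<close> this yields integrality, with \<open>of_rat\<close>
  algebraicity.\<close>

lemma module_char_poly:
  fixes h :: "'a::comm_ring_1 \<Rightarrow> complex"
  assumes h: "comm_ring_hom h" and I: "finite I" "i0 \<in> I" "v i0 \<noteq> 0"
    and eq: "\<And>i. i \<in> I \<Longrightarrow> x * v i = (\<Sum>j\<in>I. h (c i j) * v j)"
  shows "\<exists>p. lead_coeff p = 1 \<and> poly (map_poly h p) x = 0"
proof -
  interpret h: comm_ring_hom h by fact
  define n where "n = card I"
  obtain f where f: "bij_betw f {..<n} I"
    using ex_bij_betw_nat_finite[OF I(1)] unfolding n_def atLeast0LessThan by blast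
  define A where "A = mat n n (\<lambda>(i,j). c (f i) (f j))"
  have A: "A \<in> carrier_mat n n" unfolding A_def by auto
  define B where "B = map_mat h A"
  have B: "B \<in> carrier_mat n n" unfolding B_def using A by auto
  define w where "w = vec n (\<lambda>i. v (f i))"
  have w: "w \<in> carrier_vec n" unfolding w_def by auto
  obtain k where k: "k < n" "f k = i0" using f I(2) unfolding bij_betw_def by auto
  have w0: "w \<noteq> 0\<^sub>v n"
  proof
    assume "w = 0\<^sub>v n"
    hence "w $ k = 0" using k by auto
    thus False using k I(3) unfolding w_def by simp
  qed
  have "B *\<^sub>v w = x \<cdot>\<^sub>v w"
  proof (rule eq_vecI)
    fix i assume i: "i < dim_vec (x \<cdot>\<^sub>v w)"
    hence i: "i < n" using w by auto
    have "f i \<in> I" using f i unfolding bij_betw_def by auto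
    have "(B *\<^sub>v w) $ i = (\<Sum>j<n. h (c (f i) (f j)) * v (f j))"
      using i B w unfolding B_def A_def w_def
      by (auto simp: scalar_prod_def atLeast0LessThan intro!: sum.cong)
    also have "\<dots> = (\<Sum>j\<in>I. h (c (f i) j) * v j)"
      using sum.reindex_bij_betw[OF f, of "\<lambda>j. h (c (f i) j) * v j"] by simp
    also have "\<dots> = x * v (f i)" using eq[OF \<open>f i \<in> I\<close>] by simp
    finally show "(B *\<^sub>v w) $ i = (x \<cdot>\<^sub>v w) $ i" using i unfolding w_def by simp
  qed (use B w in auto)
  hence "eigenvalue B x" unfolding eigenvalue_def eigenvector_def using B w w0 by auto
  hence 0: "poly (char_poly B) x = 0" using eigenvalue_root_char_poly[OF B] by simp
  have "char_poly B = map_poly h (char_poly A)" unfolding B_def using h.char_poly_hom[OF A] by simp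
  moreover have "lead_coeff (char_poly A) = 1" using degree_monic_char_poly[OF A] by simp
  ultimately show ?thesis using 0 by metis
qed

lemma algebraic_int_module:
  assumes I: "finite I" "i0 \<in> I" "v i0 \<noteq> 0"
    and eq: "\<And>i. i \<in> I \<Longrightarrow> \<exists>c. x * v i = (\<Sum>j\<in>I. of_int (c j) * v j)"
  shows "algebraic_int (x::complex)"
proof -
  obtain c where c: "\<And>i. i \<in> I \<Longrightarrow> x * v i = (\<Sum>j\<in>I. of_int (c i j) * v j)"
    using eq by metis
  have "comm_ring_hom (of_int :: int \<Rightarrow> complex)" by unfold_locales auto
  from module_char_poly[OF this I(1,2), of v x c] I(3) c
  show ?thesis unfolding algebraic_int_altdef_ipoly by auto
qed

lemma algebraic_int_power_reduce:
  assumes "algebraic_int (x::complex)"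
  shows "\<exists>m>0. \<exists>c. x ^ m = (\<Sum>i<m. of_int (c i) * x ^ i)"
proof -
  obtain p :: "int poly" where p: "lead_coeff p = 1" "poly (map_poly of_int p) x = 0"
    using assms unfolding algebraic_int_altdef_ipoly by auto
  define m where "m = degree p"
  have "m \<noteq> 0"
  proof
    assume "m = 0"
    then obtain a where "p = [:a:]" unfolding m_def using degree_eq_zeroE by blast
    with p show False by simp
  qed
  have "(\<Sum>i\<le>m. of_int (coeff p i) * x ^ i) = 0"
    using p(2) unfolding poly_altdef m_def by (simp add: coeff_map_poly)
  moreover have "(\<Sum>i\<le>m. of_int (coeff p i) * x ^ i) = (\<Sum>i<m. of_int (coeff p i) * x ^ i) + x ^ m"
    using p(1) unfolding m_def[symmetric] by (simp add: lessThan_Suc_atMost[symmetric])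
  ultimately have "x ^ m = - (\<Sum>i<m. of_int (coeff p i) * x ^ i)"
    by (metis add_eq_0_iff)
  also have "\<dots> = (\<Sum>i<m. of_int (- coeff p i) * x ^ i)"
    by (subst sum_negf[symmetric], intro sum.cong) auto
  finally have *: "x ^ m = (\<Sum>i<m. of_int (- coeff p i) * x ^ i)" .
  show ?thesis
    by (rule exI[of _ m], rule conjI, use \<open>m \<noteq> 0\<close> in simp, rule exI[of _ "\<lambda>i. - coeff p i"], fact)
qed

text \<open>The monomials \<open>x ^ i * y ^ j\<close> below the two relation degrees span a group
  \<open>S\<close> stable under multiplication by \<open>x\<close> and by \<open>y\<close>, hence by
  their sum and product.\<close>

lemma algebraic_int_add_mult:
  assumes "algebraic_int (x::complex)" "algebraic_int y"
  shows "algebraic_int (x + y) \<and> algebraic_int (x * y)"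
proof -
  obtain m c where m: "m > 0" and xm: "x ^ m = (\<Sum>i<m. of_int (c i) * x ^ i)"
    using algebraic_int_power_reduce[OF assms(1)] by metis
  obtain n d where n: "n > 0" and yn: "y ^ n = (\<Sum>i<n. of_int (d i) * y ^ i)"
    using algebraic_int_power_reduce[OF assms(2)] by metis
  define I where "I = {..<m} \<times> {..<n}"
  define v where "v = (\<lambda>(i,j). x ^ i * y ^ j)"
  define L where "L = (\<lambda>e :: nat \<times> nat \<Rightarrow> int. \<Sum>k\<in>I. of_int (e k) * v k)"
  define S where "S = range L"
  have fin: "finite I" unfolding I_def by auto
  have Sadd: "a + b \<in> S" if asm: "a \<in> S" "b \<in> S" for a b
  proof -
    obtain e f where "a = L e" "b = L f"
      using asm unfolding S_def by blast
    hence "a + b = L (\<lambda>k. e k + f k)" by (simp add: L_def sum.distrib algebra_simps)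
    thus ?thesis unfolding S_def by blast
  qed
  have Smul: "of_int z * a \<in> S" if asm: "a \<in> S" for a z
  proof -
    obtain e where "a = L e"
      using asm unfolding S_def by blast
    hence "of_int z * a = L (\<lambda>k. z * e k)" by (simp add: L_def sum_distrib_left mult.assoc)
    thus ?thesis unfolding S_def by blast
  qed
  have S0: "0 \<in> S" unfolding S_def by (rule range_eqI[of _ _ "\<lambda>_. 0"]) (simp add: L_def)
  have Ssum: "(\<Sum>k\<in>J. g k) \<in> S" if "\<And>k. k \<in> J \<Longrightarrow> g k \<in> S" for J and g :: "'z \<Rightarrow> complex"
    using that by (induction J rule: infinite_finite_induct) (auto intro: S0 Sadd)
  have Sv: "v k \<in> S" if "k \<in> I" for k
  proof -
    have "v k = L (\<lambda>l. if l = k then 1 else 0)"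
      using that fin by (simp add: L_def if_distrib[of "\<lambda>z. of_int z * _"] sum.delta' cong: if_cong)
    thus ?thesis unfolding S_def by blast
  qed
  have xv: "x * v k \<in> S" if asm: "k \<in> I" for k
  proof -
    obtain i j where k: "k = (i,j)" "i < m" "j < n" using asm unfolding I_def by auto
    show ?thesis
    proof (cases "Suc i < m")
      case True
      have "x * v k = v (Suc i, j)" unfolding v_def k by simp
      thus ?thesis using True k Sv unfolding I_def by auto
    next
      case False
      hence "Suc i = m" using k by simp
      hence "x * v k = x ^ m * y ^ j" unfolding v_def k by auto
      also have "\<dots> = (\<Sum>i<m. of_int (c i) * v (i, j))"
        unfolding xm v_def by (simp add: sum_distrib_right mult.assoc)
      also have "\<dots> \<in> S" by (intro Ssum Smul Sv) (use k in \<open>auto simp: I_def\<close>)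
      finally show ?thesis .
    qed
  qed
  have yv: "y * v k \<in> S" if asm: "k \<in> I" for k
  proof -
    obtain i j where k: "k = (i,j)" "i < m" "j < n" using asm unfolding I_def by auto
    show ?thesis
    proof (cases "Suc j < n")
      case True
      have "y * v k = v (i, Suc j)" unfolding v_def k by simp
      thus ?thesis using True k Sv unfolding I_def by auto
    next
      case False
      hence "Suc j = n" using k by simp
      hence "y * v k = x ^ i * y ^ n" unfolding v_def k by auto
      also have "\<dots> = (\<Sum>j<n. of_int (d j) * v (i, j))"
        unfolding yn v_def by (simp add: sum_distrib_left mult_ac)
      also have "\<dots> \<in> S" by (intro Ssum Smul Sv) (use k in \<open>auto simp: I_def\<close>)
      finally show ?thesis .
    qed
  qed
  have xS: "x * a \<in> S" if asm: "a \<in> S" for a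
  proof -
    obtain e where "a = L e"
      using asm unfolding S_def by blast
    hence "x * a = (\<Sum>k\<in>I. of_int (e k) * (x * v k))" by (simp add: L_def sum_distrib_left mult_ac)
    also have "\<dots> \<in> S" by (intro Ssum Smul xv)
    finally show ?thesis .
  qed
  have v0: "v (0,0) \<noteq> 0" "(0,0) \<in> I" unfolding v_def I_def using m n by auto
  have main: "algebraic_int z" if "\<And>k. k \<in> I \<Longrightarrow> z * v k \<in> S" for z
    by (rule algebraic_int_module[of I "(0,0)" v, OF fin v0(2,1)]) (use that in \<open>auto simp: S_def L_def\<close>)
  have "algebraic_int (x + y)" by (rule main) (auto simp: distrib_right intro!: Sadd xv yv)
  moreover have "algebraic_int (x * y)" by (rule main) (auto simp: mult.assoc intro!: xS yv)
  ultimately show ?thesis by simp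
qed

lemma algebraic_int_add [intro]: "algebraic_int x \<Longrightarrow> algebraic_int y \<Longrightarrow> algebraic_int (x + y :: complex)"
  and algebraic_int_mult [intro]: "algebraic_int x \<Longrightarrow> algebraic_int y \<Longrightarrow> algebraic_int (x * y :: complex)"
  using algebraic_int_add_mult by blast+

lemma algebraic_int_diff [intro]: "algebraic_int x \<Longrightarrow> algebraic_int y \<Longrightarrow> algebraic_int (x - y :: complex)"
  using algebraic_int_add[of x "- y"] by auto

lemma algebraic_int_power [intro]: "algebraic_int x \<Longrightarrow> algebraic_int (x ^ n :: complex)"
  by (induction n) auto

lemma algebraic_int_sum [intro]: "(\<And>i. i \<in> I \<Longrightarrow> algebraic_int (f i)) \<Longrightarrow> algebraic_int (\<Sum>i\<in>I. f i :: complex)"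
  by (induction I rule: infinite_finite_induct) auto

lemma algebraic_int_prod [intro]: "(\<And>i. i \<in> I \<Longrightarrow> algebraic_int (f i)) \<Longrightarrow> algebraic_int (\<Prod>i\<in>I. f i :: complex)"
  by (induction I rule: infinite_finite_induct) auto

lemma algebraic_int_of_int [simp, intro]: "algebraic_int (of_int n :: complex)"
  by (rule int_imp_algebraic_int) auto

lemma algebraic_int_of_nat [simp, intro]: "algebraic_int (of_nat n :: complex)"
  by (rule int_imp_algebraic_int) auto

lemma algebraic_int_numeral [simp, intro]: "algebraic_int (numeral n :: complex)"
  by (rule int_imp_algebraic_int) auto

lemma algebraic_int_one [simp, intro]: "algebraic_int (1 :: complex)"
  by (rule int_imp_algebraic_int) auto

section \<open>Polynomials over a subfield and primitive elements\<close>

lemma subfield_0: "subfield L \<Longrightarrow> 0 \<in> L" and subfield_1: "subfield L \<Longrightarrow> 1 \<in> L"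
  and subfield_add: "subfield L \<Longrightarrow> x \<in> L \<Longrightarrow> y \<in> L \<Longrightarrow> x + y \<in> L"
  and subfield_mult: "subfield L \<Longrightarrow> x \<in> L \<Longrightarrow> y \<in> L \<Longrightarrow> x * y \<in> L"
  and subfield_minus: "subfield L \<Longrightarrow> x \<in> L \<Longrightarrow> - x \<in> L"
  unfolding subfield_def by auto

lemma subfield_diff: "subfield L \<Longrightarrow> x \<in> L \<Longrightarrow> y \<in> L \<Longrightarrow> x - y \<in> L"
  using subfield_add[of L x "- y"] subfield_minus[of L y] by simp

lemma subfield_inverse: "subfield L \<Longrightarrow> x \<in> L \<Longrightarrow> inverse x \<in> L"
  unfolding subfield_def by (cases "x = 0") auto

lemma subfield_divide: "subfield L \<Longrightarrow> x \<in> L \<Longrightarrow> y \<in> L \<Longrightarrow> x / y \<in> L"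
  by (simp add: divide_inverse subfield_mult subfield_inverse)

lemma subfield_sum: "subfield L \<Longrightarrow> (\<And>i. i \<in> I \<Longrightarrow> f i \<in> L) \<Longrightarrow> (\<Sum>i\<in>I. f i) \<in> L"
  by (induction I rule: infinite_finite_induct) (auto intro: subfield_0 subfield_add)

lemma subfield_prod: "subfield L \<Longrightarrow> (\<And>i. i \<in> I \<Longrightarrow> f i \<in> L) \<Longrightarrow> (\<Prod>i\<in>I. f i) \<in> L"
  by (induction I rule: infinite_finite_induct) (auto intro: subfield_1 subfield_mult)

lemma subfield_power: "subfield L \<Longrightarrow> x \<in> L \<Longrightarrow> x ^ n \<in> L"
  by (induction n) (auto intro: subfield_1 subfield_mult)

lemma subfield_of_nat: "subfield L \<Longrightarrow> of_nat n \<in> L"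
  by (induction n) (auto intro: subfield_0 subfield_1 subfield_add)

lemma subfield_of_int: "subfield L \<Longrightarrow> of_int n \<in> L"
  by (cases n) (auto intro!: subfield_of_nat subfield_minus subfield_diff subfield_1)

lemma subfield_numeral: "subfield L \<Longrightarrow> numeral n \<in> L"
  using subfield_of_nat[of L "numeral n"] by simp

lemma subfield_Rats: "subfield L \<Longrightarrow> \<rat> \<subseteq> L"
proof
  fix x :: complex assume L: "subfield L" and "x \<in> \<rat>"
  then obtain a b where "x = of_int a / of_int b" by (auto elim: Rats_cases')
  thus "x \<in> L" using L by (auto intro: subfield_divide subfield_of_int)
qed

lemma subfield_rat: "subfield (\<rat> :: complex set)"
  unfolding subfield_def by auto

section \<open>Polynomials with coefficients in a subfield, and minimal polynomials\<close>

definition poly_over :: "complex set \<Rightarrow> complex poly \<Rightarrow> bool" where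
  "poly_over L p \<longleftrightarrow> (\<forall>i. coeff p i \<in> L)"

lemma poly_over_mono: "poly_over L p \<Longrightarrow> L \<subseteq> M \<Longrightarrow> poly_over M p"
  unfolding poly_over_def by auto

context
  fixes L assumes L: "subfield L"
begin

lemma poly_over_0: "poly_over L 0" unfolding poly_over_def using subfield_0[OF L] by simp

lemma poly_over_pCons: "a \<in> L \<Longrightarrow> poly_over L p \<Longrightarrow> poly_over L (pCons a p)"
  unfolding poly_over_def by (auto simp: coeff_pCons split: nat.split)

lemma poly_over_1: "poly_over L 1"
  unfolding one_pCons by (intro poly_over_pCons subfield_1[OF L] poly_over_0)

lemma poly_over_add: "poly_over L p \<Longrightarrow> poly_over L q \<Longrightarrow> poly_over L (p + q)"
  unfolding poly_over_def using subfield_add[OF L] by simp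

lemma poly_over_diff: "poly_over L p \<Longrightarrow> poly_over L q \<Longrightarrow> poly_over L (p - q)"
  unfolding poly_over_def using subfield_diff[OF L] by simp

lemma poly_over_mult: "poly_over L p \<Longrightarrow> poly_over L q \<Longrightarrow> poly_over L (p * q)"
  unfolding poly_over_def coeff_mult using subfield_mult[OF L] by (auto intro!: subfield_sum[OF L])

lemma poly_over_smult: "a \<in> L \<Longrightarrow> poly_over L p \<Longrightarrow> poly_over L (Polynomial.smult a p)"
  unfolding poly_over_def using subfield_mult[OF L] by simp

lemma poly_over_monom: "a \<in> L \<Longrightarrow> poly_over L (monom a n)"
  unfolding poly_over_def using subfield_0[OF L] by simp

lemma poly_over_pderiv: "poly_over L p \<Longrightarrow> poly_over L (pderiv p)"
  unfolding poly_over_def coeff_pderiv using subfield_mult[OF L] subfield_of_nat[OF L] by (metis)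

lemma poly_over_pcompose: "poly_over L p \<Longrightarrow> poly_over L q \<Longrightarrow> poly_over L (pcompose p q)"
proof (induction p)
  case 0 thus ?case by (simp add: poly_over_0)
next
  case (pCons a p)
  hence "a \<in> L" "poly_over L p" unfolding poly_over_def by (metis coeff_pCons_0, metis coeff_pCons_Suc)
  thus ?case using pCons by (simp add: pcompose_pCons poly_over_add poly_over_mult poly_over_pCons poly_over_0)
qed

lemma poly_in_subfield: "poly_over L p \<Longrightarrow> x \<in> L \<Longrightarrow> poly p x \<in> L"
  unfolding poly_altdef poly_over_def using subfield_mult[OF L] subfield_power[OF L]
  by (auto intro!: subfield_sum[OF L])

lemma poly_over_division:
  assumes "poly_over L p" "poly_over L m" "m \<noteq> 0"
  shows "\<exists>q r. poly_over L q \<and> poly_over L r \<and> p = q * m + r \<and> (r = 0 \<or> degree r < degree m)"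
  using assms(1)
proof (induction "degree p" arbitrary: p rule: less_induct)
  case less
  show ?case
  proof (cases "degree p < degree m \<or> p = 0")
    case True
    show ?thesis using True less.prems by (intro exI[of _ 0] exI[of _ p]) (auto simp: poly_over_0)
  next
    case False
    define a where "a = lead_coeff p / lead_coeff m"
    have aL: "a \<in> L" unfolding a_def using less.prems assms(2) subfield_divide[OF L] unfolding poly_over_def by blast
    define t where "t = monom a (degree p - degree m)"
    have a0: "a \<noteq> 0" using False assms(3) unfolding a_def by auto
    have t: "poly_over L t" unfolding t_def using aL by (rule poly_over_monom)
    define p' where "p' = p - t * m"
    have p': "poly_over L p'" unfolding p'_def using less.prems t assms(2) by (intro poly_over_diff poly_over_mult)
    have dt: "degree t = degree p - degree m" unfolding t_def by (rule degree_monom_eq[OF a0])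
    have "t \<noteq> 0" unfolding t_def using a0 by simp
    hence deg: "degree (t * m) = degree p" using False assms(3) dt by (simp add: degree_mult_eq)
    have lc: "lead_coeff (t * m) = lead_coeff p"
    proof -
      have "lead_coeff t = a" using dt unfolding t_def by simp
      thus ?thesis using assms(3) unfolding lead_coeff_mult a_def by simp
    qed
    have c0: "coeff p' (degree p) = 0" unfolding p'_def using lc deg by simp
    have dle: "degree p' \<le> degree p" unfolding p'_def using deg by (intro degree_diff_le) auto
    show ?thesis
    proof (cases "p' = 0")
      case True
      show ?thesis using True t by (intro exI[of _ t] exI[of _ 0]) (auto simp: poly_over_0 p'_def)
    next
      case False
      have "degree p' < degree p" using dle c0 False
        by (metis le_neq_implies_less leading_coeff_0_iff)
      from less.hyps[OF this p'] obtain q r where qr: "poly_over L q" "poly_over L r" "p' = q * m + r"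
        "r = 0 \<or> degree r < degree m" by blast
      show ?thesis using qr t by (intro exI[of _ "q + t"] exI[of _ r])
        (auto simp: poly_over_add p'_def algebra_simps)
    qed
  qed
qed

definition is_minpoly :: "complex poly \<Rightarrow> complex \<Rightarrow> bool" where
  "is_minpoly m x \<longleftrightarrow> poly_over L m \<and> lead_coeff m = 1 \<and> poly m x = 0 \<and>
     (\<forall>p. poly_over L p \<and> p \<noteq> 0 \<and> poly p x = 0 \<longrightarrow> degree m \<le> degree p)"

lemma is_minpoly_ex:
  assumes "poly_over L p" "p \<noteq> 0" "poly p x = 0"
  shows "\<exists>m. is_minpoly m x"
proof -
  define P where "P = (\<lambda>q. poly_over L q \<and> q \<noteq> 0 \<and> poly q x = 0)"
  define q where "q = arg_min degree P"
  have q: "P q" "\<And>r. P r \<Longrightarrow> degree q \<le> degree r"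
    unfolding q_def using arg_min_nat_lemma[of P p degree] assms by (auto simp: P_def)
  define m where "m = Polynomial.smult (inverse (lead_coeff q)) q"
  have "inverse (lead_coeff q) \<in> L" using q(1) subfield_inverse[OF L] unfolding P_def poly_over_def by auto
  hence "is_minpoly m x" using q unfolding is_minpoly_def m_def P_def by (auto intro: poly_over_smult)
  thus ?thesis ..
qed

lemma is_minpoly_dvd:
  assumes "is_minpoly m x" "poly_over L p" "poly p x = 0"
  shows "\<exists>q. poly_over L q \<and> p = q * m"
proof -
  have "m \<noteq> 0" using assms(1) unfolding is_minpoly_def by auto
  then obtain q r where qr: "poly_over L q" "poly_over L r" "p = q * m + r"
        "r = 0 \<or> degree r < degree m"
    using poly_over_division[OF assms(2)] assms(1) unfolding is_minpoly_def by metis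
  have "poly r x = 0" using qr(3) assms(1,3) unfolding is_minpoly_def by simp
  hence "r = 0" using qr(2,4) assms(1) unfolding is_minpoly_def by force
  thus ?thesis using qr by auto
qed

text \<open>The minimal polynomial \<open>n\<close> of \<open>y\<close> divides \<open>m\<close>.
  The cofactor has smaller degree than \<open>m\<close>, so it cannot vanish at \<open>x\<close>;
  hence \<open>n\<close> does, and minimality of \<open>m\<close> at \<open>x\<close> bounds the
  degree of \<open>n\<close> from below.\<close>

lemma is_minpoly_root:
  assumes "is_minpoly m x" "poly m y = 0"
  shows "is_minpoly m y"
proof -
  have m: "poly_over L m" "lead_coeff m = 1" "m \<noteq> 0" "poly m x = 0" using assms(1) unfolding is_minpoly_def by auto
  obtain n where n: "is_minpoly n y" using is_minpoly_ex[OF m(1,3) assms(2)] ..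
  obtain q where q: "poly_over L q" "m = q * n" using is_minpoly_dvd[OF n m(1) assms(2)] by auto
  have nz: "n \<noteq> 0" "q \<noteq> 0" using q(2) m by auto
  have dn: "degree n > 0"
  proof (rule ccontr)
    assume "\<not> degree n > 0"
    then obtain a where "n = [:a:]" using degree_eq_zeroE by blast
    with n show False unfolding is_minpoly_def by auto
  qed
  have "poly q x \<noteq> 0"
  proof
    assume "poly q x = 0"
    hence "degree m \<le> degree q" using assms(1) q(1) nz unfolding is_minpoly_def by auto
    thus False using dn nz q(2) by (simp add: degree_mult_eq)
  qed
  hence "poly n x = 0" using q(2) m(4) by simp
  hence "degree m \<le> degree n" using assms(1) n nz unfolding is_minpoly_def by auto
  thus ?thesis using n m assms(2) unfolding is_minpoly_def by auto
qed

lemma is_minpoly_degree: "is_minpoly m x \<Longrightarrow> degree m > 0"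
proof (rule ccontr)
  assume m: "is_minpoly m x" "\<not> degree m > 0"
  then obtain a where "m = [:a:]" using degree_eq_zeroE by blast
  with m show False unfolding is_minpoly_def by auto
qed

text \<open>A double root would also be a root of the derivative, which is too small in degree
  because \<open>m\<close> is minimal at each of its roots.\<close>

lemma is_minpoly_rsquarefree:
  assumes "is_minpoly m x"
  shows "rsquarefree m"
  unfolding rsquarefree_roots
proof (intro allI notI, elim conjE)
  fix y assume y: "poly m y = 0" "poly (pderiv m) y = 0"
  have my: "is_minpoly m y" using is_minpoly_root[OF assms y(1)] .
  have d: "degree m > 0" using is_minpoly_degree[OF assms] .
  hence "pderiv m \<noteq> 0" by (auto simp: pderiv_eq_0_iff)
  hence "degree m \<le> degree (pderiv m)"
    using my y(2) poly_over_pderiv unfolding is_minpoly_def by blast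
  thus False using d by (simp add: degree_pderiv)
qed

lemma is_minpoly_prod:
  assumes "is_minpoly m x"
  shows "m = (\<Prod>z|poly m z = 0. [:-z, 1:])"
  using complex_poly_decompose_rsquarefree[OF is_minpoly_rsquarefree[OF assms]] assms
  unfolding is_minpoly_def by simp

end

section \<open>Simple extensions, primitive elements and integral generators\<close>

definition adj :: "complex \<Rightarrow> complex set" where
  "adj x = {poly h x | h. poly_over \<rat> h}"

lemma number_field_subfield: "number_field K \<Longrightarrow> subfield K"
  unfolding number_field_def by auto

text \<open>Multiplication by \<open>x\<close> maps the finite spanning set \<open>B\<close> into
  its rational span, so \<open>module_char_poly\<close> applies.\<close>

lemma number_field_algebraic:
  assumes "number_field K" "x \<in> K"
  shows "\<exists>p. poly_over \<rat> p \<and> p \<noteq> 0 \<and> poly p x = 0"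
proof -
  obtain B where B: "finite B" "B \<subseteq> K" and sp: "\<And>x. x \<in> K \<Longrightarrow> \<exists>c :: complex \<Rightarrow> rat. x = (\<Sum>b\<in>B. of_rat (c b) * b)"
    and K: "subfield K" using assms unfolding number_field_def by metis
  obtain c1 :: "complex \<Rightarrow> rat" where c1: "1 = (\<Sum>b\<in>B. of_rat (c1 b) * b)" using sp[OF subfield_1[OF K]] by auto
  have "\<exists>b\<in>B. b \<noteq> 0"
  proof (rule ccontr)
    assume "\<not> ?thesis"
    hence "(\<Sum>b\<in>B. of_rat (c1 b) * b) = 0" by (intro sum.neutral) auto
    thus False using c1 by simp
  qed
  then obtain b0 where b0: "b0 \<in> B" "b0 \<noteq> 0" by auto
  have "\<forall>b\<in>B. \<exists>c :: complex \<Rightarrow> rat. x * b = (\<Sum>j\<in>B. of_rat (c j) * j)"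
    by (intro ballI sp subfield_mult[OF K assms(2)]) (use B(2) in auto)
  then obtain c :: "complex \<Rightarrow> complex \<Rightarrow> rat" where c: "\<And>b. b \<in> B \<Longrightarrow> x * b = (\<Sum>j\<in>B. of_rat (c b j) * j)" by metis
  have hom: "comm_ring_hom (of_rat :: rat \<Rightarrow> complex)"
    by unfold_locales (auto simp: of_rat_add of_rat_mult)
  obtain p where p: "lead_coeff p = 1" "poly (map_poly (of_rat :: rat \<Rightarrow> complex) p) x = 0"
    using module_char_poly[OF hom B(1) b0(1), of "\<lambda>b. b" x c] b0(2) c by auto
  have "coeff (map_poly (of_rat :: rat \<Rightarrow> complex) p) (degree p) = 1"
    using p(1) by (simp add: coeff_map_poly)
  hence "map_poly (of_rat :: rat \<Rightarrow> complex) p \<noteq> 0" by (metis coeff_0 zero_neq_one)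
  moreover have "poly_over \<rat> (map_poly (of_rat :: rat \<Rightarrow> complex) p)"
    unfolding poly_over_def by (simp add: coeff_map_poly)
  ultimately show ?thesis using p(2) by blast
qed

lemma adj_self: "x \<in> adj x" unfolding adj_def
  by (auto intro!: exI[of _ "[:0,1:]"] poly_over_pCons poly_over_0 subfield_rat)

lemma adj_subset: "subfield K \<Longrightarrow> x \<in> K \<Longrightarrow> adj x \<subseteq> K"
  unfolding adj_def using poly_in_subfield poly_over_mono subfield_Rats by blast

lemma adj_subset_adj: "y \<in> adj x \<Longrightarrow> adj y \<subseteq> adj x"
proof
  fix z assume "y \<in> adj x" "z \<in> adj y"
  then obtain h g where "poly_over \<rat> h" "poly_over \<rat> g" "y = poly h x" "z = poly g y" unfolding adj_def by auto
  thus "z \<in> adj x" unfolding adj_def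
    by (auto intro!: exI[of _ "pcompose g h"] simp: poly_pcompose poly_over_pcompose subfield_rat)
qed

lemma adj_subfield:
  assumes K: "number_field K" "x \<in> K"
  shows "subfield (adj x)"
proof -
  have inv: "inverse y \<in> adj x" if y: "y \<in> adj x" "y \<noteq> 0" for y
  proof -
    have "y \<in> K" using adj_subset[OF number_field_subfield[OF K(1)] K(2)] y by auto
    then obtain p where p: "is_minpoly \<rat> p y"
      using number_field_algebraic[OF K(1)] is_minpoly_ex[OF subfield_rat] by metis
    obtain a q where pq: "p = pCons a q" by (cases p)
    have p': "poly_over \<rat> p" "poly p y = 0" "p \<noteq> 0" using p unfolding is_minpoly_def[OF subfield_rat] by auto
    have q: "poly_over \<rat> q" using p'(1) unfolding pq poly_over_def by (metis coeff_pCons_Suc)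
    have a: "a \<in> \<rat>" using p'(1) unfolding pq poly_over_def by (metis coeff_pCons_0)
    have "q \<noteq> 0" using p'(2,3) unfolding pq by auto
    have "a \<noteq> 0"
    proof
      assume "a = 0"
      hence "poly q y = 0" using p'(2) y unfolding pq by simp
      hence "degree p \<le> degree q" using p q \<open>q \<noteq> 0\<close> unfolding is_minpoly_def[OF subfield_rat] by blast
      thus False using \<open>q \<noteq> 0\<close> unfolding pq by simp
    qed
    \<comment> \<open>With p = a + X q and p(y) = 0, the product of y and q(y) is -a, which is
      nonzero by minimality.\<close>
    have "inverse y = poly (Polynomial.smult (- inverse a) q) y"
      using p'(2) y \<open>a \<noteq> 0\<close> unfolding pq by (simp add: field_simps eq_neg_iff_add_eq_0)
    moreover have "poly_over \<rat> (Polynomial.smult (- inverse a) q)" using q a by (intro poly_over_smult subfield_rat) auto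
    ultimately have "inverse y \<in> adj y" unfolding adj_def by blast
    thus ?thesis using adj_subset_adj[OF y(1)] by auto
  qed
  show ?thesis unfolding subfield_def
  proof (intro conjI ballI impI)
    show "0 \<in> adj x" unfolding adj_def by (auto intro!: exI[of _ 0] poly_over_0 subfield_rat)
    show "1 \<in> adj x" unfolding adj_def by (auto intro!: exI[of _ 1] poly_over_1 subfield_rat)
    fix y assume y: "y \<in> adj x"
    then obtain h where h: "poly_over \<rat> h" "y = poly h x" unfolding adj_def by auto
    have "- y = poly (0 - h) x" using h by simp
    thus "- y \<in> adj x" unfolding adj_def using poly_over_diff[OF subfield_rat poly_over_0[OF subfield_rat] h(1)] by blast
    show "y \<noteq> 0 \<Longrightarrow> inverse y \<in> adj x" using inv y by auto
    fix z assume "z \<in> adj x"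
    then obtain g where g: "poly_over \<rat> g" "z = poly g x" unfolding adj_def by auto
    have "y + z = poly (h + g) x" "y * z = poly (h * g) x" using h g by auto
    thus "y + z \<in> adj x" "y * z \<in> adj x" unfolding adj_def
      using poly_over_add[OF subfield_rat h(1) g(1)] poly_over_mult[OF subfield_rat h(1) g(1)] by blast+
  qed
qed

text \<open>The generator is c = a + n b, with n outside the finite set \<open>S\<close> of ratios
  (u - a) / (b - v) for roots u of \<open>f\<close> and v of \<open>g\<close>. Over
  \<open>adj c\<close>, both g(X) and f(c - n X) vanish at b, and the choice of n leaves them no
  other common root; so the minimal polynomial of b is X - b.\<close>

lemma adjoin_two:
  assumes K: "number_field K" and ab: "a \<in> K" "b \<in> K"
  shows "\<exists>c\<in>K. a \<in> adj c \<and> b \<in> adj c"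
proof -
  note subfield_K = number_field_subfield[OF K]
  obtain f where f: "poly_over \<rat> f" "f \<noteq> 0" "poly f a = 0"
    using number_field_algebraic[OF K ab(1)] by auto
  obtain g where g: "poly_over \<rat> g" "g \<noteq> 0" "poly g b = 0"
    using number_field_algebraic[OF K ab(2)] by auto
  define S where "S = (\<lambda>(u,v). (u - a) / (b - v)) ` ({u. poly f u = 0} \<times> {v. poly g v = 0})"
  have "finite S" unfolding S_def using poly_roots_finite f(2) g(2) by auto
  moreover have "infinite (of_nat ` {1..} :: complex set)"
    using finite_imageD[of "of_nat :: nat \<Rightarrow> complex" "{1..}"] infinite_Ici[of "1::nat"] by (auto simp: inj_on_def)
  ultimately obtain n where n: "n \<ge> 1" "(of_nat n :: complex) \<notin> S"
    by (metis (no_types, lifting) atLeast_iff finite_subset imageE subsetI)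
  define c where "c = a + of_nat n * b"
  have cK: "c \<in> K" unfolding c_def using ab subfield_K by (auto intro: subfield_add subfield_mult subfield_of_nat)
  note L = adj_subfield[OF K cK]
  have gL: "poly_over (adj c) g" using poly_over_mono[OF g(1) subfield_Rats[OF L]] .
  define h where "h = pcompose f [:c, - of_nat n:]"
  have hL: "poly_over (adj c) h" unfolding h_def
    by (intro poly_over_pcompose[OF L] poly_over_pCons[OF L] poly_over_0[OF L] adj_self
        poly_over_mono[OF f(1) subfield_Rats[OF L]] subfield_minus[OF L] subfield_of_nat[OF L])
  have hb: "poly h b = 0" unfolding h_def using f(3) by (simp add: poly_pcompose c_def algebra_simps)
  obtain m where m: "is_minpoly (adj c) m b" using is_minpoly_ex[OF L gL g(2,3)] ..
  have "v = b" if v: "poly m v = 0" for v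
  proof (rule ccontr)
    assume nb: "v \<noteq> b"
    have "poly g v = 0" using is_minpoly_dvd[OF L m gL g(3)] v by auto
    moreover have "poly h v = 0" using is_minpoly_dvd[OF L m hL hb] v by auto
    hence "poly f (c - of_nat n * v) = 0" unfolding h_def by (simp add: poly_pcompose mult.commute)
    ultimately have "((c - of_nat n * v) - a) / (b - v) \<in> S" unfolding S_def by auto
    moreover have "((c - of_nat n * v) - a) / (b - v) = of_nat n" using nb unfolding c_def by (simp add: field_simps)
    ultimately show False using n by simp
  qed
  hence "{z. poly m z = 0} = {b}" using m unfolding is_minpoly_def[OF L] by auto
  hence "m = [:-b, 1:]" using is_minpoly_prod[OF L m] by simp
  hence "coeff m 0 = - b" by simp
  hence bL: "b \<in> adj c" using m subfield_minus[OF L, of "-b"] unfolding is_minpoly_def[OF L] poly_over_def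
    by (metis minus_minus)
  moreover have "a = c - of_nat n * b" unfolding c_def by simp
  hence "a \<in> adj c" using bL adj_self L by (metis subfield_diff subfield_mult subfield_of_nat)
  ultimately show ?thesis using cK by auto
qed

lemma primitive_element:
  assumes K: "number_field K"
  shows "\<exists>c\<in>K. K = adj c"
proof -
  note subfield_K = number_field_subfield[OF K]
  obtain B where B: "finite B" "B \<subseteq> K" and sp: "\<And>x. x \<in> K \<Longrightarrow> \<exists>c :: complex \<Rightarrow> rat. x = (\<Sum>b\<in>B. of_rat (c b) * b)"
    using K unfolding number_field_def by metis
  have "\<exists>c\<in>K. B \<subseteq> adj c" using B
  proof (induction B)
    case empty thus ?case using subfield_0[OF subfield_K] by auto
  next
    case (insert b B)
    then obtain c where c: "c \<in> K" "B \<subseteq> adj c" by auto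
    obtain e where e: "e \<in> K" "b \<in> adj e" "c \<in> adj e" using adjoin_two[OF K c(1), of b] insert.prems by auto
    thus ?case using c adj_subset_adj[OF e(3)] by auto
  qed
  then obtain c where c: "c \<in> K" "B \<subseteq> adj c" by auto
  note L = adj_subfield[OF K c(1)]
  have "x \<in> adj c" if "x \<in> K" for x
  proof -
    obtain e :: "complex \<Rightarrow> rat" where "x = (\<Sum>b\<in>B. of_rat (e b) * b)" using sp[OF \<open>x \<in> K\<close>] by auto
    moreover have "(of_rat r :: complex) \<in> adj c" for r using subfield_Rats[OF L] by auto
    ultimately show ?thesis using c(2) by (auto intro!: subfield_sum[OF L] subfield_mult[OF L])
  qed
  thus ?thesis using adj_subset[OF subfield_K c(1)] c(1) by auto
qed

text \<open>If an integer polynomial of degree n with leading coefficient a vanishes at x, the group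
  spanned by 1, x, ..., x^(n-1) is stable under multiplication by a x, because a x^n is an integral
  combination of lower powers.\<close>

lemma algebraic_int_scale:
  assumes "poly_over \<rat> p" "p \<noteq> 0" "poly p (x::complex) = 0"
  shows "\<exists>n::int. n \<noteq> 0 \<and> algebraic_int (of_int n * x)"
proof -
  have "algebraic x" unfolding algebraic_altdef using assms unfolding poly_over_def by blast
  then obtain q :: "int poly" where q: "q \<noteq> 0" "poly (map_poly of_int q) x = 0"
    using algebraicE' by metis
  define n where "n = degree q"
  define a where "a = lead_coeff q"
  have a: "a \<noteq> 0" using q unfolding a_def by auto
  have n0: "n > 0"
  proof (rule ccontr)
    assume "\<not> n > 0"
    then obtain e where "q = [:e:]" unfolding n_def using degree_eq_zeroE by blast
    with q show False by simp
  qed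
  have "(\<Sum>i\<le>n. of_int (coeff q i) * x ^ i) = 0"
    using q(2) unfolding poly_altdef n_def by (simp add: coeff_map_poly)
  moreover have "(\<Sum>i\<le>n. of_int (coeff q i) * x ^ i) = (\<Sum>i<n. of_int (coeff q i) * x ^ i) + of_int a * x ^ n"
    unfolding a_def n_def[symmetric] by (simp add: lessThan_Suc_atMost[symmetric])
  ultimately have "of_int a * x ^ n = - (\<Sum>i<n. of_int (coeff q i) * x ^ i)"
    by (metis add_eq_0_iff)
  also have "\<dots> = (\<Sum>i<n. of_int (- coeff q i) * x ^ i)"
    by (subst sum_negf[symmetric], intro sum.cong) auto
  finally have *: "of_int a * x ^ n = (\<Sum>i<n. of_int (- coeff q i) * x ^ i)" .
  have "algebraic_int (of_int a * x)"
  proof (rule algebraic_int_module[of "{..<n}" 0 "\<lambda>i. x ^ i"])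
    fix i assume i: "i \<in> {..<n}"
    show "\<exists>c. of_int a * x * x ^ i = (\<Sum>j<n. of_int (c j) * x ^ j)"
    proof (cases "Suc i < n")
      case True
      have "of_int a * x * x ^ i = (\<Sum>j<n. of_int (if j = Suc i then a else 0) * x ^ j)"
        using True by (simp add: if_distrib[of "\<lambda>z. of_int z * _"] sum.delta' cong: if_cong)
      thus ?thesis by (rule exI[of _ "\<lambda>j. if j = Suc i then a else 0"])
    next
      case False
      hence "n = Suc i" using i by simp
      hence "of_int a * x * x ^ i = (\<Sum>j<n. of_int (- coeff q j) * x ^ j)"
        using * by (simp add: mult_ac)
      thus ?thesis by (rule exI[of _ "\<lambda>j. - coeff q j"])
    qed
  qed (use n0 in auto)
  thus ?thesis using a by auto
qed

lemma primitive_integer: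
  assumes K: "number_field K"
  shows "\<exists>c\<in>K. algebraic_int c \<and> K = adj c"
proof -
  obtain c where c: "c \<in> K" "K = adj c" using primitive_element[OF K] by auto
  obtain p where "poly_over \<rat> p" "p \<noteq> 0" "poly p c = 0" using number_field_algebraic[OF K c(1)] by auto
  then obtain n :: int where n: "n \<noteq> 0" "algebraic_int (of_int n * c)" using algebraic_int_scale by blast
  note subfield_K = number_field_subfield[OF K]
  have nK: "of_int n * c \<in> K" using c(1) subfield_K by (auto intro: subfield_mult subfield_of_int)
  note L = adj_subfield[OF K nK]
  have "c = (of_int n * c) / of_int n" using n by simp
  also have "\<dots> \<in> adj (of_int n * c)" by (intro subfield_divide[OF L] adj_self subfield_of_int[OF L])
  finally have "adj c \<subseteq> adj (of_int n * c)" by (rule adj_subset_adj)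
  thus ?thesis using n nK c(2) adj_subset[OF subfield_K nK] by auto
qed

section \<open>Embeddings of totally real fields\<close>

context
  fixes K \<tau> assumes K: "subfield K" and \<tau>: "embedding K \<tau>"
begin

lemma emb_1: "\<tau> 1 = 1" using \<tau> unfolding embedding_def by auto
lemma emb_add: "x \<in> K \<Longrightarrow> y \<in> K \<Longrightarrow> \<tau> (x + y) = \<tau> x + \<tau> y" using \<tau> unfolding embedding_def by auto
lemma emb_mult: "x \<in> K \<Longrightarrow> y \<in> K \<Longrightarrow> \<tau> (x * y) = \<tau> x * \<tau> y" using \<tau> unfolding embedding_def by auto
lemma emb_0: "\<tau> 0 = 0" using emb_add[of 0 0] subfield_0[OF K] by simp
lemma emb_minus: "x \<in> K \<Longrightarrow> \<tau> (- x) = - \<tau> x"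
  using emb_add[of x "- x"] subfield_minus[OF K] emb_0 by (simp add: eq_neg_iff_add_eq_0 add.commute)
lemma emb_diff: "x \<in> K \<Longrightarrow> y \<in> K \<Longrightarrow> \<tau> (x - y) = \<tau> x - \<tau> y"
  using emb_add[of x "- y"] subfield_minus[OF K] emb_minus by simp
lemma emb_of_nat: "\<tau> (of_nat n) = of_nat n"
  by (induction n) (simp_all add: emb_0 emb_1 emb_add subfield_1[OF K] subfield_of_nat[OF K])
lemma emb_of_int: "\<tau> (of_int n) = of_int n"
proof (cases n rule: int_cases2)
  case (nonneg m) thus ?thesis using emb_of_nat by simp
next
  case (nonpos m) thus ?thesis using emb_of_nat emb_minus[OF subfield_of_nat[OF K, of m]] by simp
qed
lemma emb_inverse: "x \<in> K \<Longrightarrow> \<tau> (inverse x) = inverse (\<tau> x)"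
proof (cases "x = 0")
  case False
  assume x: "x \<in> K"
  have "\<tau> x * \<tau> (inverse x) = 1"
    using emb_mult[OF x subfield_inverse[OF K x]] False emb_1 by simp
  thus ?thesis by (metis inverse_unique)
qed (simp add: emb_0)
lemma emb_rat: "x \<in> \<rat> \<Longrightarrow> \<tau> x = x"
proof -
  assume "x \<in> \<rat>"
  then obtain a b where x: "x = of_int a * inverse (of_int b)" by (auto elim: Rats_cases' simp: divide_inverse)
  show ?thesis unfolding x
    by (simp add: emb_mult emb_inverse emb_of_int subfield_of_int[OF K] subfield_inverse[OF K])
qed
lemma emb_sum: "(\<And>i. i \<in> I \<Longrightarrow> f i \<in> K) \<Longrightarrow> \<tau> (\<Sum>i\<in>I. f i) = (\<Sum>i\<in>I. \<tau> (f i))"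
  by (induction I rule: infinite_finite_induct) (auto simp: emb_0 emb_add subfield_sum[OF K])
lemma emb_power: "x \<in> K \<Longrightarrow> \<tau> (x ^ n) = \<tau> x ^ n"
  by (induction n) (auto simp: emb_1 emb_mult subfield_power[OF K])
lemma emb_poly: "poly_over \<rat> h \<Longrightarrow> x \<in> K \<Longrightarrow> \<tau> (poly h x) = poly h (\<tau> x)"
proof -
  assume h: "poly_over \<rat> h" and x: "x \<in> K"
  have c: "coeff h i \<in> K" "coeff h i \<in> \<rat>" for i using h subfield_Rats[OF K] unfolding poly_over_def by auto
  show ?thesis unfolding poly_altdef using x c
    by (subst emb_sum) (auto simp: subfield_mult[OF K] subfield_power[OF K] emb_mult emb_power emb_rat)
qed
lemma emb_algebraic_int: "x \<in> K \<Longrightarrow> algebraic_int x \<Longrightarrow> algebraic_int (\<tau> x)"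
proof -
  assume x: "x \<in> K" and "algebraic_int x"
  then obtain p :: "int poly" where p: "lead_coeff p = 1" "poly (map_poly of_int p) x = 0"
    unfolding algebraic_int_altdef_ipoly by auto
  have "poly_over \<rat> (map_poly of_int p)" unfolding poly_over_def by (simp add: coeff_map_poly)
  hence "poly (map_poly of_int p) (\<tau> x) = 0" using emb_poly[of "map_poly of_int p" x] p(2) x emb_0 by simp
  thus ?thesis unfolding algebraic_int_altdef_ipoly using p(1) by blast
qed

end

lemma poly_algebraic_int_prod:
  assumes "\<And>r. r \<in> I \<Longrightarrow> algebraic_int (f r :: complex)"
  shows "algebraic_int (coeff (\<Prod>r\<in>I. [:- f r, 1:]) i)"
  using assms
proof (induction I arbitrary: i rule: infinite_finite_induct)
  case (insert r I)
  have "(\<Prod>r\<in>insert r I. [:- f r, 1:]) = Polynomial.smult (- f r) (\<Prod>r\<in>I. [:- f r, 1:]) + pCons 0 (\<Prod>r\<in>I. [:- f r, 1:])"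
    using insert.hyps by (simp add: mult_pCons_left)
  thus ?case using insert by (cases i) (auto intro!: algebraic_int_diff algebraic_int_mult)
qed (auto simp: coeff_1)

lemma poly_coeff_bound:
  assumes "finite I" "\<And>r. r \<in> I \<Longrightarrow> norm (f r :: complex) \<le> C"
  shows "norm (coeff (\<Prod>r\<in>I. [:- f r, 1:]) i) \<le> (1 + C) ^ card I"
  using assms
proof (induction I arbitrary: i rule: finite_induct)
  case (insert r I)
  let ?P = "\<Prod>r\<in>I. [:- f r, 1:]"
  have C: "norm (f r) \<le> C" using insert.prems[of r] by auto
  hence "0 \<le> C" using norm_ge_zero[of "f r"] by linarith
  note C = C this
  have IH: "norm (coeff ?P i) \<le> (1 + C) ^ card I" for i using insert by simp
  have e: "(\<Prod>r\<in>insert r I. [:- f r, 1:]) = Polynomial.smult (- f r) ?P + pCons 0 ?P"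
    using insert.hyps by (simp add: mult_pCons_left)
  have "norm (coeff (pCons 0 ?P) i) \<le> (1 + C) ^ card I"
    using IH C by (cases i) auto
  moreover have "norm (coeff (Polynomial.smult (- f r) ?P) i) \<le> C * (1 + C) ^ card I"
    using IH[of i] C by (auto simp: norm_mult intro!: mult_mono)
  ultimately have "norm (coeff (\<Prod>r\<in>insert r I. [:- f r, 1:]) i) \<le> C * (1 + C) ^ card I + (1 + C) ^ card I"
    unfolding e coeff_add by (rule norm_triangle_mono[rotated])
  thus ?case using insert.hyps by (simp add: algebra_simps)
qed (auto simp: coeff_1)

lemma finite_polys:
  assumes "finite T"
  shows "finite {p :: 'a::zero poly. degree p \<le> d \<and> (\<forall>i. coeff p i \<in> T)}"
proof (rule finite_subset)
  show "{p :: 'a poly. degree p \<le> d \<and> (\<forall>i. coeff p i \<in> T)} \<subseteq> Poly ` {xs. set xs \<subseteq> T \<and> length xs \<le> Suc d}"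
  proof
    fix p :: "'a poly" assume p: "p \<in> {p. degree p \<le> d \<and> (\<forall>i. coeff p i \<in> T)}"
    have "set (coeffs p) \<subseteq> T" using p by (auto simp: coeffs_def)
    moreover have "length (coeffs p) \<le> Suc d" using p by (auto simp: length_coeffs_degree coeffs_def)
    ultimately show "p \<in> Poly ` {xs. set xs \<subseteq> T \<and> length xs \<le> Suc d}"
      by (intro image_eqI[of _ _ "coeffs p"]) auto
  qed
  show "finite (Poly ` {xs. set xs \<subseteq> T \<and> length xs \<le> Suc d})"
    using finite_lists_length_le[OF assms] by auto
qed

text \<open>Integrality of the generator places the order Z[\<theta>] inside the ring of integers;
  the pigeonhole arguments take place in that order.\<close>

locale tr_field =
  fixes K :: "complex set" and \<theta> :: complex
  assumes tr: "totally_real_field K" and \<theta>K: "\<theta> \<in> K" and \<theta>int: "algebraic_int \<theta>" and gen: "K = adj \<theta>"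
begin

lemma number_field_K: "number_field K" and subfield_K: "subfield K"
  using tr number_field_subfield unfolding totally_real_field_def by auto

text \<open>The embeddings \<open>\<sigma> r\<close> are indexed by the conjugates \<open>r \<in> R\<close> of the generator \<open>\<theta>\<close>; since they are
  real-valued, \<open>s r\<close> loses no information. The index \<open>\<theta>\<close> itself is the identity embedding.\<close>

definition mp where "mp = (SOME m. is_minpoly \<rat> m \<theta>)"
definition R where "R = {r. poly mp r = 0}"
definition d where "d = degree mp"
definition \<sigma> where "\<sigma> r x = poly (SOME h. poly_over \<rat> h \<and> poly h \<theta> = x) r"
definition s where "s r x = Re (\<sigma> r x)"

lemma mp: "is_minpoly \<rat> mp \<theta>"
  unfolding mp_def using number_field_algebraic[OF number_field_K \<theta>K] is_minpoly_ex[OF subfield_rat] by (metis someI_ex)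

lemma mp0: "mp \<noteq> 0" "lead_coeff mp = 1" "poly_over \<rat> mp" "poly mp \<theta> = 0"
  using mp unfolding is_minpoly_def[OF subfield_rat] by auto

lemma finite_R: "finite R" unfolding R_def using mp0 by (simp add: poly_roots_finite)

lemma \<theta>R: "\<theta> \<in> R" unfolding R_def using mp0 by simp

lemma mp_prod: "mp = (\<Prod>r\<in>R. [:-r, 1:])"
  using is_minpoly_prod[OF subfield_rat mp] unfolding R_def .

lemma card_R: "card R = d"
  unfolding d_def by (subst mp_prod) (simp add: degree_prod_sum_eq)

lemma d_pos: "d > 0" unfolding d_def using is_minpoly_degree[OF subfield_rat mp] .

lemma R_poly_0: "poly_over \<rat> h \<Longrightarrow> poly h \<theta> = 0 \<Longrightarrow> r \<in> R \<Longrightarrow> poly h r = 0"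
  using is_minpoly_dvd[OF subfield_rat mp] unfolding R_def by force

text \<open>Two polynomials over the rationals with the same value at \<theta> differ by a multiple
  of \<open>mp\<close>, so the choice made in the definition of \<open>\<sigma>\<close> has no
  effect at the roots of \<open>mp\<close>.\<close>

lemma \<sigma>_poly:
  assumes "poly_over \<rat> h" "r \<in> R"
  shows "\<sigma> r (poly h \<theta>) = poly h r"
proof -
  define g where "g = (SOME g. poly_over \<rat> g \<and> poly g \<theta> = poly h \<theta>)"
  have g: "poly_over \<rat> g \<and> poly g \<theta> = poly h \<theta>" unfolding g_def by (rule someI[of _ h]) (use assms in auto)
  have "poly (g - h) r = 0"
    using R_poly_0[of "g - h" r] g assms by (auto simp: poly_over_diff[OF subfield_rat])
  thus ?thesis unfolding \<sigma>_def g_def by simp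
qed

lemma in_K: "x \<in> K \<Longrightarrow> \<exists>h. poly_over \<rat> h \<and> x = poly h \<theta>"
  using gen unfolding adj_def by auto

lemma embedding_\<sigma>: "r \<in> R \<Longrightarrow> embedding K (\<sigma> r)"
  unfolding embedding_def
proof (intro conjI ballI)
  assume r: "r \<in> R"
  show "\<sigma> r 1 = 1" using \<sigma>_poly[OF poly_over_1[OF subfield_rat] r] by simp
  fix x y assume "x \<in> K" "y \<in> K"
  then obtain g h where gh: "poly_over \<rat> g" "poly_over \<rat> h" and x: "x = poly g \<theta>" and y: "y = poly h \<theta>"
    using in_K by metis
  show "\<sigma> r (x + y) = \<sigma> r x + \<sigma> r y" "\<sigma> r (x * y) = \<sigma> r x * \<sigma> r y"
    unfolding x y using \<sigma>_poly[OF poly_over_add[OF subfield_rat gh] r] \<sigma>_poly[OF poly_over_mult[OF subfield_rat gh] r]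
      \<sigma>_poly[OF gh(1) r] \<sigma>_poly[OF gh(2) r] by auto
qed

lemma embedding_is_\<sigma>:
  assumes "embedding K \<tau>"
  shows "\<exists>r\<in>R. \<forall>x\<in>K. \<tau> x = \<sigma> r x"
proof -
  have r: "\<tau> \<theta> \<in> R" unfolding R_def
    using emb_poly[OF subfield_K assms mp0(3) \<theta>K] mp0(4) emb_0[OF subfield_K assms] by simp
  have "\<tau> x = \<sigma> (\<tau> \<theta>) x" if x: "x \<in> K" for x
  proof -
    obtain h where h: "poly_over \<rat> h" "x = poly h \<theta>" using in_K[OF x] by auto
    show ?thesis unfolding h(2) \<sigma>_poly[OF h(1) r] by (rule emb_poly[OF subfield_K assms h(1) \<theta>K])
  qed
  thus ?thesis using r by blast
qed

lemma s_eq: "x \<in> K \<Longrightarrow> r \<in> R \<Longrightarrow> \<sigma> r x = of_real (s r x)"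
  using tr embedding_\<sigma> unfolding totally_real_field_def s_def by (metis of_real_Re)

lemma s_1: "r \<in> R \<Longrightarrow> s r 1 = 1"
  and s_0: "r \<in> R \<Longrightarrow> s r 0 = 0"
  and s_add: "r \<in> R \<Longrightarrow> x \<in> K \<Longrightarrow> y \<in> K \<Longrightarrow> s r (x + y) = s r x + s r y"
  and s_diff: "r \<in> R \<Longrightarrow> x \<in> K \<Longrightarrow> y \<in> K \<Longrightarrow> s r (x - y) = s r x - s r y"
  and s_minus: "r \<in> R \<Longrightarrow> x \<in> K \<Longrightarrow> s r (- x) = - s r x"
  and s_of_int: "r \<in> R \<Longrightarrow> s r (of_int n) = of_int n"
  using emb_1[OF subfield_K embedding_\<sigma>] emb_0[OF subfield_K embedding_\<sigma>] emb_add[OF subfield_K embedding_\<sigma>]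
    emb_diff[OF subfield_K embedding_\<sigma>] emb_minus[OF subfield_K embedding_\<sigma>] emb_of_int[OF subfield_K embedding_\<sigma>]
  unfolding s_def by auto

lemma s_numeral: "r \<in> R \<Longrightarrow> s r (numeral n) = numeral n"
  using s_of_int[of r "numeral n"] by simp

lemma s_mult: "r \<in> R \<Longrightarrow> x \<in> K \<Longrightarrow> y \<in> K \<Longrightarrow> s r (x * y) = s r x * s r y"
proof -
  assume a: "r \<in> R" "x \<in> K" "y \<in> K"
  have "complex_of_real (s r (x * y)) = of_real (s r x * s r y)"
    using emb_mult[OF subfield_K embedding_\<sigma>] s_eq a subfield_mult[OF subfield_K] by (metis of_real_mult)
  thus ?thesis using of_real_eq_iff by blast
qed

lemma s_power: "r \<in> R \<Longrightarrow> x \<in> K \<Longrightarrow> s r (x ^ n) = s r x ^ n"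
  by (induction n) (auto simp: s_1 s_mult subfield_power[OF subfield_K])

lemma s_sum: "r \<in> R \<Longrightarrow> (\<And>i. i \<in> I \<Longrightarrow> f i \<in> K) \<Longrightarrow> s r (\<Sum>i\<in>I. f i) = (\<Sum>i\<in>I. s r (f i))"
  by (induction I rule: infinite_finite_induct) (auto simp: s_0 s_add subfield_sum[OF subfield_K])

lemma s_prod: "r \<in> R \<Longrightarrow> (\<And>i. i \<in> I \<Longrightarrow> f i \<in> K) \<Longrightarrow> s r (\<Prod>i\<in>I. f i) = (\<Prod>i\<in>I. s r (f i))"
  by (induction I rule: infinite_finite_induct) (auto simp: s_1 s_mult subfield_prod[OF subfield_K])

lemma s_inverse: "r \<in> R \<Longrightarrow> x \<in> K \<Longrightarrow> s r (inverse x) = inverse (s r x)"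
proof (cases "x = 0")
  case False
  assume r: "r \<in> R" and x: "x \<in> K"
  have "s r x * s r (inverse x) = 1"
    using s_mult[OF r x subfield_inverse[OF subfield_K x]] False s_1[OF r] by simp
  thus ?thesis by (metis inverse_unique)
qed (simp add: s_0)

lemma s_divide: "r \<in> R \<Longrightarrow> x \<in> K \<Longrightarrow> y \<in> K \<Longrightarrow> s r (x / y) = s r x / s r y"
  by (simp add: divide_inverse s_mult s_inverse subfield_inverse[OF subfield_K])

lemma s_eq_0: "r \<in> R \<Longrightarrow> x \<in> K \<Longrightarrow> s r x = 0 \<longleftrightarrow> x = 0"
proof
  assume r: "r \<in> R" and x: "x \<in> K" and 0: "s r x = 0"
  show "x = 0"
  proof (rule ccontr)
    assume "x \<noteq> 0"
    hence "s r x * s r (inverse x) = 1"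
      using s_mult[OF r x subfield_inverse[OF subfield_K x]] s_1[OF r] by simp
    thus False using 0 by simp
  qed
qed (simp add: s_0)

lemma s_\<theta>: "x \<in> K \<Longrightarrow> x = of_real (s \<theta> x)"
proof -
  assume x: "x \<in> K"
  obtain h where h: "poly_over \<rat> h" "x = poly h \<theta>" using in_K[OF x] by auto
  show ?thesis using \<sigma>_poly[OF h(1) \<theta>R] s_eq[OF x \<theta>R] h(2) by simp
qed

lemma totally_positive_iff: "totally_positive K x \<longleftrightarrow> x \<in> K \<and> (\<forall>r\<in>R. s r x > 0)"
proof (intro iffI conjI ballI)
  assume t: "totally_positive K x"
  show "x \<in> K" using t unfolding totally_positive_def by auto
  fix r assume "r \<in> R"
  thus "s r x > 0" using t embedding_\<sigma> unfolding totally_positive_def s_def by auto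
next
  assume a: "x \<in> K \<and> (\<forall>r\<in>R. s r x > 0)"
  show "totally_positive K x" unfolding totally_positive_def
  proof (intro conjI allI impI)
    fix \<tau> assume "embedding K \<tau>"
    then obtain r where r: "r \<in> R" "\<forall>x\<in>K. \<tau> x = \<sigma> r x" using embedding_is_\<sigma> by blast
    thus "\<tau> x \<in> \<real>" "Re (\<tau> x) > 0" using a s_eq[of x r] by auto
  qed (use a in auto)
qed

lemma conj_poly_rational:
  assumes x: "x \<in> K"
  shows "poly_over \<rat> (\<Prod>r\<in>R. [:- \<sigma> r x, 1:])"
proof -
  \<comment> \<open>A Vandermonde matrix of the conjugates diagonalises multiplication by \<open>x\<close> in the basis of powers of \<open>\<theta>\<close>.\<close>
  have "\<forall>j. \<exists>h. poly_over \<rat> h \<and> degree h < d \<and> x * \<theta> ^ j = poly h \<theta>"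
  proof
    fix j
    obtain g where g: "poly_over \<rat> g" "x * \<theta> ^ j = poly g \<theta>"
      using in_K[of "x * \<theta> ^ j"] x \<theta>K by (auto simp: subfield_mult[OF subfield_K] subfield_power[OF subfield_K])
    obtain q h where qh: "poly_over \<rat> h" "g = q * mp + h" "h = 0 \<or> degree h < degree mp"
      using poly_over_division[OF subfield_rat g(1) mp0(3,1)] by auto
    show "\<exists>h. poly_over \<rat> h \<and> degree h < d \<and> x * \<theta> ^ j = poly h \<theta>"
      using qh g(2) mp0(4) d_pos unfolding d_def by (intro exI[of _ h]) auto
  qed
  then obtain h where h: "\<And>j. poly_over \<rat> (h j)" "\<And>j. degree (h j) < d" "\<And>j. x * \<theta> ^ j = poly (h j) \<theta>"
    by metis
  obtain f where f: "bij_betw f {..<d} R"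
    using ex_bij_betw_nat_finite[OF finite_R] card_R by (metis atLeast0LessThan)
  have fR: "f i \<in> R" if "i < d" for i using f that unfolding bij_betw_def by auto
  define V where "V = mat d d (\<lambda>(i,j). f i ^ j)"
  define M where "M = mat d d (\<lambda>(k,j). coeff (h j) k)"
  define D where "D = mat d d (\<lambda>(i,j). if i = j then \<sigma> (f i) x else 0)"
  have car: "V \<in> carrier_mat d d" "M \<in> carrier_mat d d" "D \<in> carrier_mat d d"
    unfolding V_def M_def D_def by auto
  have hr: "\<sigma> r x * r ^ j = (\<Sum>k<d. r ^ k * coeff (h j) k)" if r: "r \<in> R" for r j
  proof -
    have "\<sigma> r x * r ^ j = \<sigma> r x * \<sigma> r (\<theta> ^ j)"
      using \<sigma>_poly[OF poly_over_monom[OF subfield_rat, of 1 j] r] by (simp add: poly_monom)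
    also have "\<dots> = \<sigma> r (x * \<theta> ^ j)"
      using emb_mult[OF subfield_K embedding_\<sigma>[OF r] x] subfield_power[OF subfield_K \<theta>K] by simp
    also have "\<dots> = poly (h j) r" using \<sigma>_poly[OF h(1) r] h(3) by simp
    also have "\<dots> = (\<Sum>k\<le>degree (h j). coeff (h j) k * r ^ k)" by (simp add: poly_altdef)
    also have "\<dots> = (\<Sum>k<d. r ^ k * coeff (h j) k)"
      by (rule sum.mono_neutral_cong_left) (use h(2)[of j] in \<open>auto simp: coeff_eq_0\<close>)
    finally show ?thesis .
  qed
  have VM: "V * M = D * V"
  proof (rule eq_matI)
    fix i j assume "i < dim_row (D * V)" "j < dim_col (D * V)"
    hence ij: "i < d" "j < d" using car by auto
    have "(V * M) $$ (i,j) = (\<Sum>k<d. f i ^ k * coeff (h j) k)"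
      using ij unfolding V_def M_def by (simp add: scalar_prod_def atLeast0LessThan)
    also have "\<dots> = \<sigma> (f i) x * f i ^ j" using hr[OF fR[OF ij(1)]] by simp
    also have "\<dots> = (D * V) $$ (i,j)"
      using ij unfolding V_def D_def
      by (simp add: scalar_prod_def atLeast0LessThan if_distrib[of "\<lambda>z. z * _"] sum.delta cong: if_cong)
    finally show "(V * M) $$ (i,j) = (D * V) $$ (i,j)" .
  qed (use car in auto)
  \<comment> \<open>A kernel vector would list the coefficients of a nonzero polynomial of degree
    below \<open>d\<close> with \<open>d\<close> roots.\<close>
  have "det V \<noteq> 0"
  proof
    assume "det V = 0"
    then obtain v where v: "v \<in> carrier_vec d" "v \<noteq> 0\<^sub>v d" "V *\<^sub>v v = 0\<^sub>v d"
      using det_0_iff_vec_prod_zero_field[OF car(1)] by auto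
    define p where "p = (\<Sum>j<d. monom (v $ j) j)"
    have cp: "coeff p j = (if j < d then v $ j else 0)" for j
      unfolding p_def coeff_sum by (auto simp: if_distrib cong: if_cong)
    have "p \<noteq> 0"
    proof
      assume "p = 0"
      hence "v $ j = 0" if "j < d" for j using cp[of j] that by simp
      hence "v = 0\<^sub>v d" using v(1) by (intro eq_vecI) auto
      thus False using v by simp
    qed
    have "degree p < d"
    proof -
      have "degree p \<le> d - 1" by (rule degree_le) (auto simp: cp)
      thus ?thesis using d_pos by simp
    qed
    have "poly p r = 0" if r: "r \<in> R" for r
    proof -
      have "r \<in> f ` {..<d}" using f r unfolding bij_betw_def by auto
      then obtain i where i: "i < d" "f i = r" by auto
      have "poly p r = (\<Sum>j<d. f i ^ j * v $ j)" unfolding p_def poly_sum i(2) by (simp add: poly_monom mult.commute)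
      also have "\<dots> = (V *\<^sub>v v) $ i" using i v(1) unfolding V_def by (simp add: scalar_prod_def atLeast0LessThan)
      also have "\<dots> = 0" using v(3) i by simp
      finally show ?thesis .
    qed
    hence "card R \<le> card {r. poly p r = 0}" using \<open>p \<noteq> 0\<close> by (intro card_mono poly_roots_finite) auto
    also have "\<dots> \<le> degree p" using \<open>p \<noteq> 0\<close> by (rule card_poly_roots_bound)
    finally show False using \<open>degree p < d\<close> card_R by simp
  qed
  from det_non_zero_imp_unit[OF car(1) this, of "()"]
  obtain W where W: "W \<in> carrier_mat d d" "V * W = 1\<^sub>m d" "W * V = 1\<^sub>m d"
    unfolding Units_def ring_mat_def by auto
  have "D = D * (V * W)" unfolding W(2) using car by simp
  also have "\<dots> = (D * V) * W" using car W(1) by (simp add: assoc_mult_mat[of _ d d _ d _ d])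
  also have "\<dots> = V * M * W" unfolding VM ..
  finally have "D = V * M * W" .
  hence "similar_mat D M" using car W by (intro similar_matI[of _ _ V W d]) auto
  hence "char_poly M = char_poly D" using char_poly_similar by metis
  also have "\<dots> = (\<Prod>a\<leftarrow>diag_mat D. [:- a, 1:])"
    by (rule char_poly_upper_triangular[OF car(3)]) (auto simp: upper_triangular_def D_def)
  also have "diag_mat D = map (\<lambda>i. \<sigma> (f i) x) [0..<d]"
    unfolding diag_mat_def D_def by (auto intro!: map_cong)
  also have "(\<Prod>a\<leftarrow>map (\<lambda>i. \<sigma> (f i) x) [0..<d]. [:- a, 1:]) = (\<Prod>i<d. [:- \<sigma> (f i) x, 1:])"
    by (simp add: o_def prod.distinct_set_conv_list[symmetric] atLeast0LessThan)
  also have "\<dots> = (\<Prod>r\<in>R. [:- \<sigma> r x, 1:])"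
    using prod.reindex_bij_betw[OF f, of "\<lambda>r. [:- \<sigma> r x, 1:]"] by simp
  finally have eq: "char_poly M = (\<Prod>r\<in>R. [:- \<sigma> r x, 1:])" .
  have "\<forall>j k. \<exists>q. coeff (h j) k = (of_rat q :: complex)" using h(1) unfolding poly_over_def by (metis Rats_cases)
  then obtain q where q: "\<And>j k. coeff (h j) k = (of_rat (q j k) :: complex)" by metis
  define M' where "M' = mat d d (\<lambda>(k,j). q j k)"
  have M': "M' \<in> carrier_mat d d" "M = map_mat of_rat M'" unfolding M_def M'_def q by auto
  have hom: "comm_ring_hom (of_rat :: rat \<Rightarrow> complex)"
    by unfold_locales (auto simp: of_rat_add of_rat_mult)
  have "char_poly M = map_poly of_rat (char_poly M')" unfolding M'(2) by (rule comm_ring_hom.char_poly_hom[OF hom M'(1)])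
  thus ?thesis unfolding eq[symmetric] poly_over_def by (simp add: coeff_map_poly)
qed

lemma \<sigma>_algebraic_int: "x \<in> OK K \<Longrightarrow> r \<in> R \<Longrightarrow> algebraic_int (\<sigma> r x)"
  unfolding OK_def algebraic_integer_iff using emb_algebraic_int[OF subfield_K embedding_\<sigma>] by auto

lemma OK_K: "x \<in> OK K \<Longrightarrow> x \<in> K" unfolding OK_def by simp

lemma conj_poly_int:
  assumes x: "x \<in> OK K"
  shows "coeff (\<Prod>r\<in>R. [:- \<sigma> r x, 1:]) i \<in> \<int>"
proof (rule rational_algebraic_int_is_int)
  show "coeff (\<Prod>r\<in>R. [:- \<sigma> r x, 1:]) i \<in> \<rat>"
    using conj_poly_rational[OF OK_K[OF x]] unfolding poly_over_def by auto
  show "algebraic_int (coeff (\<Prod>r\<in>R. [:- \<sigma> r x, 1:]) i)"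
    by (rule poly_algebraic_int_prod) (use \<sigma>_algebraic_int[OF x] in auto)
qed

text \<open>Bounded conjugates bound the coefficients of the conjugate polynomial, which are
  integers; so only finitely many polynomials occur, and \<open>x\<close> is a root of one of
  them.\<close>

lemma finite_bounded: "finite {x \<in> OK K. \<forall>r\<in>R. \<bar>s r x\<bar> \<le> C}"
proof -
  define T where "T = {z \<in> \<int>. norm (z::complex) \<le> (1 + C) ^ d}"
  have "T \<subseteq> of_int ` {z. \<bar>z\<bar> \<le> \<lfloor>(1 + C) ^ d\<rfloor>}"
  proof
    fix z assume "z \<in> T"
    then obtain n where n: "z = of_int n" "norm z \<le> (1 + C) ^ d" unfolding T_def by (auto elim: Ints_cases)
    hence "\<bar>n\<bar> \<le> \<lfloor>(1 + C) ^ d\<rfloor>" by (simp add: le_floor_iff)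
    thus "z \<in> of_int ` {z. \<bar>z\<bar> \<le> \<lfloor>(1 + C) ^ d\<rfloor>}" using n by auto
  qed
  moreover have "finite {z::int. \<bar>z\<bar> \<le> \<lfloor>(1 + C) ^ d\<rfloor>}"
    by (rule finite_subset[of _ "{-\<lfloor>(1 + C) ^ d\<rfloor>..\<lfloor>(1 + C) ^ d\<rfloor>}"]) auto
  ultimately have T: "finite T" by (meson finite_imageI finite_subset)
  define P where "P = {p :: complex poly. degree p \<le> d \<and> (\<forall>i. coeff p i \<in> T)} - {0}"
  have "finite P" unfolding P_def using finite_polys[OF T] by auto
  hence fin: "finite (\<Union>p\<in>P. {z. poly p z = 0})" unfolding P_def by (auto intro: poly_roots_finite)
  have "{x \<in> OK K. \<forall>r\<in>R. \<bar>s r x\<bar> \<le> C} \<subseteq> (\<Union>p\<in>P. {z. poly p z = 0})"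
  proof
    fix x assume x: "x \<in> {x \<in> OK K. \<forall>r\<in>R. \<bar>s r x\<bar> \<le> C}"
    define p where "p = (\<Prod>r\<in>R. [:- \<sigma> r x, 1:])"
    have bd: "norm (\<sigma> r x) \<le> C" if "r \<in> R" for r using x that s_eq[OF OK_K, of x r] by auto
    have "norm (coeff p i) \<le> (1 + C) ^ card R" for i unfolding p_def
      by (rule poly_coeff_bound[OF finite_R]) (use bd in auto)
    hence "coeff p i \<in> T" for i unfolding T_def p_def
      using conj_poly_int[of x i] x card_R by auto
    moreover have "degree p \<le> d" unfolding p_def card_R[symmetric] by (simp add: degree_prod_sum_eq)
    moreover have "p \<noteq> 0" unfolding p_def using finite_R by auto
    moreover have "poly p x = 0" unfolding p_def poly_prod using s_\<theta>[OF OK_K, of x] s_eq[OF OK_K \<theta>R, of x] x finite_R \<theta>R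
      by (auto intro!: prod_zero bexI[of _ \<theta>])
    ultimately show "x \<in> (\<Union>p\<in>P. {z. poly p z = 0})" unfolding P_def by auto
  qed
  thus ?thesis using fin finite_subset by blast
qed

section \<open>The norm and its relation to units\<close>

definition Nm where "Nm x = (\<Prod>r\<in>R. s r x)"

lemma Nm_mult: "x \<in> K \<Longrightarrow> y \<in> K \<Longrightarrow> Nm (x * y) = Nm x * Nm y"
  unfolding Nm_def by (simp add: s_mult prod.distrib)

lemma Nm_power: "x \<in> K \<Longrightarrow> Nm (x ^ n) = Nm x ^ n"
  unfolding Nm_def by (simp add: s_power prod_power_distrib)

lemma Nm_1: "Nm 1 = 1" unfolding Nm_def by (simp add: s_1)

lemma Nm_of_int: "Nm (of_int n) = of_int n ^ d"
  unfolding Nm_def by (simp add: s_of_int card_R)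

lemma Nm_eq_0: "x \<in> K \<Longrightarrow> Nm x = 0 \<longleftrightarrow> x = 0"
  unfolding Nm_def using finite_R \<theta>R by (auto simp: s_eq_0)

lemma Nm_coeff:
  assumes x: "x \<in> K"
  shows "coeff (\<Prod>r\<in>R. [:- \<sigma> r x, 1:]) 0 = (-1) ^ d * of_real (Nm x)"
proof -
  have "coeff (\<Prod>r\<in>R. [:- \<sigma> r x, 1:]) 0 = (\<Prod>r\<in>R. - 1 * of_real (s r x))"
    unfolding poly_0_coeff_0[symmetric] poly_prod using s_eq[OF x] by (intro prod.cong) auto
  also have "\<dots> = (-1) ^ d * of_real (Nm x)"
    unfolding prod.distrib Nm_def by (simp add: card_R)
  finally show ?thesis .
qed

lemma Nm_int: "x \<in> OK K \<Longrightarrow> \<exists>n::int. Nm x = of_int n"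
proof -
  assume x: "x \<in> OK K"
  have "(-1) ^ d * complex_of_real (Nm x) \<in> \<int>" using conj_poly_int[OF x, of 0] Nm_coeff[OF OK_K[OF x]] by simp
  hence "complex_of_real (Nm x) \<in> \<int>" by (cases "even d") (auto simp: minus_in_Ints_iff)
  then obtain n where "complex_of_real (Nm x) = of_int n" by (auto elim: Ints_cases)
  hence "Nm x = of_int n" by (metis of_real_eq_iff of_real_of_int_eq)
  thus ?thesis ..
qed

lemma Nm_ge_1: "x \<in> OK K \<Longrightarrow> x \<noteq> 0 \<Longrightarrow> \<bar>Nm x\<bar> \<ge> 1"
  using Nm_int[of x] Nm_eq_0[OF OK_K, of x] by auto

text \<open>The conjugate polynomial vanishes at \<open>x\<close> and has the norm, up to sign, as
  constant term; dividing by \<open>x\<close> writes the quotient, up to sign, as an integral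
  polynomial in \<open>x\<close>.\<close>

lemma Nm_divide_OK:
  assumes x: "x \<in> OK K" "x \<noteq> 0"
  shows "of_real (Nm x) / x \<in> OK K"
proof -
  define p where "p = (\<Prod>r\<in>R. [:- \<sigma> r x, 1:])"
  obtain a q where pq: "p = pCons a q" by (cases p)
  have ip: "coeff p i \<in> \<int>" for i using conj_poly_int[OF x(1)] unfolding p_def .
  have q: "coeff q i \<in> \<int>" for i using ip[of "Suc i"] unfolding pq by simp
  have "poly p x = 0" unfolding p_def poly_prod using s_\<theta>[OF OK_K, of x] s_eq[OF OK_K \<theta>R, of x] x finite_R \<theta>R
      by (auto intro!: prod_zero bexI[of _ \<theta>])
  hence "a / x = - poly q x" using x(2) unfolding pq by (simp add: field_simps eq_neg_iff_add_eq_0)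
  moreover have "algebraic_int (poly q x)" unfolding poly_altdef using x(1) q
    by (intro algebraic_int_sum algebraic_int_mult algebraic_int_power)
      (auto simp: OK_def algebraic_integer_iff intro: int_imp_algebraic_int)
  ultimately have "algebraic_int (a / x)" by simp
  moreover have "a = (-1) ^ d * of_real (Nm x)" using Nm_coeff[OF OK_K[OF x(1)]] unfolding p_def[symmetric] pq by simp
  ultimately have "algebraic_int (of_real (Nm x) / x)" by (cases "even d") auto
  moreover have "of_real (Nm x) \<in> K" using Nm_int[OF x(1)] subfield_of_int[OF subfield_K] by (metis of_real_of_int_eq)
  ultimately show ?thesis using x(1) unfolding OK_def algebraic_integer_iff by (auto intro: subfield_divide[OF subfield_K])
qed

lemma OK_add: "x \<in> OK K \<Longrightarrow> y \<in> OK K \<Longrightarrow> x + y \<in> OK K"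
  and OK_mult: "x \<in> OK K \<Longrightarrow> y \<in> OK K \<Longrightarrow> x * y \<in> OK K"
  and OK_diff: "x \<in> OK K \<Longrightarrow> y \<in> OK K \<Longrightarrow> x - y \<in> OK K"
  and OK_minus: "x \<in> OK K \<Longrightarrow> - x \<in> OK K"
  and OK_power: "x \<in> OK K \<Longrightarrow> x ^ n \<in> OK K"
  and OK_of_int: "of_int k \<in> OK K"
  and OK_1: "1 \<in> OK K"
  and OK_0: "0 \<in> OK K"
  and OK_numeral: "numeral m \<in> OK K"
  unfolding OK_def algebraic_integer_iff
  by (auto intro: subfield_add[OF subfield_K] subfield_mult[OF subfield_K] subfield_diff[OF subfield_K] subfield_minus[OF subfield_K]
      subfield_power[OF subfield_K] subfield_of_int[OF subfield_K] subfield_1[OF subfield_K] subfield_0[OF subfield_K] subfield_numeral[OF subfield_K])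

lemma OK_sum: "(\<And>i. i \<in> I \<Longrightarrow> f i \<in> OK K) \<Longrightarrow> (\<Sum>i\<in>I. f i) \<in> OK K"
  by (induction I rule: infinite_finite_induct) (auto intro: OK_0 OK_add)

lemma units_iff: "x \<in> units K \<longleftrightarrow> x \<in> OK K \<and> \<bar>Nm x\<bar> = 1"
proof
  assume u: "x \<in> units K"
  hence x: "x \<in> OK K" "x \<noteq> 0" "inverse x \<in> OK K" unfolding units_def by auto
  have "\<bar>Nm x\<bar> * \<bar>Nm (inverse x)\<bar> = 1"
    using Nm_mult[OF OK_K[OF x(1)] OK_K[OF x(3)]] x(2) Nm_1 by (simp add: abs_mult[symmetric])
  moreover have "\<bar>Nm x\<bar> \<ge> 1" "\<bar>Nm (inverse x)\<bar> \<ge> 1" using Nm_ge_1 x by auto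
  ultimately have "\<bar>Nm x\<bar> = 1" by (metis dual_order.antisym mult_cancel_left2 mult_left_le mult.commute abs_ge_zero mult_1 mult_right_mono)
  thus "x \<in> OK K \<and> \<bar>Nm x\<bar> = 1" using x by simp
next
  assume a: "x \<in> OK K \<and> \<bar>Nm x\<bar> = 1"
  hence x0: "x \<noteq> 0" using Nm_eq_0[of 0] subfield_0[OF subfield_K] by auto
  have "of_real (Nm x) / x \<in> OK K" using Nm_divide_OK a x0 by auto
  moreover have "Nm x = 1 \<or> Nm x = -1" using a by (auto simp: abs_if split: if_splits)
  ultimately have "inverse x \<in> OK K" using OK_minus[of "-1 / x"] by (auto simp: inverse_eq_divide)
  thus "x \<in> units K" unfolding units_def using a x0 by auto
qed

lemma OK_plus_iff: "x \<in> OK_plus K \<longleftrightarrow> x \<in> OK K \<and> (\<forall>r\<in>R. s r x > 0)"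
  unfolding OK_plus_def totally_positive_iff using OK_K by auto

end

lemma tr_field_ex:
  assumes "totally_real_field K"
  shows "\<exists>\<theta>. tr_field K \<theta>"
proof -
  have "number_field K" using assms unfolding totally_real_field_def by auto
  from primitive_integer[OF this] obtain \<theta> where "\<theta> \<in> K" "algebraic_int \<theta>" "K = adj \<theta>" by auto
  thus ?thesis using assms by (intro exI[of _ \<theta>]) (unfold_locales, auto)
qed

section \<open>Units of all signs\<close>

text \<open>Add the vanishing column combinations over the set \<open>P\<close> where
  \<open>f\<close> is positive. A row from \<open>P\<close> has positive sum over \<open>P\<close>,
  since its other entries, among them the one at \<open>i0\<close>, are negative and the whole row
  sums to zero. A row outside \<open>P\<close> has nonpositive sum there and nonpositive weight. So
  every contribution is nonnegative and that of \<open>i\<close> is positive. The rows to think of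
  are logarithms of conjugates of units.\<close>

lemma dominant_nonpos:
  fixes a :: "'i \<Rightarrow> 'i \<Rightarrow> real" and f :: "'i \<Rightarrow> real"
  assumes fin: "finite I" "i0 \<in> I"
    and neg: "\<And>i r. i \<in> I \<Longrightarrow> r \<in> I \<Longrightarrow> r \<noteq> i \<Longrightarrow> a i r < 0"
    and rowsum: "\<And>i. i \<in> I \<Longrightarrow> (\<Sum>r\<in>I. a i r) = 0"
    and zero: "\<And>r. r \<in> I \<Longrightarrow> (\<Sum>i\<in>I - {i0}. f i * a i r) = 0"
    and i: "i \<in> I - {i0}"
  shows "f i \<le> 0"
proof (rule ccontr)
  assume pos: "\<not> f i \<le> 0"
  define P where "P = {i \<in> I - {i0}. f i > 0}"
  have P: "finite P" "P \<subseteq> I - {i0}" "i \<in> P" unfolding P_def using fin i pos by auto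
  have "0 = (\<Sum>r\<in>P. \<Sum>i\<in>I - {i0}. f i * a i r)"
    using P(2) by (intro sum.neutral[symmetric]) (auto intro!: zero)
  also have "\<dots> = (\<Sum>i\<in>I - {i0}. f i * (\<Sum>r\<in>P. a i r))"
    by (subst sum.swap) (simp add: sum_distrib_left)
  also have "\<dots> > 0"
  proof (rule sum_pos2[OF _ i])
    have ge: "(\<Sum>r\<in>P. a j r) > 0" if j: "j \<in> P" for j
    proof -
      have "(\<Sum>r\<in>I. a j r) = (\<Sum>r\<in>P. a j r) + (\<Sum>r\<in>I - P. a j r)"
        using P fin by (subst sum.subset_diff[of P]) auto
      moreover have "(\<Sum>r\<in>I - P. a j r) < 0"
      proof -
        have "(\<Sum>r\<in>I - P. - a j r) > 0"
          by (rule sum_pos2[of _ i0]) (use fin P j neg[of j] in \<open>auto intro!: less_imp_le\<close>)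
        thus ?thesis by (simp add: sum_negf)
      qed
      ultimately show ?thesis using rowsum[of j] j P(2) by auto
    qed
    show "0 < f i * (\<Sum>r\<in>P. a i r)" using ge[OF P(3)] pos by auto
    show "0 \<le> f j * (\<Sum>r\<in>P. a j r)" if j: "j \<in> I - {i0}" for j
    proof (cases "j \<in> P")
      case True
      thus ?thesis using ge[OF True] unfolding P_def by auto
    next
      case False
      have "(\<Sum>r\<in>P. a j r) \<le> 0" using False P j by (intro sum_nonpos less_imp_le neg) auto
      moreover have "f j \<le> 0" using False j unfolding P_def by auto
      ultimately show ?thesis by (rule mult_nonpos_nonpos[rotated])
    qed
  qed (use fin in auto)
  finally show False by simp
qed

text \<open>Applied to \<open>f\<close> and to its negative: the rows other than that of
  \<open>i0\<close> are linearly independent.\<close>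

lemma dominant_zero:
  fixes a :: "'i \<Rightarrow> 'i \<Rightarrow> real" and f :: "'i \<Rightarrow> real"
  assumes fin: "finite I" "i0 \<in> I"
    and neg: "\<And>i r. i \<in> I \<Longrightarrow> r \<in> I \<Longrightarrow> r \<noteq> i \<Longrightarrow> a i r < 0"
    and rowsum: "\<And>i. i \<in> I \<Longrightarrow> (\<Sum>r\<in>I. a i r) = 0"
    and zero: "\<And>r. r \<in> I \<Longrightarrow> (\<Sum>i\<in>I - {i0}. f i * a i r) = 0"
    and i: "i \<in> I - {i0}"
  shows "f i = 0"
proof -
  have z: "(\<Sum>i\<in>I - {i0}. - f i * a i r) = 0" if "r \<in> I" for r
    using zero[OF that] by (simp add: sum_negf)
  have "- f i \<le> 0"
    by (rule dominant_nonpos[OF fin neg rowsum z i])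
  moreover have "f i \<le> 0" by (rule dominant_nonpos[OF fin neg rowsum zero i])
  ultimately show ?thesis by simp
qed

lemma card_le_fibres:
  assumes "finite B" "\<And>x. x \<in> A \<Longrightarrow> g x \<in> B" "\<And>y. y \<in> B \<Longrightarrow> card {x \<in> A. g x = y} \<le> c"
    "finite A"
  shows "card A \<le> card B * c"
proof -
  have "A = (\<Union>y\<in>B. {x \<in> A. g x = y})" using assms(2) by auto
  hence "card A \<le> (\<Sum>y\<in>B. card {x \<in> A. g x = y})"
    using card_UN_le[OF assms(1), of "\<lambda>y. {x \<in> A. g x = y}"] by simp
  also have "\<dots> \<le> card B * c" using sum_bounded_above[of B _ c] assms(3) by simp
  finally show ?thesis .
qed

section \<open>Small elements of the order and exceptional units\<close>

context tr_field
begin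

text \<open>The order Z[\<theta>] has integral coordinates, unique below \<open>d\<close> by
  \<open>ord_elem_0\<close>, on which boxes and congruences can be counted.\<close>

definition ord_elem :: "(nat \<Rightarrow> int) \<Rightarrow> complex" where
  "ord_elem e = (\<Sum>j<d. of_int (e j) * \<theta> ^ j)"

lemma \<theta>OK: "\<theta> \<in> OK K" using \<theta>K \<theta>int unfolding OK_def algebraic_integer_iff by auto

lemma ord_elem_OK: "ord_elem e \<in> OK K"
  unfolding ord_elem_def by (intro OK_sum OK_mult OK_of_int OK_power \<theta>OK)

lemma ord_elem_diff: "ord_elem e - ord_elem f = ord_elem (\<lambda>j. e j - f j)"
  unfolding ord_elem_def by (simp add: sum_subtractf algebra_simps)

lemma ord_elem_scale: "of_int n * ord_elem e = ord_elem (\<lambda>j. n * e j)"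
  unfolding ord_elem_def by (simp add: sum_distrib_left mult.assoc)

lemma ord_elem_0: "ord_elem e = 0 \<Longrightarrow> j < d \<Longrightarrow> e j = 0"
proof -
  assume 0: "ord_elem e = 0" and j: "j < d"
  define p :: "complex poly" where "p = (\<Sum>j<d. monom (of_int (e j)) j)"
  have cp: "coeff p j = (if j < d then of_int (e j) else 0)" for j
    unfolding p_def coeff_sum by (auto simp: if_distrib cong: if_cong)
  have "poly p \<theta> = 0" using 0 unfolding p_def ord_elem_def by (simp add: poly_sum poly_monom)
  moreover have "poly_over \<rat> p" unfolding poly_over_def cp by auto
  moreover have "degree p < d"
  proof -
    have "degree p \<le> d - 1" by (rule degree_le) (auto simp: cp)
    thus ?thesis using d_pos by simp
  qed
  ultimately have "p = 0" using mp unfolding is_minpoly_def[OF subfield_rat] d_def by force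
  thus "e j = 0" using cp[of j] j by simp
qed

text \<open>The bounds are balanced: one conjugate of size \<open>t ^ (d - 1)\<close> and
  \<open>d - 1\<close> of size \<open>1 / t\<close> leave the norm bounded by \<open>A ^ d\<close>
  for every \<open>t\<close>.\<close>

lemma small_element:
  "\<exists>A>0. \<forall>r0\<in>R. \<forall>t\<ge>1. \<exists>e. ord_elem e \<noteq> 0 \<and> (\<forall>r\<in>R - {r0}. \<bar>s r (ord_elem e)\<bar> < A / of_nat t)
      \<and> \<bar>s r0 (ord_elem e)\<bar> \<le> A * of_nat t ^ (d - 1)"
proof -
  define B where "B = 1 + (\<Sum>r\<in>R. \<Sum>j<d. \<bar>s r (\<theta> ^ j)\<bar>)"
  have Br: "(\<Sum>j<d. \<bar>s r (\<theta> ^ j)\<bar>) < B" if "r \<in> R" for r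
  proof -
    have "(\<Sum>j<d. \<bar>s r (\<theta> ^ j)\<bar>) \<le> (\<Sum>r\<in>R. \<Sum>j<d. \<bar>s r (\<theta> ^ j)\<bar>)"
      by (rule member_le_sum[OF that]) (auto intro: sum_nonneg finite_R)
    thus ?thesis unfolding B_def by simp
  qed
  have B: "B > 0" unfolding B_def by (auto intro!: add_pos_nonneg sum_nonneg)
  have "\<exists>e. ord_elem e \<noteq> 0 \<and> (\<forall>r\<in>R - {r0}. \<bar>s r (ord_elem e)\<bar> < (2*B) / of_nat t)
      \<and> \<bar>s r0 (ord_elem e)\<bar> \<le> (2*B) * of_nat t ^ (d - 1)" if r0: "r0 \<in> R" and t: "t \<ge> 1" for r0 and t :: nat
  proof -
    \<comment> \<open>Pigeonhole: the \<open>(M + 1) ^ d\<close> coefficient vectors outnumber the \<open>(t ^ d) ^ (d - 1) = M ^ d\<close> boxes.\<close>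
    define M where "M = t ^ (d - 1)"
    have M: "M \<ge> 1" unfolding M_def using t by simp
    define C where "C = {..<d} \<rightarrow>\<^sub>E {0..int M}"
    have cC: "card C = (M + 1) ^ d" unfolding C_def by (simp add: card_PiE nat_add_distrib)
    have bd: "\<bar>s r (ord_elem c)\<bar> < M * B" if c: "c \<in> C" and r: "r \<in> R" for c r
    proof -
      have "s r (ord_elem c) = (\<Sum>j<d. of_int (c j) * s r (\<theta> ^ j))"
        unfolding ord_elem_def using r
        by (simp add: s_sum s_mult s_of_int subfield_mult[OF subfield_K] subfield_of_int[OF subfield_K] subfield_power[OF subfield_K \<theta>K])
      also have "\<bar>\<dots>\<bar> \<le> (\<Sum>j<d. \<bar>of_int (c j) * s r (\<theta> ^ j)\<bar>)" by (rule sum_abs)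
      also have "\<dots> \<le> (\<Sum>j<d. M * \<bar>s r (\<theta> ^ j)\<bar>)"
      proof (rule sum_mono)
        fix j assume "j \<in> {..<d}"
        hence "c j \<in> {0..int M}" using c unfolding C_def by (meson PiE_mem)
        hence "0 \<le> c j" "c j \<le> int M" by auto
        hence "\<bar>real_of_int (c j)\<bar> \<le> real M" by linarith
        thus "\<bar>of_int (c j) * s r (\<theta> ^ j)\<bar> \<le> M * \<bar>s r (\<theta> ^ j)\<bar>"
          unfolding abs_mult by (intro mult_right_mono) auto
      qed
      also have "\<dots> = M * (\<Sum>j<d. \<bar>s r (\<theta> ^ j)\<bar>)" by (simp add: sum_distrib_left)
      also have "\<dots> < M * B" using Br[OF r] M by simp
      finally show ?thesis .
    qed
    \<comment> \<open>Each conjugate away from \<open>r0\<close> lies in an interval of length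
      \<open>2 * M * B\<close>, cut here into \<open>t ^ d\<close> pieces of length
      \<open>2 * B / t\<close>.\<close>
    define g where "g c = (\<lambda>r\<in>R - {r0}. \<lfloor>(s r (ord_elem c) + M * B) * t ^ d / (2 * M * B)\<rfloor>)" for c
    have MB: "M * B > 0" using M B by simp
    have gim: "g ` C \<subseteq> (R - {r0}) \<rightarrow>\<^sub>E {0..<int (t ^ d)}"
    proof (intro image_subsetI PiE_I)
      fix c r assume c: "c \<in> C" and r: "r \<in> R - {r0}"
      define y where "y = (s r (ord_elem c) + M * B) * t ^ d / (2 * M * B)"
      have a: "s r (ord_elem c) + M * B > 0" "s r (ord_elem c) + M * B < 2 * M * B"
      proof -
        have "r \<in> R" using r by simp
        from bd[OF c this] show "s r (ord_elem c) + M * B > 0" "s r (ord_elem c) + M * B < 2 * M * B" by linarith+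
      qed
      have MB2: "real (2 * M) * B > 0" using M B by simp
      have "y \<ge> 0" unfolding y_def by (rule divide_nonneg_pos[OF mult_nonneg_nonneg MB2]) (use a(1) in simp_all)
      moreover have "y < t ^ d"
      proof -
        have "(s r (ord_elem c) + M * B) * t ^ d < (2 * M * B) * t ^ d" using a t by (intro mult_strict_right_mono) auto
        thus ?thesis unfolding y_def using MB by (simp add: divide_less_eq mult_ac)
      qed
      moreover have "g c r = \<lfloor>y\<rfloor>" unfolding g_def y_def using r by simp
      ultimately show "g c r \<in> {0..<int (t ^ d)}" by (simp add: floor_less_iff)
    qed (auto simp: g_def)
    have "card (g ` C) \<le> card ((R - {r0}) \<rightarrow>\<^sub>E {0..<int (t ^ d)})"
      using gim finite_R by (intro card_mono finite_PiE) auto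
    also have "\<dots> = (t ^ d) ^ (d - 1)" using finite_R r0 card_R by (simp add: card_PiE nat_power_eq)
    also have "\<dots> = M ^ d" unfolding M_def by (simp add: power_mult[symmetric] mult.commute)
    also have "\<dots> < card C" unfolding cC using d_pos by (intro power_strict_mono) auto
    finally have "\<not> inj_on g C" by (rule pigeonhole)
    then obtain c c' where cc: "c \<in> C" "c' \<in> C" "c \<noteq> c'" "g c = g c'" unfolding inj_on_def by auto
    define e where "e j = c j - c' j" for j
    have oe: "ord_elem e = ord_elem c - ord_elem c'" unfolding ord_elem_diff e_def ..
    have ooK: "ord_elem c \<in> K" "ord_elem c' \<in> K" using OK_K[OF ord_elem_OK] by auto
    have se: "s r (ord_elem e) = s r (ord_elem c) - s r (ord_elem c')" if "r \<in> R" for r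
      unfolding oe using s_diff[OF that ooK] .
    have "ord_elem e \<noteq> 0"
    proof
      assume "ord_elem e = 0"
      hence "c j = c' j" if "j < d" for j using ord_elem_0[of e j] that unfolding e_def by simp
      hence "c = c'" using cc(1,2) PiE_ext[of c "{..<d}" "\<lambda>_. {0..int M}" c'] unfolding C_def by blast
      thus False using cc by simp
    qed
    moreover have "\<bar>s r (ord_elem e)\<bar> < 2 * B / t" if r: "r \<in> R - {r0}" for r
    proof -
      let ?y = "\<lambda>c. (s r (ord_elem c) + M * B) * t ^ d / (2 * M * B)"
      have "g c r = g c' r" using cc by simp
      hence "\<lfloor>?y c\<rfloor> = \<lfloor>?y c'\<rfloor>" unfolding g_def using r by simp
      hence "\<bar>?y c - ?y c'\<bar> < 1" by linarith
      moreover have "?y c - ?y c' = s r (ord_elem e) * t ^ d / (2 * M * B)"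
        using r by (simp add: se diff_divide_distrib[symmetric] algebra_simps)
      ultimately have "\<bar>s r (ord_elem e) * t ^ d / (2 * M * B)\<bar> < 1" by simp
      moreover have "real (2 * M) * B > 0" using M B by simp
      ultimately have "\<bar>s r (ord_elem e) * t ^ d\<bar> < 2 * M * B"
        unfolding abs_divide by (simp only: abs_of_pos pos_divide_less_eq mult_1)
      hence "\<bar>s r (ord_elem e)\<bar> * t ^ d < 2 * M * B" by (simp add: abs_mult)
      moreover have "real t ^ d = t * M" unfolding M_def using d_pos by (cases d) auto
      ultimately have "(\<bar>s r (ord_elem e)\<bar> * t) * M < (2 * B) * M" by (simp add: mult_ac)
      hence "\<bar>s r (ord_elem e)\<bar> * t < 2 * B" using M by (simp add: mult_less_cancel_right)
      thus ?thesis using t by (simp add: field_simps)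
    qed
    moreover have "\<bar>s r0 (ord_elem e)\<bar> \<le> 2 * B * real t ^ (d - 1)"
    proof -
      have "\<bar>s r0 (ord_elem e)\<bar> \<le> M * B + M * B" unfolding se[OF r0]
        using bd[OF cc(1) r0] bd[OF cc(2) r0] by linarith
      thus ?thesis unfolding M_def by (simp add: mult_ac)
    qed
    ultimately show ?thesis by blast
  qed
  thus ?thesis using B by (intro exI[of _ "2 * B"]) auto
qed

text \<open>There is an infinite sequence of elements of bounded norm whose conjugates away from
  \<open>r0\<close> strictly decrease. Two of them share the norm n and are congruent modulo n; the
  later one divided by the earlier one is integral of norm 1.\<close>

lemma exceptional_unit:
  assumes r0: "r0 \<in> R"
  shows "\<exists>u\<in>units K. \<forall>r\<in>R - {r0}. \<bar>s r u\<bar> < 1"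
proof -
  obtain A where A: "A > 0" and el: "\<And>t::nat. t \<ge> 1 \<Longrightarrow> \<exists>e. ord_elem e \<noteq> 0 \<and>
      (\<forall>r\<in>R - {r0}. \<bar>s r (ord_elem e)\<bar> < A / of_nat t) \<and> \<bar>s r0 (ord_elem e)\<bar> \<le> A * of_nat t ^ (d - 1)"
    using small_element r0 by metis
  define P where "P e \<longleftrightarrow> ord_elem e \<noteq> 0 \<and> \<bar>Nm (ord_elem e)\<bar> \<le> A ^ d" for e
  have step: "\<exists>f. P f \<and> (\<forall>r\<in>R - {r0}. \<bar>s r (ord_elem f)\<bar> < \<delta>)" if \<delta>: "\<delta> > 0" for \<delta>
  proof -
    obtain t :: nat where t: "t \<ge> 1" "A / \<delta> < t"
      using reals_Archimedean2[of "max 1 (A / \<delta>)"] by (metis less_imp_le max_less_iff_conj of_nat_1 of_nat_less_iff)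
    obtain f where f: "ord_elem f \<noteq> 0" "\<And>r. r \<in> R - {r0} \<Longrightarrow> \<bar>s r (ord_elem f)\<bar> < A / t"
       "\<bar>s r0 (ord_elem f)\<bar> \<le> A * of_nat t ^ (d - 1)" using el[OF t(1)] by blast
    have "\<bar>Nm (ord_elem f)\<bar> = \<bar>s r0 (ord_elem f)\<bar> * (\<Prod>r\<in>R - {r0}. \<bar>s r (ord_elem f)\<bar>)"
      unfolding Nm_def abs_prod by (rule prod.remove[OF finite_R r0])
    also have "\<dots> \<le> (A * of_nat t ^ (d - 1)) * (\<Prod>r\<in>R - {r0}. A / t)"
      using f A by (intro mult_mono prod_mono) (auto intro!: prod_nonneg intro: less_imp_le)
    also have "\<dots> = A ^ Suc (d - 1)"
      using t(1) finite_R r0 card_R by (simp add: power_divide)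
    also have "\<dots> = A ^ d" using d_pos by simp
    finally have "P f" unfolding P_def using f by auto
    moreover have "A / t < \<delta>" using t \<delta> by (simp add: field_simps)
    ultimately show ?thesis using f(2) by force
  qed
  have "\<exists>f. \<forall>n. P (f n) \<and> (\<forall>r\<in>R - {r0}. \<bar>s r (ord_elem (f (Suc n)))\<bar> < \<bar>s r (ord_elem (f n))\<bar>)"
  proof (rule dependent_nat_choice)
    show "\<exists>x. P x" using step[of 1] by auto
    fix e :: "nat \<Rightarrow> int" and n :: nat assume e: "P e"
    define \<delta> where "\<delta> = Min (insert 1 ((\<lambda>r. \<bar>s r (ord_elem e)\<bar>) ` R))"
    have "\<delta> > 0" unfolding \<delta>_def using finite_R e s_eq_0[OF _ OK_K[OF ord_elem_OK]] unfolding P_def by auto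
    then obtain f where f: "P f" "\<And>r. r \<in> R - {r0} \<Longrightarrow> \<bar>s r (ord_elem f)\<bar> < \<delta>" using step by blast
    moreover have "\<delta> \<le> \<bar>s r (ord_elem e)\<bar>" if "r \<in> R" for r unfolding \<delta>_def using finite_R that by (intro Min_le) auto
    ultimately show "\<exists>y. P y \<and> (\<forall>r\<in>R - {r0}. \<bar>s r (ord_elem y)\<bar> < \<bar>s r (ord_elem e)\<bar>)" by force
  qed
  then obtain f where f: "\<And>n. P (f n)" "\<And>n r. r \<in> R - {r0} \<Longrightarrow> \<bar>s r (ord_elem (f (Suc n)))\<bar> < \<bar>s r (ord_elem (f n))\<bar>" by blast
  have dec: "\<bar>s r (ord_elem (f l))\<bar> < \<bar>s r (ord_elem (f k))\<bar>" if "k < l" "r \<in> R - {r0}" for k l r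
    using lift_Suc_mono_less[of "\<lambda>n. - \<bar>s r (ord_elem (f n))\<bar>" k l] f(2)[OF that(2)] that(1) by simp
  have "\<forall>n. \<exists>z::int. Nm (ord_elem (f n)) = of_int z" using Nm_int[OF ord_elem_OK] by blast
  then obtain N where N: "\<And>n. Nm (ord_elem (f n)) = of_int (N n)" by metis
  have N0: "N n \<noteq> 0" for n using Nm_eq_0[OF OK_K[OF ord_elem_OK], of "f n"] f(1)[of n] N[of n] unfolding P_def by auto
  define L where "L = \<lfloor>A ^ d\<rfloor>"
  have NL: "\<bar>N n\<bar> \<le> L" for n using f(1)[of n] N[of n] unfolding P_def L_def by (simp add: le_floor_iff)
  define key where "key n = (N n, \<lambda>j\<in>{..<d}. f n j mod \<bar>N n\<bar>)" for n
  have "key ` UNIV \<subseteq> {-L..L} \<times> ({..<d} \<rightarrow>\<^sub>E {0..L})"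
  proof (intro image_subsetI)
    fix n
    have "0 \<le> f n j mod \<bar>N n\<bar>" "f n j mod \<bar>N n\<bar> \<le> L" for j
    proof -
      have p: "0 < \<bar>N n\<bar>" using N0[of n] by simp
      show "0 \<le> f n j mod \<bar>N n\<bar>" by (rule pos_mod_sign[OF p])
      show "f n j mod \<bar>N n\<bar> \<le> L" using pos_mod_bound[OF p, of "f n j"] NL[of n] by linarith
    qed
    thus "key n \<in> {-L..L} \<times> ({..<d} \<rightarrow>\<^sub>E {0..L})" unfolding key_def using NL[of n] by auto
  qed
  moreover have "finite ({-L..L} \<times> ({..<d} \<rightarrow>\<^sub>E {0..L}))" by (intro finite_cartesian_product finite_PiE) auto
  ultimately have "finite (key ` UNIV)" by (rule finite_subset)
  hence "\<not> inj key" using finite_imageD[of key UNIV] by auto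
  then obtain k l where kl: "k < l" "key k = key l" unfolding inj_def by (metis linorder_neqE_nat)
  define n where "n = N k"
  have n: "N l = n" "N k = n" using kl(2) unfolding key_def n_def by auto
  have cong: "\<bar>n\<bar> dvd f l j - f k j" if "j < d" for j
  proof -
    have "(\<lambda>j\<in>{..<d}. f k j mod \<bar>N k\<bar>) = (\<lambda>j\<in>{..<d}. f l j mod \<bar>N l\<bar>)" using kl(2) unfolding key_def by (rule Pair_inject)
    from fun_cong[OF this, of j]
    have "(\<lambda>j\<in>{..<d}. f k j mod \<bar>N k\<bar>) j = (\<lambda>j\<in>{..<d}. f l j mod \<bar>N l\<bar>) j" .
    hence "f l j mod \<bar>n\<bar> = f k j mod \<bar>n\<bar>" using that n by simp
    thus ?thesis by (simp only: mod_eq_dvd_iff)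
  qed
  let ?a = "ord_elem (f k)" and ?b = "ord_elem (f l)"
  have a0: "?a \<noteq> 0" "?b \<noteq> 0" using f(1) unfolding P_def by auto
  \<comment> \<open>With \<open>?b = ?a + n * w\<close> the quotient is
    \<open>1 + w * (n / ?a)\<close>, and \<open>n / ?a\<close> is integral because n is the norm of
    \<open>?a\<close>.\<close>
  define w where "w = ord_elem (\<lambda>j. (f l j - f k j) div n)"
  have "?b - ?a = of_int n * w" unfolding ord_elem_diff w_def ord_elem_scale
    unfolding ord_elem_def using cong by (intro sum.cong) auto
  hence "?b / ?a = 1 + w * (of_int n / ?a)" using a0 by (simp add: field_simps)
  moreover have "of_int n / ?a \<in> OK K"
    using Nm_divide_OK[OF ord_elem_OK a0(1)] N[of k] n by simp
  moreover have "w \<in> OK K" unfolding w_def by (rule ord_elem_OK)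
  ultimately have u: "?b / ?a \<in> OK K" by (metis OK_add OK_1 OK_mult)
  have "Nm (?b / ?a) * Nm ?a = Nm ?b"
    using Nm_mult[OF OK_K[OF u] OK_K[OF ord_elem_OK], of "f k"] a0 by simp
  hence "Nm (?b / ?a) = 1" using N n N0[of k] by simp
  hence "?b / ?a \<in> units K" using u units_iff by simp
  moreover have "\<bar>s r (?b / ?a)\<bar> < 1" if r: "r \<in> R - {r0}" for r
  proof -
    have "s r ?a \<noteq> 0" using s_eq_0[OF _ OK_K[OF ord_elem_OK], of r] r a0 by auto
    thus ?thesis using r dec[OF kl(1) r] by (simp add: s_divide OK_K[OF ord_elem_OK])
  qed
  ultimately show ?thesis by blast
qed


section \<open>Units, their sign patterns and their classes modulo powers\<close>

lemma units_K: "u \<in> units K \<Longrightarrow> u \<in> K" and units_OK: "u \<in> units K \<Longrightarrow> u \<in> OK K"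
  and units_nz: "u \<in> units K \<Longrightarrow> u \<noteq> 0"
  using OK_K unfolding units_def by auto

lemma units_mult: "u \<in> units K \<Longrightarrow> v \<in> units K \<Longrightarrow> u * v \<in> units K"
  unfolding units_def by (auto intro: OK_mult)

lemma units_inverse: "u \<in> units K \<Longrightarrow> inverse u \<in> units K"
  unfolding units_def by auto

lemma units_divide: "u \<in> units K \<Longrightarrow> v \<in> units K \<Longrightarrow> u / v \<in> units K"
  by (simp add: divide_inverse units_mult units_inverse)

lemma units_1: "1 \<in> units K" unfolding units_def by (auto intro: OK_1)

lemma units_power: "u \<in> units K \<Longrightarrow> u ^ n \<in> units K"
  by (induction n) (auto intro: units_1 units_mult)

lemma units_minus: "u \<in> units K \<Longrightarrow> - u \<in> units K"
  using OK_minus unfolding units_def by (auto simp: inverse_minus_eq)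

lemma s_units_nz: "u \<in> units K \<Longrightarrow> r \<in> R \<Longrightarrow> s r u \<noteq> 0"
  using s_eq_0 units_K units_nz by blast

definition sg where "sg u = {r \<in> R. s r u > 0}"

text \<open>The sign at the identity embedding selects exactly one of \<open>u\<close> and
  \<open>- u\<close>, so \<open>U1\<close> represents the units up to sign.\<close>

definition U1 where "U1 = {u \<in> units K. s \<theta> u > 0}"

lemma sg_mult: "u \<in> units K \<Longrightarrow> v \<in> units K \<Longrightarrow> sg (u * v) = {r \<in> R. r \<in> sg u \<longleftrightarrow> r \<in> sg v}"
proof -
  assume u: "u \<in> units K" and v: "v \<in> units K"
  have "s r (u * v) > 0 \<longleftrightarrow> (s r u > 0 \<longleftrightarrow> s r v > 0)" if r: "r \<in> R" for r
    using s_units_nz[OF u r] s_units_nz[OF v r] s_mult[OF r units_K[OF u] units_K[OF v]]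
    by (cases "s r u > 0"; cases "s r v > 0") (auto simp: zero_less_mult_iff)
  thus ?thesis unfolding sg_def by blast
qed

lemma U1_units: "u \<in> U1 \<Longrightarrow> u \<in> units K" unfolding U1_def by auto

lemma U1_mult: "u \<in> U1 \<Longrightarrow> v \<in> U1 \<Longrightarrow> u * v \<in> U1"
  unfolding U1_def using \<theta>R by (auto simp: units_mult s_mult units_K)

lemma U1_1: "1 \<in> U1" unfolding U1_def using \<theta>R by (simp add: units_1 s_1)

lemma U1_power: "u \<in> U1 \<Longrightarrow> u ^ n \<in> U1"
  by (induction n) (auto intro: U1_mult U1_1)

lemma U1_prod: "(\<And>i. i \<in> I \<Longrightarrow> f i \<in> U1) \<Longrightarrow> (\<Prod>i\<in>I. f i) \<in> U1"
  by (induction I rule: infinite_finite_induct) (auto intro: U1_mult U1_1)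

lemma U1_pm: "u \<in> units K \<Longrightarrow> u \<in> U1 \<or> - u \<in> U1"
  using s_units_nz[OF _ \<theta>R, of u] \<theta>R unfolding U1_def by (auto simp: units_minus s_minus units_K)

text \<open>Dividing \<open>u\<close> by a chosen unit with the same signs leaves a totally positive
  unit, hence the square of some \<open>z'\<close> in \<open>U1\<close>; squaring the decomposition
  of \<open>z'\<close> from the induction hypothesis doubles the exponent. Each step multiplies the
  number of representatives by at most the number of sign patterns in \<open>U1\<close>.\<close>

lemma U1_generators_mod_powers:
  assumes sq: "\<And>u. u \<in> units K \<Longrightarrow> (\<forall>r\<in>R. s r u > 0) \<Longrightarrow> \<exists>v\<in>units K. u = v\<^sup>2"
  shows "\<exists>T\<subseteq>U1. finite T \<and> card T \<le> card (sg ` U1) ^ n \<and> (\<forall>u\<in>U1. \<exists>t\<in>T. \<exists>w\<in>U1. u = t * w ^ (2 ^ n))"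
proof (induction n)
  case 0
  show ?case using \<theta>R by (intro exI[of _ "{1}"]) (auto simp: U1_def units_1 s_1)
next
  case (Suc n)
  from Suc.IH obtain T where T0: "T \<subseteq> U1 \<and> finite T \<and> card T \<le> card (sg ` U1) ^ n \<and>
      (\<forall>u\<in>U1. \<exists>t\<in>T. \<exists>w\<in>U1. u = t * w ^ (2 ^ n))" by (elim exE)
  hence T: "T \<subseteq> U1" "finite T" "card T \<le> card (sg ` U1) ^ n" by auto
  have cov: "\<exists>t\<in>T. \<exists>w\<in>U1. u = t * w ^ (2 ^ n)" if "u \<in> U1" for u using T0 that by meson
  have fin: "finite (sg ` U1)" by (rule finite_subset[of _ "Pow R"]) (auto simp: sg_def finite_R)
  define g where "g X = (SOME u. u \<in> U1 \<and> sg u = X)" for X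
  have g: "g X \<in> U1 \<and> sg (g X) = X" if X: "X \<in> sg ` U1" for X
  proof -
    obtain u where "u \<in> U1 \<and> sg u = X" using X by blast
    thus ?thesis unfolding g_def by (rule someI)
  qed
  define T' where "T' = (\<lambda>(X,t). g X * t ^ 2) ` (sg ` U1 \<times> T)"
  have "T' \<subseteq> U1" unfolding T'_def using g T(1) by (auto intro!: U1_mult U1_power)
  moreover have "finite T'" unfolding T'_def using fin T(2) by auto
  moreover have cT: "card T' \<le> card (sg ` U1) * card T"
    unfolding T'_def using card_image_le[of "sg ` U1 \<times> T" "\<lambda>(X,t). g X * t ^ 2"] fin T(2)
    by (simp add: card_cartesian_product)
  have "card T' \<le> card (sg ` U1) ^ Suc n"
    using order_trans[OF cT mult_le_mono2[OF T(3)]] by simp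
  moreover have "\<exists>t\<in>T'. \<exists>w\<in>U1. u = t * w ^ (2 ^ Suc n)" if u: "u \<in> U1" for u
  proof -
    define v where "v = g (sg u)"
    have v: "v \<in> U1" "sg v = sg u" unfolding v_def using g u by auto
    have uv: "u / v \<in> units K" using u v by (auto intro: units_divide U1_units)
    have "s r (u / v) > 0" if r: "r \<in> R" for r
    proof -
      have "s r u > 0 \<longleftrightarrow> s r v > 0" using v(2) r unfolding sg_def by auto
      thus ?thesis using s_units_nz[OF U1_units[OF u] r] s_units_nz[OF U1_units[OF v(1)] r] r
        by (auto simp: s_divide units_K U1_units u v zero_less_divide_iff)
    qed
    then obtain z where z: "z \<in> units K" "u / v = z\<^sup>2" using sq[OF uv] by blast
    obtain z' where z': "z' \<in> U1" "u / v = z'\<^sup>2" using U1_pm[OF z(1)] z(2) by (metis power2_minus)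
    obtain t w where tw: "t \<in> T" "w \<in> U1" "z' = t * w ^ (2 ^ n)" using cov[OF z'(1)] by blast
    have "u = v * (t * w ^ (2 ^ n)) ^ 2"
      using z'(2) tw(3) units_nz[OF U1_units[OF v(1)]] by (simp add: field_simps)
    also have "\<dots> = (g (sg u) * t ^ 2) * w ^ (2 ^ Suc n)"
      unfolding v_def by (simp add: power_mult_distrib power_mult[symmetric] mult_ac)
    finally show ?thesis using tw(1,2) u unfolding T'_def by force
  qed
  ultimately show ?case by blast
qed

text \<open>If some sign pattern were missing, the positive units \<open>U1\<close> would realise at most \<open>2 ^ (d - 2)\<close> patterns and
  hence have at most \<open>2 ^ (n * (d - 2))\<close> classes modulo \<open>2 ^ n\<close>-th powers. The exponents below \<open>2 ^ n\<close> of \<open>d - 1\<close>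
  independent units give \<open>2 ^ (n * (d - 1))\<close> products, and the products in one class differ by \<open>2 ^ n\<close>-th powers
  of units from a finite set that does not depend on \<open>n\<close>.\<close>

lemma all_signs:
  assumes sq: "\<And>u. u \<in> units K \<Longrightarrow> (\<forall>r\<in>R. s r u > 0) \<Longrightarrow> \<exists>v\<in>units K. u = v\<^sup>2"
    and E: "E \<subseteq> R"
  shows "\<exists>u\<in>units K. sg u = E"
proof (rule ccontr)
  assume none: "\<not> (\<exists>u\<in>units K. sg u = E)"
  have sgm: "sg (- u) = R - sg u" if "u \<in> units K" for u
    unfolding sg_def using s_units_nz[OF that] that by (force simp: s_minus units_K)
  \<comment> \<open>Negation complements a pattern, so the missing pattern may be taken to contain
    \<theta>.\<close>
  define E' where "E' = (if \<theta> \<in> E then E else R - E)"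
  have none': "sg u \<noteq> E'" if "u \<in> units K" for u
    using none sgm[OF that] units_minus[OF that] that E unfolding E'_def
    by (metis Diff_Diff_Int inf.absorb_iff2)
  have E': "\<theta> \<in> E'" "E' \<subseteq> R" unfolding E'_def using E \<theta>R by auto
  define S where "S = sg ` U1"
  define W where "W = {X. X \<subseteq> R \<and> \<theta> \<in> X}"
  have SW: "S \<subseteq> W" unfolding S_def W_def U1_def sg_def using \<theta>R by auto
  have "W = insert \<theta> ` Pow (R - {\<theta>})"
  proof (intro equalityI subsetI)
    fix X assume X: "X \<in> W"
    hence "X = insert \<theta> (X - {\<theta>})" "X - {\<theta>} \<in> Pow (R - {\<theta>})" unfolding W_def by auto
    thus "X \<in> insert \<theta> ` Pow (R - {\<theta>})" by (rule image_eqI)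
  qed (use \<theta>R in \<open>auto simp: W_def\<close>)
  moreover have "inj_on (insert \<theta>) (Pow (R - {\<theta>}))" unfolding inj_on_def by blast
  ultimately have cW: "card W = 2 ^ (d - 1)"
    using finite_R \<theta>R card_R by (simp add: card_image card_Pow)
  have finW: "finite W" unfolding W_def using finite_R by auto
  \<comment> \<open>\<open>\<phi> X\<close> is the pattern whose product with \<open>X\<close> is
    \<open>E'\<close>. Units realising both would have a product realising \<open>E'\<close>; so
    \<open>S\<close> fills at most half of \<open>W\<close>.\<close>
  define \<phi> where "\<phi> X = {r \<in> R. r \<in> X \<longleftrightarrow> r \<in> E'}" for X
  have "inj_on \<phi> S"
  proof (rule inj_onI)
    fix X Y assume "X \<in> S" "Y \<in> S" "\<phi> X = \<phi> Y"
    moreover from this have "X \<subseteq> R" "Y \<subseteq> R" using SW unfolding W_def by auto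
    ultimately show "X = Y" unfolding \<phi>_def by blast
  qed
  moreover have "\<phi> ` S \<subseteq> W" using SW E' \<theta>R unfolding \<phi>_def W_def by auto
  moreover have "\<phi> ` S \<inter> S = {}"
  proof (rule ccontr)
    assume "\<not> ?thesis"
    then obtain u v where uv: "u \<in> U1" "v \<in> U1" "sg v = \<phi> (sg u)" unfolding S_def by auto
    have "sg (u * v) = E'"
      unfolding sg_mult[OF U1_units[OF uv(1)] U1_units[OF uv(2)]] uv(3) using E'(2) unfolding \<phi>_def by blast
    thus False using none' units_mult U1_units uv by blast
  qed
  moreover have finS: "finite S" using SW finW finite_subset by blast
  ultimately have "card S + card S \<le> 2 ^ (d - 1)"
    using card_mono[OF finW, of "S \<union> \<phi> ` S"] SW card_Un_disjoint[of S "\<phi> ` S"]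
    by (simp add: card_image cW Int_commute)
  moreover have "S \<noteq> {}" unfolding S_def U1_def using units_1 s_1[OF \<theta>R] by force
  hence "card S > 0" using finS by (simp add: card_gt_0_iff)
  \<comment> \<open>At least one pattern is realised, so 2 <= 2^(d-1) and \<open>d\<close> is at
    least 2.\<close>
  ultimately obtain m where m: "d = Suc (Suc m)" "card S \<le> 2 ^ m"
    by (cases d; cases "d - 1") auto
  have "\<forall>i\<in>R. \<exists>u\<in>U1. \<forall>r\<in>R - {i}. \<bar>s r u\<bar> < 1"
  proof
    fix i assume "i \<in> R"
    then obtain u where u: "u \<in> units K" "\<forall>r\<in>R - {i}. \<bar>s r u\<bar> < 1" using exceptional_unit by blast
    from U1_pm[OF u(1)] show "\<exists>u\<in>U1. \<forall>r\<in>R - {i}. \<bar>s r u\<bar> < 1"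
    proof
      assume "- u \<in> U1"
      moreover have "\<forall>r\<in>R - {i}. \<bar>s r (- u)\<bar> < 1" using u by (auto simp: s_minus units_K)
      ultimately show ?thesis by blast
    qed (use u in blast)
  qed
  then obtain \<eta> where \<eta>: "\<And>i. i \<in> R \<Longrightarrow> \<eta> i \<in> U1" "\<And>i r. i \<in> R \<Longrightarrow> r \<in> R \<Longrightarrow> r \<noteq> i \<Longrightarrow> \<bar>s r (\<eta> i)\<bar> < 1"
    by (metis DiffI singletonD)
  define a where "a i r = ln \<bar>s r (\<eta> i)\<bar>" for i r
  have snz: "s r (\<eta> i) \<noteq> 0" if "i \<in> R" "r \<in> R" for i r using s_units_nz U1_units \<eta>(1) that by blast
  have aneg: "a i r < 0" if "i \<in> R" "r \<in> R" "r \<noteq> i" for i r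
    unfolding a_def using \<eta>(2)[OF that] snz[OF that(1,2)] by simp
  have arow: "(\<Sum>r\<in>R. a i r) = 0" if "i \<in> R" for i
  proof -
    have "(\<Sum>r\<in>R. a i r) = ln (\<Prod>r\<in>R. \<bar>s r (\<eta> i)\<bar>)"
      unfolding a_def by (rule ln_prod[symmetric]) (use snz[OF that] finite_R in auto)
    also have "(\<Prod>r\<in>R. \<bar>s r (\<eta> i)\<bar>) = 1"
      using units_iff[of "\<eta> i"] U1_units[OF \<eta>(1)[OF that]] unfolding Nm_def abs_prod by simp
    finally show ?thesis by simp
  qed
  define J where "J = R - {\<theta>}"
  have J: "finite J" "card J = Suc m" "J \<subseteq> R" unfolding J_def using finite_R \<theta>R card_R m by auto
  define V where "V e = (\<Prod>i\<in>J. \<eta> i ^ e i)" for e :: "complex \<Rightarrow> nat"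
  have VU: "V e \<in> U1" for e unfolding V_def using J(3) by (auto intro!: U1_prod U1_power \<eta>)
  have lnV: "ln \<bar>s r (V e)\<bar> = (\<Sum>i\<in>J. e i * a i r)" if r: "r \<in> R" for r e
  proof -
    have "\<bar>s r (V e)\<bar> = (\<Prod>i\<in>J. \<bar>s r (\<eta> i)\<bar> ^ e i)"
      unfolding V_def using r J(3) \<eta>(1)
      by (subst s_prod) (auto simp: abs_prod power_abs s_power subfield_power[OF subfield_K] units_K U1_units intro!: prod.cong)
    also have "ln \<dots> = (\<Sum>i\<in>J. ln (\<bar>s r (\<eta> i)\<bar> ^ e i))"
      by (rule ln_prod) (use snz r J in auto)
    also have "\<dots> = (\<Sum>i\<in>J. e i * a i r)" unfolding a_def
      by (intro sum.cong refl ln_realpow)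
    finally show ?thesis .
  qed
  have Vinj: "e i = e' i" if "V e = V e'" "i \<in> J" for e e' i
  proof -
    have "real (e i) - real (e' i) = 0"
    proof (rule dominant_zero[OF finite_R \<theta>R aneg arow])
      fix r assume r: "r \<in> R"
      show "(\<Sum>i\<in>R - {\<theta>}. (real (e i) - real (e' i)) * a i r) = 0"
        using lnV[OF r, of e] lnV[OF r, of e'] that(1) unfolding J_def by (simp add: left_diff_distrib sum_subtractf)
    qed (use that(2) in \<open>simp_all add: J_def\<close>)
    thus ?thesis by simp
  qed
  define C where "C = exp (\<Sum>i\<in>J. \<Sum>r\<in>R. \<bar>a i r\<bar>)"
  define B where "B = {x \<in> OK K. \<forall>r\<in>R. \<bar>s r x\<bar> \<le> C}"
  have finB: "finite B" unfolding B_def by (rule finite_bounded)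
  \<comment> \<open>\<open>B\<close> is fixed before \<open>n\<close>, so \<open>n\<close> may be
    its cardinality; the count will end in \<open>2 ^ n \<le> n\<close>.\<close>
  define n where "n = card B"
  have "\<exists>T\<subseteq>U1. finite T \<and> card T \<le> card (sg ` U1) ^ n \<and>
      (\<forall>u\<in>U1. \<exists>t\<in>T. \<exists>w\<in>U1. u = t * w ^ (2 ^ n))"
    by (rule U1_generators_mod_powers) (rule sq)
  then obtain T where T0: "T \<subseteq> U1 \<and> finite T \<and> card T \<le> card (sg ` U1) ^ n \<and>
      (\<forall>u\<in>U1. \<exists>t\<in>T. \<exists>w\<in>U1. u = t * w ^ (2 ^ n))" by (elim exE)
  hence T: "T \<subseteq> U1" "finite T" "card T \<le> card S ^ n" unfolding S_def by auto
  have cov: "\<exists>t\<in>T. \<exists>w\<in>U1. u = t * w ^ (2 ^ n)" if "u \<in> U1" for u using T0 that by meson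
  have "\<forall>e. \<exists>t w. t \<in> T \<and> w \<in> U1 \<and> V e = t * w ^ (2 ^ n)" using cov[OF VU] by blast
  then obtain g w where gw: "\<And>e. g e \<in> T" "\<And>e. w e \<in> U1" "\<And>e. V e = g e * w e ^ (2 ^ n)" by metis
  define A where "A = J \<rightarrow>\<^sub>E {..<2 ^ n :: nat}"
  have finA: "finite A" unfolding A_def using J by (intro finite_PiE) auto
  have cA: "card A = 2 ^ (n * Suc m)" unfolding A_def using J by (simp add: card_PiE power_mult[symmetric] power_add)
  have fibre: "card {e \<in> A. g e = t} \<le> n" if t: "t \<in> T" for t
  proof (cases "{e \<in> A. g e = t} = {}")
    case True thus ?thesis by (simp only: card.empty)
  next
    case False
    then obtain e0 where e0: "e0 \<in> A" "g e0 = t" by auto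
    have t0: "t \<noteq> 0" using t T(1) units_nz U1_units by blast
    have w0: "w e \<noteq> 0" for e using gw(2) units_nz U1_units by blast
    define \<psi> where "\<psi> e = w e / w e0" for e
    have "inj_on \<psi> {e \<in> A. g e = t}"
    proof (rule inj_onI)
      fix e e' assume e: "e \<in> {e \<in> A. g e = t}" "e' \<in> {e \<in> A. g e = t}" "\<psi> e = \<psi> e'"
      hence "w e = w e'" using w0 unfolding \<psi>_def by simp
      hence "V e = V e'" using gw(3) e by simp
      hence "\<And>i. i \<in> J \<Longrightarrow> e i = e' i" by (rule Vinj)
      thus "e = e'" using e PiE_ext[of e J "\<lambda>_. {..<2 ^ n}" e'] unfolding A_def by blast
    qed
    moreover have "\<psi> ` {e \<in> A. g e = t} \<subseteq> B"
    proof (rule image_subsetI)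
      fix e assume e: "e \<in> {e \<in> A. g e = t}"
      have pu: "\<psi> e \<in> units K" unfolding \<psi>_def using gw(2) by (intro units_divide U1_units)
      have "\<bar>s r (\<psi> e)\<bar> \<le> C" if r: "r \<in> R" for r
      proof -
        have sV: "ln \<bar>s r (V f)\<bar> = ln \<bar>s r t\<bar> + 2 ^ n * ln \<bar>s r (w f)\<bar>" if "g f = t" for f
        proof -
          have "s r t \<noteq> 0" "s r (w f) \<noteq> 0"
            using s_units_nz[OF U1_units r] t T(1) gw(2) by blast+
          moreover have "s r (V f) = s r t * s r (w f) ^ (2 ^ n)"
            using gw(2,3)[of f] t T(1) that r by (simp add: s_mult s_power units_K U1_units subset_iff subfield_power[OF subfield_K])
          ultimately show ?thesis by (simp add: abs_mult ln_mult power_abs ln_realpow)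
        qed
        have l1: "ln \<bar>s r (\<psi> e)\<bar> = ln \<bar>s r (w e)\<bar> - ln \<bar>s r (w e0)\<bar>"
        proof -
          have "s r (w e) \<noteq> 0" "s r (w e0) \<noteq> 0" using s_units_nz[OF U1_units r] gw(2) by blast+
          thus ?thesis unfolding \<psi>_def using gw(2) r by (simp add: s_divide units_K U1_units ln_div)
        qed
        \<comment> \<open>The exponents differ by less than \<open>2 ^ n\<close>, so dividing by
          \<open>2 ^ n\<close> bounds the logarithms of the conjugates independently of
          \<open>n\<close>.\<close>
        have "2 ^ n * ln \<bar>s r (\<psi> e)\<bar> = ln \<bar>s r (V e)\<bar> - ln \<bar>s r (V e0)\<bar>"
          unfolding l1 using sV[of e] sV[of e0] e e0 by (simp add: right_diff_distrib)
        also have "\<dots> = (\<Sum>i\<in>J. (real (e i) - real (e0 i)) * a i r)"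
          unfolding lnV[OF r] by (simp add: left_diff_distrib sum_subtractf)
        also have "\<dots> \<le> (\<Sum>i\<in>J. 2 ^ n * \<bar>a i r\<bar>)"
        proof (rule sum_mono)
          fix i assume i: "i \<in> J"
          have "e i < 2 ^ n" "e0 i < 2 ^ n" using e e0 i unfolding A_def by (auto dest: PiE_mem)
          hence "real (e i) < 2 ^ n" "real (e0 i) < 2 ^ n"
            by (metis of_nat_less_iff of_nat_numeral of_nat_power)+
          hence "\<bar>real (e i) - real (e0 i)\<bar> \<le> 2 ^ n" unfolding abs_le_iff by linarith
          hence "\<bar>(real (e i) - real (e0 i)) * a i r\<bar> \<le> 2 ^ n * \<bar>a i r\<bar>"
            unfolding abs_mult by (intro mult_right_mono) auto
          thus "(real (e i) - real (e0 i)) * a i r \<le> 2 ^ n * \<bar>a i r\<bar>" by linarith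
        qed
        also have "\<dots> = 2 ^ n * (\<Sum>i\<in>J. \<bar>a i r\<bar>)" by (simp add: sum_distrib_left)
        finally have "ln \<bar>s r (\<psi> e)\<bar> \<le> (\<Sum>i\<in>J. \<bar>a i r\<bar>)" by simp
        also have "\<dots> \<le> (\<Sum>i\<in>J. \<Sum>r\<in>R. \<bar>a i r\<bar>)"
          by (intro sum_mono member_le_sum[OF r]) (auto simp: finite_R)
        finally show ?thesis unfolding C_def using s_units_nz[OF pu r] by (metis abs_ge_zero abs_zero exp_le_cancel_iff exp_ln less_le zero_less_abs_iff)
      qed
      thus "\<psi> e \<in> B" unfolding B_def using pu units_OK by blast
    qed
    ultimately show ?thesis unfolding n_def using card_inj_on_le finB by blast
  qed
  have "card A \<le> card T * n" by (rule card_le_fibres[OF T(2) gw(1) fibre finA])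
  also have "\<dots> \<le> (2 ^ m) ^ n * n" using T(3) m(2) power_mono[of "card S" "2 ^ m" n] by (intro mult_right_mono) auto
  finally have "2 ^ (m * n) * 2 ^ n \<le> 2 ^ (m * n) * (n::nat)"
    unfolding cA by (simp add: power_mult[symmetric] power_add mult_ac)
  hence "2 ^ n \<le> (n::nat)" by simp
  thus False using less_exp[of n] by simp
qed

end

section \<open>Indecomposable elements\<close>

context tr_field
begin

lemma two_power_d: "(1::real) < 2 ^ d"
  using d_pos by simp

lemma square_OK_plus: "x \<in> OK K \<Longrightarrow> x \<noteq> 0 \<Longrightarrow> x\<^sup>2 \<in> OK_plus K"
  unfolding OK_plus_iff using s_eq_0[OF _ OK_K] by (auto intro: OK_power simp: s_power OK_K)

lemma OK_plus_add: "x \<in> OK_plus K \<Longrightarrow> y \<in> OK_plus K \<Longrightarrow> x + y \<in> OK_plus K"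
  unfolding OK_plus_iff by (auto intro: OK_add simp: s_add OK_K add_pos_pos)

lemma OK_plus_mult: "x \<in> OK_plus K \<Longrightarrow> y \<in> OK_plus K \<Longrightarrow> x * y \<in> OK_plus K"
  unfolding OK_plus_iff by (auto intro: OK_mult simp: s_mult OK_K)

lemma OK_plus_OK: "x \<in> OK_plus K \<Longrightarrow> x \<in> OK K" and OK_plus_K: "x \<in> OK_plus K \<Longrightarrow> x \<in> K"
  unfolding OK_plus_iff using OK_K by auto

lemma OK_plus_nz: "x \<in> OK_plus K \<Longrightarrow> x \<noteq> 0"
  unfolding OK_plus_iff using s_0 \<theta>R by force

lemma Nm_pos: "x \<in> OK_plus K \<Longrightarrow> Nm x > 0"
  unfolding OK_plus_iff Nm_def by (auto intro: prod_pos)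

lemma Nm_units: "u \<in> units K \<Longrightarrow> \<bar>Nm u\<bar> = 1"
  using units_iff by auto

text \<open>Multiplying 4 b c <= (b + c)^2 over all embeddings, with both summands of norm at least
  1, gives 4^d <= (Nm \<alpha>)^2.\<close>

lemma indecomposable_small_norm:
  assumes a: "\<alpha> \<in> OK_plus K" "Nm \<alpha> < 2 ^ d"
  shows "indecomposable K \<alpha>"
  unfolding indecomposable_def
proof (intro conjI notI)
  assume "\<exists>\<beta>\<in>OK_plus K. \<exists>\<gamma>\<in>OK_plus K. \<alpha> = \<beta> + \<gamma>"
  then obtain \<beta> \<gamma> where bc: "\<beta> \<in> OK_plus K" "\<gamma> \<in> OK_plus K" "\<alpha> = \<beta> + \<gamma>" by auto
  have "(\<Prod>r\<in>R. 4 * (s r \<beta> * s r \<gamma>)) \<le> (\<Prod>r\<in>R. (s r \<alpha>)\<^sup>2)"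
  proof (rule prod_mono, intro conjI)
    fix r assume r: "r \<in> R"
    have p: "s r \<beta> > 0" "s r \<gamma> > 0" using bc r unfolding OK_plus_iff by auto
    thus "0 \<le> 4 * (s r \<beta> * s r \<gamma>)" by simp
    have "s r \<alpha> = s r \<beta> + s r \<gamma>" unfolding bc(3) using bc r by (simp add: s_add OK_plus_K)
    moreover have "(s r \<beta> - s r \<gamma>)\<^sup>2 \<ge> 0" by simp
    ultimately show "4 * (s r \<beta> * s r \<gamma>) \<le> (s r \<alpha>)\<^sup>2" by (simp add: power2_eq_square algebra_simps)
  qed
  hence "4 ^ d * (Nm \<beta> * Nm \<gamma>) \<le> (Nm \<alpha>)\<^sup>2"
    unfolding Nm_def prod.distrib by (simp add: card_R prod_power_distrib)
  moreover have "1 * 1 \<le> Nm \<beta> * Nm \<gamma>"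
    using Nm_ge_1[OF OK_plus_OK OK_plus_nz] Nm_pos bc(1,2) by (intro mult_mono) (auto simp: abs_of_pos less_imp_le)
  hence "4 ^ d * 1 \<le> 4 ^ d * (Nm \<beta> * Nm \<gamma>)" by (intro mult_left_mono) auto
  ultimately have "4 ^ d \<le> (Nm \<alpha>)\<^sup>2" by linarith
  moreover have "(4::real) ^ d = (2 ^ d)\<^sup>2" by (simp add: power2_eq_square power_mult_distrib[symmetric])
  ultimately have "(2 ^ d)\<^sup>2 \<le> (Nm \<alpha>)\<^sup>2" by simp
  hence "2 ^ d \<le> Nm \<alpha>" using Nm_pos[OF a(1)] by (simp add: power2_le_iff_abs_le)
  thus False using a(2) by simp
qed (fact a(1))

end

text \<open>The condition that 2 \<delta> t is a sum of two squares serves twice. It makes \<delta>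
  t totally positive unless it is zero, although nothing is said about the signs of t; and it
  completes 2 x^2 + 2 w^2 = (q x)^2 + (q w)^2 to four squares.\<close>

locale core = tr_field +
  fixes q :: complex
  assumes qK: "q \<in> K" and q2: "q\<^sup>2 = 2"
    and delta_form: "\<alpha> \<in> OK_plus K \<Longrightarrow> \<exists>x w t A B. {x, w, t, A, B} \<subseteq> OK K \<and>
        \<alpha> = x\<^sup>2 + w\<^sup>2 + (2 + q) * t \<and> 2 * ((2 + q) * t) = A\<^sup>2 + B\<^sup>2"
begin

lemma q_OK: "q \<in> OK K"
proof -
  have "algebraic_int q" by (rule algebraic_int.intros[of "[:-2, 0, 1:]"])
    (use q2 in \<open>auto simp: coeff_pCons power2_eq_square split: nat.split\<close>)
  thus ?thesis using qK unfolding OK_def algebraic_integer_iff by auto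
qed

lemma qq: "q * q = 2" using q2 by (simp add: power2_eq_square)

lemma sq_q: "r \<in> R \<Longrightarrow> (s r q)\<^sup>2 = 2"
  using s_power[OF _ qK, of r 2] q2 s_numeral by metis

lemma Nm_q: "(Nm q)\<^sup>2 = 2 ^ d"
  using Nm_power[OF qK, of 2] q2 Nm_of_int[of 2] by simp

lemma delta_OK: "2 + q \<in> OK K" by (intro OK_add OK_numeral q_OK)

lemma delta_plus: "2 + q \<in> OK_plus K"
  unfolding OK_plus_iff
proof (intro conjI ballI delta_OK)
  fix r assume r: "r \<in> R"
  have "\<bar>s r q\<bar>\<^sup>2 < 2\<^sup>2" using sq_q[OF r] by simp
  hence "\<bar>s r q\<bar> < 2" by (rule power2_less_imp_less) simp
  moreover have "s r (2 + q) = 2 + s r q" using r by (simp add: s_add s_numeral qK subfield_numeral[OF subfield_K])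
  ultimately show "s r (2 + q) > 0" by linarith
qed

lemma eps_unit: "1 + q \<in> units K"
proof -
  have p: "(1 + q) * (q - 1) = 1" using qq by (simp add: algebra_simps)
  have "1 + q \<noteq> 0" using p by auto
  moreover have "inverse (1 + q) = q - 1" using p by (rule inverse_unique)
  ultimately show ?thesis unfolding units_def by (auto intro: OK_add OK_diff OK_1 q_OK)
qed

lemma delta_eq: "2 + q = q * (1 + q)" using qq by (simp add: algebra_simps)

text \<open>Since \<delta> is \<open>q\<close> times a unit, its square is twice a unit square; this
  splits every multiple of \<delta>^2 by a totally positive integer.\<close>

lemma delta_sq: "(2 + q)\<^sup>2 = (1 + q)\<^sup>2 + (1 + q)\<^sup>2"
  unfolding delta_eq power_mult_distrib q2 by simp

text \<open>The squared form avoids the exponent d/2 and the sign of the norm.\<close>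

lemma Nm_delta: "(Nm (2 + q))\<^sup>2 = 2 ^ d"
proof -
  have "\<bar>Nm (2 + q)\<bar> = \<bar>Nm q\<bar>"
    unfolding delta_eq Nm_mult[OF qK units_K[OF eps_unit]] abs_mult using Nm_units[OF eps_unit] by simp
  thus ?thesis using Nm_q by (metis power2_abs)
qed

lemma Nm_delta_gt_1: "\<bar>Nm (2 + q)\<bar> > 1"
proof (rule ccontr)
  assume "\<not> ?thesis"
  hence "\<bar>Nm (2 + q)\<bar>\<^sup>2 \<le> 1\<^sup>2" by (intro power_mono) auto
  hence "2 ^ d \<le> (1::real)" using Nm_delta by simp
  thus False using two_power_d by linarith
qed

text \<open>A nonzero \<delta> t is totally positive because its double is a sum of two squares that
  are not both zero. Indecomposability then leaves room for only one of the summands x^2, w^2 and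
  \<delta> t.\<close>

lemma indecomposable_square_or_delta:
  assumes ind: "indecomposable K \<alpha>"
  shows "(\<exists>x\<in>OK K. \<alpha> = x\<^sup>2) \<or> (\<exists>t\<in>OK K. \<alpha> = (2 + q) * t)"
proof -
  have a: "\<alpha> \<in> OK_plus K" and nd: "\<And>\<beta> \<gamma>. \<beta> \<in> OK_plus K \<Longrightarrow> \<gamma> \<in> OK_plus K \<Longrightarrow> \<alpha> \<noteq> \<beta> + \<gamma>"
    using ind unfolding indecomposable_def by auto
  obtain x w t A B where 0: "{x, w, t, A, B} \<subseteq> OK K \<and>
        \<alpha> = x\<^sup>2 + w\<^sup>2 + (2 + q) * t \<and> 2 * ((2 + q) * t) = A\<^sup>2 + B\<^sup>2" using delta_form[OF a] by (elim exE)
  hence m: "x \<in> OK K" "w \<in> OK K" "t \<in> OK K" "A \<in> OK K" "B \<in> OK K"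
    and e: "\<alpha> = x\<^sup>2 + w\<^sup>2 + (2 + q) * t" "2 * ((2 + q) * t) = A\<^sup>2 + B\<^sup>2" by auto
  show ?thesis
  proof (cases "(2 + q) * t = 0")
    case True
    hence e1: "\<alpha> = x\<^sup>2 + w\<^sup>2" using e(1) by simp
    hence "x = 0 \<or> w = 0" using nd square_OK_plus m by blast
    thus ?thesis using e1 m by auto
  next
    case False
    have AB: "A \<noteq> 0 \<or> B \<noteq> 0" using False e(2) by auto
    have pos: "(2 + q) * t \<in> OK_plus K"
      unfolding OK_plus_iff
    proof (intro conjI ballI)
      show dt: "(2 + q) * t \<in> OK K" using delta_OK m by (intro OK_mult)
      fix r assume r: "r \<in> R"
      have "2 * s r ((2 + q) * t) = s r (2 * ((2 + q) * t))"
        by (subst s_mult[OF r subfield_numeral[OF subfield_K] OK_K[OF dt]]) (simp add: s_numeral r)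
      also have "\<dots> = (s r A)\<^sup>2 + (s r B)\<^sup>2"
        unfolding e(2) using r m by (simp add: s_add s_power OK_K subfield_power[OF subfield_K])
      also have "\<dots> > 0" using AB s_eq_0[OF r OK_K] m by (auto simp: sum_power2_gt_zero_iff)
      finally show "s r ((2 + q) * t) > 0" by simp
    qed
    have "x\<^sup>2 + w\<^sup>2 \<notin> OK_plus K" using nd[OF _ pos] e(1) by auto
    hence "x = 0 \<and> w = 0" using square_OK_plus[of x] square_OK_plus[of w] OK_plus_add m by (metis add.left_neutral add.right_neutral power_zero_numeral)
    thus ?thesis using e(1) m by auto
  qed
qed

text \<open>A totally positive unit has norm 1 and is therefore indecomposable; it has no factor
  \<delta>, whose absolute norm exceeds 1.\<close>

lemma pos_unit_square:
  assumes u: "u \<in> units K" "\<forall>r\<in>R. s r u > 0"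
  shows "\<exists>v\<in>units K. u = v\<^sup>2"
proof -
  have up: "u \<in> OK_plus K" unfolding OK_plus_iff using u units_OK by auto
  have N1: "\<bar>Nm u\<bar> = 1" using Nm_units[OF u(1)] .
  have "Nm u < 2 ^ d" using N1 two_power_d by linarith
  from indecomposable_square_or_delta[OF indecomposable_small_norm[OF up this]]
  show ?thesis
  proof
    assume "\<exists>x\<in>OK K. u = x\<^sup>2"
    then obtain x where x: "x \<in> OK K" "u = x\<^sup>2" by auto
    have "\<bar>Nm x\<bar>\<^sup>2 = 1" using N1 Nm_power[OF OK_K[OF x(1)], of 2] x(2) by simp
    hence "\<bar>Nm x\<bar> = 1" by (auto simp: power2_eq_1_iff)
    thus ?thesis using x units_iff by auto
  next
    assume "\<exists>t\<in>OK K. u = (2 + q) * t"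
    then obtain t where t: "t \<in> OK K" "u = (2 + q) * t" by auto
    have "\<bar>Nm (2 + q)\<bar> * \<bar>Nm t\<bar> = 1" using N1 unfolding t(2) Nm_mult[OF OK_K[OF delta_OK] OK_K[OF t(1)]] abs_mult .
    moreover have "\<bar>Nm t\<bar> \<ge> 1" using Nm_ge_1[OF t(1)] t(2) units_nz[OF u(1)] by auto
    hence "\<bar>Nm (2 + q)\<bar> * 1 \<le> \<bar>Nm (2 + q)\<bar> * \<bar>Nm t\<bar>" by (intro mult_left_mono) auto
    ultimately show ?thesis using Nm_delta_gt_1 by simp
  qed
qed

lemma unit_multiple_pos:
  assumes x: "x \<in> OK K" "x \<noteq> 0"
  shows "\<exists>u\<in>units K. u * x \<in> OK_plus K"
proof -
  obtain u where u: "u \<in> units K" "sg u = {r \<in> R. s r x > 0}"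
    using all_signs[OF pos_unit_square, of "{r \<in> R. s r x > 0}"] by blast
  have "u * x \<in> OK_plus K" unfolding OK_plus_iff
  proof (intro conjI ballI)
    fix r assume r: "r \<in> R"
    have "s r u > 0 \<longleftrightarrow> s r x > 0" using u(2) r unfolding sg_def by auto
    moreover have "s r u \<noteq> 0" "s r x \<noteq> 0" using s_units_nz[OF u(1) r] s_eq_0[OF r OK_K[OF x(1)]] x(2) by auto
    ultimately show "s r (u * x) > 0"
      using s_mult[OF r units_K[OF u(1)] OK_K[OF x(1)]] by (auto simp: zero_less_mult_iff)
  qed (intro OK_mult units_OK u x)
  thus ?thesis using u by auto
qed

lemma unit_square_plus: "u \<in> units K \<Longrightarrow> u\<^sup>2 \<in> OK_plus K"
  by (intro square_OK_plus units_OK units_nz)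

lemma indecomposable_unit_square:
  assumes "indecomposable K \<alpha>" "u \<in> units K"
  shows "indecomposable K (u\<^sup>2 * \<alpha>)"
  unfolding indecomposable_def
proof (intro conjI notI)
  show "u\<^sup>2 * \<alpha> \<in> OK_plus K" using assms unit_square_plus unfolding indecomposable_def by (auto intro: OK_plus_mult)
  assume "\<exists>\<beta>\<in>OK_plus K. \<exists>\<gamma>\<in>OK_plus K. u\<^sup>2 * \<alpha> = \<beta> + \<gamma>"
  then obtain \<beta> \<gamma> where bc: "\<beta> \<in> OK_plus K" "\<gamma> \<in> OK_plus K" "u\<^sup>2 * \<alpha> = \<beta> + \<gamma>" by auto
  have "\<alpha> = (inverse u)\<^sup>2 * (u\<^sup>2 * \<alpha>)" using units_nz[OF assms(2)] by (simp add: power_mult_distrib[symmetric] mult.assoc[symmetric])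
  also have "\<dots> = (inverse u)\<^sup>2 * \<beta> + (inverse u)\<^sup>2 * \<gamma>" unfolding bc(3) by (simp add: distrib_left)
  finally show False using assms(1) bc OK_plus_mult[OF unit_square_plus[OF units_inverse[OF assms(2)]]]
    unfolding indecomposable_def by blast
qed

lemma delta_sq_multiple_decomposable:
  assumes "t \<in> OK_plus K" shows "\<not> indecomposable K ((2 + q)\<^sup>2 * t)"
proof -
  have "(2 + q)\<^sup>2 * t = (1 + q)\<^sup>2 * t + (1 + q)\<^sup>2 * t" unfolding delta_sq by (simp add: distrib_right)
  thus ?thesis using OK_plus_mult[OF unit_square_plus[OF eps_unit] assms] unfolding indecomposable_def by blast
qed

text \<open>Descent on the norm. Up to a unit, \<open>x\<close> is a totally positive
  \<open>y\<close>, and a splitting of \<open>y\<close>, multiplied by \<open>y\<close>, would split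
  its square; so \<open>y\<close> is indecomposable. If \<open>y\<close> is the square of
  \<open>z\<close>, then \<open>z\<close> has smaller norm unless it is a unit; if \<open>y\<close>
  is a multiple of \<delta>, its square decomposes.\<close>

lemma indecomposable_square_unit:
  assumes "x \<in> OK K" "indecomposable K (x\<^sup>2)"
  shows "x \<in> units K"
  using assms
proof (induction "nat \<lfloor>\<bar>Nm x\<bar>\<rfloor>" arbitrary: x rule: less_induct)
  case less
  note x = less.prems
  have xn: "x \<noteq> 0" using x(2) OK_plus_nz unfolding indecomposable_def by force
  obtain u where u: "u \<in> units K" "u * x \<in> OK_plus K" using unit_multiple_pos[OF x(1) xn] by auto
  define y where "y = u * x"
  have y: "y \<in> OK_plus K" using u unfolding y_def by simp
  have y2: "indecomposable K (y\<^sup>2)" unfolding y_def power_mult_distrib by (rule indecomposable_unit_square[OF x(2) u(1)])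
  have Ny: "\<bar>Nm y\<bar> = \<bar>Nm x\<bar>" unfolding y_def Nm_mult[OF units_K[OF u(1)] OK_K[OF x(1)]] abs_mult Nm_units[OF u(1)] by simp
  have "indecomposable K y" unfolding indecomposable_def
  proof (intro conjI notI)
    assume "\<exists>\<beta>\<in>OK_plus K. \<exists>\<gamma>\<in>OK_plus K. y = \<beta> + \<gamma>"
    then obtain \<beta> \<gamma> where bc: "\<beta> \<in> OK_plus K" "\<gamma> \<in> OK_plus K" "y = \<beta> + \<gamma>" by auto
    have "y\<^sup>2 = \<beta> * y + \<gamma> * y" using bc(3) by (simp add: power2_eq_square distrib_right)
    thus False using y2 OK_plus_mult[OF _ y] bc unfolding indecomposable_def by blast
  qed (fact y)
  from indecomposable_square_or_delta[OF this] show ?case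
  proof
    assume "\<exists>z\<in>OK K. y = z\<^sup>2"
    then obtain z where z: "z \<in> OK K" "y = z\<^sup>2" by auto
    have N: "\<bar>Nm x\<bar> = \<bar>Nm z\<bar>\<^sup>2" using Ny Nm_power[OF OK_K[OF z(1)], of 2] z(2) by simp
    have z0: "z \<noteq> 0" using z(2) OK_plus_nz[OF y] by auto
    show ?thesis
    proof (cases "\<bar>Nm z\<bar> = 1")
      case True thus ?thesis using N units_iff x(1) by simp
    next
      case False
      obtain n where n: "Nm z = of_int n" using Nm_int[OF z(1)] by auto
      have n2: "\<bar>n\<bar> \<ge> 2" using False Nm_ge_1[OF z(1) z0] n by auto
      hence "\<bar>n\<bar> * 1 < \<bar>n\<bar> * \<bar>n\<bar>" by (intro mult_strict_left_mono) auto
      moreover have "\<bar>Nm x\<bar> = of_int (\<bar>n\<bar> * \<bar>n\<bar>)" using N n by (simp add: power2_eq_square)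
      hence "\<lfloor>\<bar>Nm x\<bar>\<rfloor> = \<bar>n\<bar> * \<bar>n\<bar>" by (simp only: floor_of_int)
      moreover have "\<lfloor>\<bar>Nm z\<bar>\<rfloor> = \<bar>n\<bar>" using n by (metis floor_of_int of_int_abs)
      ultimately have "nat \<lfloor>\<bar>Nm z\<bar>\<rfloor> < nat \<lfloor>\<bar>Nm x\<bar>\<rfloor>" using n2 by simp
      moreover have "indecomposable K (z\<^sup>2)" using \<open>indecomposable K y\<close> z by simp
      ultimately have "z \<in> units K" using less.hyps z(1) by blast
      thus ?thesis using N Nm_units x(1) units_iff by simp
    qed
  next
    assume "\<exists>t\<in>OK K. y = (2 + q) * t"
    then obtain t where t: "t \<in> OK K" "y = (2 + q) * t" by auto
    have "t \<noteq> 0" using t(2) OK_plus_nz[OF y] by auto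
    moreover have "y\<^sup>2 = (2 + q)\<^sup>2 * t\<^sup>2" unfolding t(2) by (simp add: power_mult_distrib)
    ultimately show ?thesis using y2 delta_sq_multiple_decomposable[OF square_OK_plus[OF t(1)]] by simp
  qed
qed

text \<open>When \<alpha> = \<delta> t, the factor t is again totally positive and indecomposable. A
  second factor \<delta> would make \<alpha> decomposable, so t is a square, and that of a
  unit.\<close>

lemma indecomposable_classification:
  assumes a: "indecomposable K \<alpha>"
  shows "\<exists>u\<in>units K. \<alpha> = u\<^sup>2 \<or> \<alpha> = (2 + q) * u\<^sup>2"
  using indecomposable_square_or_delta[OF a]
proof
  assume "\<exists>x\<in>OK K. \<alpha> = x\<^sup>2"
  thus ?thesis using indecomposable_square_unit a by blast
next
  assume "\<exists>t\<in>OK K. \<alpha> = (2 + q) * t"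
  then obtain t where t: "t \<in> OK K" "\<alpha> = (2 + q) * t" by auto
  have ap: "\<alpha> \<in> OK_plus K" using a unfolding indecomposable_def by auto
  have quot: "z \<in> OK_plus K" if z: "z \<in> OK K" "(2 + q) * z \<in> OK_plus K" for z
    unfolding OK_plus_iff
  proof (intro conjI ballI z(1))
    fix r assume r: "r \<in> R"
    have "s r (2 + q) * s r z > 0" "s r (2 + q) > 0"
      using z(2) delta_plus r s_mult[OF r OK_K[OF delta_OK] OK_K[OF z(1)]] unfolding OK_plus_iff by auto
    thus "s r z > 0" by (simp add: zero_less_mult_iff)
  qed
  have tp: "t \<in> OK_plus K" using quot t ap by simp
  have "indecomposable K t" unfolding indecomposable_def
  proof (intro conjI notI)
    assume "\<exists>\<beta>\<in>OK_plus K. \<exists>\<gamma>\<in>OK_plus K. t = \<beta> + \<gamma>"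
    then obtain \<beta> \<gamma> where bc: "\<beta> \<in> OK_plus K" "\<gamma> \<in> OK_plus K" "t = \<beta> + \<gamma>" by auto
    have "\<alpha> = (2 + q) * \<beta> + (2 + q) * \<gamma>" unfolding t(2) bc(3) by (simp add: distrib_left)
    thus False using a OK_plus_mult[OF delta_plus] bc unfolding indecomposable_def by blast
  qed (fact tp)
  from indecomposable_square_or_delta[OF this] show ?thesis
  proof
    assume "\<exists>x\<in>OK K. t = x\<^sup>2"
    thus ?thesis using indecomposable_square_unit \<open>indecomposable K t\<close> t(2) by blast
  next
    assume "\<exists>z\<in>OK K. t = (2 + q) * z"
    then obtain z where z: "z \<in> OK K" "t = (2 + q) * z" by auto
    hence "z \<in> OK_plus K" using quot tp by simp
    moreover have "\<alpha> = (2 + q)\<^sup>2 * z" unfolding t(2) z(2) by (simp add: power2_eq_square mult_ac)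
    ultimately show ?thesis using delta_sq_multiple_decomposable a by simp
  qed
qed

lemma small_norm:
  assumes x: "x \<in> OK K" "x \<noteq> 0" "\<bar>Nm x\<bar> < 2 ^ d"
  shows "\<exists>u\<in>units K. x = u \<or> x = (2 + q) * u"
proof -
  obtain u where u: "u \<in> units K" "u * x \<in> OK_plus K" using unit_multiple_pos[OF x(1,2)] by auto
  have "\<bar>Nm (u * x)\<bar> = \<bar>Nm x\<bar>" unfolding Nm_mult[OF units_K[OF u(1)] OK_K[OF x(1)]] abs_mult Nm_units[OF u(1)] by simp
  hence "Nm (u * x) < 2 ^ d" using x(3) by linarith
  from indecomposable_classification[OF indecomposable_small_norm[OF u(2) this]]
  obtain v where v: "v \<in> units K" "u * x = v\<^sup>2 \<or> u * x = (2 + q) * v\<^sup>2" by auto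
  have "x = v\<^sup>2 / u \<or> x = (2 + q) * (v\<^sup>2 / u)"
    using v(2) units_nz[OF u(1)] by (auto simp: field_simps)
  moreover have "v\<^sup>2 / u \<in> units K" using u v by (intro units_divide units_power)
  ultimately show ?thesis by blast
qed

text \<open>The absolute norm of \<open>x\<close> would be 2^(d/4), so \<open>small_norm\<close>
  would make \<open>x\<close> a unit or \<delta> times a unit; in both cases \<open>q\<close> would
  be a unit, against its norm.\<close>

lemma no_root_of_q:
  assumes x: "x \<in> OK K" and u: "u \<in> units K"
  shows "x\<^sup>2 \<noteq> q * u"
proof
  assume e: "x\<^sup>2 = q * u"
  have q0: "q \<noteq> 0" using qq by auto
  have x0: "x \<noteq> 0" using e q0 units_nz[OF u] by auto
  have qnu: "q \<notin> units K"
  proof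
    assume "q \<in> units K"
    hence "(Nm q)\<^sup>2 = 1" using Nm_units by (metis power2_abs one_power2)
    thus False using Nm_q two_power_d by linarith
  qed
  have "\<bar>Nm x\<bar>\<^sup>2 = \<bar>Nm (x\<^sup>2)\<bar>" using Nm_power[OF OK_K[OF x], of 2] by simp
  also have "\<dots> = \<bar>Nm q\<bar>"
    unfolding e Nm_mult[OF qK units_K[OF u]] abs_mult Nm_units[OF u] by simp
  finally have N: "\<bar>Nm x\<bar>\<^sup>2 = \<bar>Nm q\<bar>" .
  have "\<bar>Nm q\<bar>\<^sup>2 < (2 ^ d)\<^sup>2"
    unfolding power2_abs Nm_q using two_power_d d_pos by (simp add: power2_eq_square)
  hence "\<bar>Nm q\<bar> < 2 ^ d" by (rule power2_less_imp_less) simp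
  also have "\<dots> \<le> (2 ^ d)\<^sup>2" by (simp add: power2_eq_square)
  finally have "\<bar>Nm x\<bar> < 2 ^ d" unfolding N[symmetric] by (rule power2_less_imp_less) simp
  from small_norm[OF x x0 this] obtain v where v: "v \<in> units K" "x = v \<or> x = (2 + q) * v" by auto
  from v(2) show False
  proof
    assume "x = v"
    hence "q = v\<^sup>2 / u" using e units_nz[OF u] by (simp add: field_simps)
    thus False using qnu units_divide units_power v(1) u by metis
  next
    assume "x = (2 + q) * v"
    hence "q * q * ((1 + q) * v)\<^sup>2 = q * u" using e unfolding delta_eq by (simp add: power2_eq_square mult_ac)
    hence "q * ((1 + q) * v)\<^sup>2 = u" using q0 by simp
    moreover have "(1 + q) * v \<noteq> 0" using units_nz eps_unit v(1) by simp
    ultimately have "q = u / ((1 + q) * v)\<^sup>2" by (simp add: field_simps)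
    thus False using qnu units_divide units_power units_mult eps_unit v(1) u by metis
  qed
qed

lemma unit_quotient_unique: "A \<in> unit_quotient K \<Longrightarrow> B \<in> unit_quotient K \<Longrightarrow> A = B"
proof -
  have "A = unit_squares K" if A: "A \<in> unit_quotient K" for A
  proof -
    obtain e where e: "e \<in> units_plus K" "A = (\<lambda>\<eta>. e * \<eta>) ` unit_squares K" using A unfolding unit_quotient_def by auto
    have eu: "e \<in> units K" "\<forall>r\<in>R. s r e > 0" using e(1) unfolding units_plus_def totally_positive_iff by auto
    obtain v where v: "v \<in> units K" "e = v\<^sup>2" using pos_unit_square[OF eu] by auto
    show ?thesis
    proof (intro equalityI subsetI)
      fix x assume "x \<in> A"
      then obtain w where w: "w \<in> units K" "x = e * w\<^sup>2" using e(2) unfolding unit_squares_def by auto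
      hence "x = (v * w)\<^sup>2" using v by (simp add: power_mult_distrib)
      thus "x \<in> unit_squares K" unfolding unit_squares_def using units_mult v(1) w(1) by auto
    next
      fix x assume "x \<in> unit_squares K"
      then obtain w where w: "w \<in> units K" "x = w\<^sup>2" unfolding unit_squares_def by auto
      have "x = e * (w / v)\<^sup>2" using w(2) v units_nz[OF v(1)] by (simp add: power_divide)
      moreover have "(w / v)\<^sup>2 \<in> unit_squares K" unfolding unit_squares_def using units_divide w(1) v(1) by auto
      ultimately show "x \<in> A" unfolding e(2) by auto
    qed
  qed
  thus "A \<in> unit_quotient K \<Longrightarrow> B \<in> unit_quotient K \<Longrightarrow> A = B" by metis
qed

lemma double_sum_four_squares: "\<alpha> \<in> OK_plus K \<Longrightarrow> 2 * \<alpha> \<in> sum_four_squares K"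
proof -
  assume "\<alpha> \<in> OK_plus K"
  from delta_form[OF this] obtain x w t A B where 0: "{x, w, t, A, B} \<subseteq> OK K \<and>
        \<alpha> = x\<^sup>2 + w\<^sup>2 + (2 + q) * t \<and> 2 * ((2 + q) * t) = A\<^sup>2 + B\<^sup>2" by (elim exE)
  have "2 * \<alpha> = 2 * x\<^sup>2 + 2 * w\<^sup>2 + 2 * ((2 + q) * t)" using 0 by (simp only: distrib_left)
  also have "\<dots> = (q * x)\<^sup>2 + (q * w)\<^sup>2 + A\<^sup>2 + B\<^sup>2" using 0 by (simp add: power_mult_distrib q2)
  finally show ?thesis unfolding sum_four_squares_def using 0 OK_mult[OF q_OK] by blast
qed

lemma indecomposable_unit_squares: "indecomposable K \<alpha> \<Longrightarrow> \<alpha> \<in> unit_squares K \<union> (\<lambda>\<eta>. (2 + q) * \<eta>) ` unit_squares K"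
  using indecomposable_classification[of \<alpha>] unfolding unit_squares_def by blast

end

section \<open>Real cyclotomic subfields\<close>

lemma algebraic_int_of_power:
  assumes "algebraic_int (x ^ n :: complex)" "n > 0"
  shows "algebraic_int x"
  by (rule algebraic_int_root[OF assms(1), of "monom 1 n"]) (use assms(2) in \<open>auto simp: poly_monom degree_monom_eq\<close>)

lemma algebraic_int_root_of_unity: "z ^ n = 1 \<Longrightarrow> n > 0 \<Longrightarrow> algebraic_int (z :: complex)"
  using algebraic_int_of_power[of z n] by simp

text \<open>The powers of \<open>z\<close> below \<open>p\<close> are distinct: z^(j - i) = 1 with j
  - i prime to p gives z = 1 by Bezout. Hence they exhaust the p-th roots of unity.\<close>

lemma prime_root_of_unity_power:
  assumes p: "prime (p::nat)" and z: "z ^ p = 1" "z \<noteq> 1" and w: "(w::complex) ^ p = 1"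
  shows "\<exists>j. w = z ^ j"
proof -
  have z0: "z \<noteq> 0" using z(1) p by (metis power_0_left prime_gt_0_nat zero_neq_one less_numeral_extra(3))
  have ne: "z ^ i \<noteq> z ^ j" if ij: "i < j" "j < p" for i j
  proof
    assume e: "z ^ i = z ^ j"
    have "z ^ j = z ^ i * z ^ (j - i)" using ij by (simp add: power_add[symmetric])
    hence 1: "z ^ (j - i) = 1" using e z0 by simp
    have "coprime (j - i) p" using p ij by (metis coprime_commute prime_imp_coprime_nat nat_dvd_not_less diff_less_mono2 less_imp_diff_less zero_less_diff)
    moreover have "j - i \<noteq> 0" using ij by simp
    ultimately obtain a b where ab: "(j - i) * a = p * b + 1" using bezout_nat[of "j - i" p] by (metis coprime_iff_gcd_eq_1)
    have "1 = (z ^ (j - i)) ^ a" using 1 by simp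
    also have "\<dots> = z ^ (p * b + 1)" unfolding power_mult[symmetric] ab ..
    also have "\<dots> = z" using z(1) by (simp add: power_add power_mult)
    finally show False using z(2) by simp
  qed
  have inj: "inj_on (\<lambda>j. z ^ j) {..<p}"
  proof (rule inj_onI, rule ccontr)
    fix i j assume "i \<in> {..<p}" "j \<in> {..<p}" "z ^ i = z ^ j" "i \<noteq> j"
    thus False using ne[of i j] ne[of j i] by (cases "i < j") auto
  qed
  have p0: "p > 0" using p prime_gt_0_nat by blast
  have "(\<lambda>j. z ^ j) ` {..<p} = {w. w ^ p = 1}"
  proof (rule card_subset_eq)
    show "finite {w::complex. w ^ p = 1}" using finite_roots_unity[of p] p0 by simp
    show "(\<lambda>j. z ^ j) ` {..<p} \<subseteq> {w. w ^ p = 1}" using z(1) by (auto simp: power_mult[symmetric] mult.commute[of _ p]) (simp add: power_mult)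
    show "card ((\<lambda>j. z ^ j) ` {..<p}) = card {w::complex. w ^ p = 1}"
      using inj p0 by (simp add: card_image card_roots_unity_eq)
  qed
  thus ?thesis using w by auto
qed

text \<open>Evaluate (X^n - 1) / (X - 1) = 1 + X + ... + X^(n-1) at 1.\<close>

lemma prod_one_minus_roots_of_unity:
  assumes n: "n > 0"
  shows "(\<Prod>w\<in>{w::complex. w ^ n = 1} - {1}. 1 - w) = of_nat n"
proof -
  define P :: "complex poly" where "P = monom 1 n - 1"
  have Pz: "poly P z = z ^ n - 1" for z unfolding P_def by (simp add: poly_monom)
  have "rsquarefree P" unfolding rsquarefree_roots
  proof (intro allI notI, elim conjE)
    fix a assume "poly P a = 0" "poly (pderiv P) a = 0"
    hence "a ^ n = 1" "of_nat n * a ^ (n - 1) = 0"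
      unfolding Pz by (simp_all add: P_def pderiv_diff pderiv_monom poly_monom)
    moreover have "a \<noteq> 0" using \<open>a ^ n = 1\<close> n by (auto simp: power_0_left)
    ultimately show False using n by simp
  qed
  moreover have "lead_coeff P = 1"
  proof -
    have "degree P = n" unfolding P_def using n
      by (metis degree_1 degree_add_eq_left degree_minus degree_monom_eq diff_conv_add_uminus zero_neq_one)
    thus ?thesis unfolding P_def using n by simp
  qed
  ultimately have "P = (\<Prod>w\<in>{w. w ^ n = 1}. [:-w, 1:])"
    using complex_poly_decompose_rsquarefree[of P] by (simp add: Pz)
  also have "\<dots> = [:-1, 1:] * (\<Prod>w\<in>{w. w ^ n = 1} - {1}. [:-w, 1:])"
    using finite_roots_unity[of n] n by (subst prod.remove[of _ 1]) auto
  finally have 1: "P = [:-1, 1:] * (\<Prod>w\<in>{w. w ^ n = 1} - {1}. [:-w, 1:])" .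
  have "P = [:-1, 1:] * (\<Sum>i<n. monom 1 i)"
  proof (rule poly_eq_poly_eq_iff[THEN iffD1], rule ext)
    fix x show "poly P x = poly ([:-1, 1:] * (\<Sum>i<n. monom 1 i)) x"
      unfolding Pz power_diff_1_eq by (simp add: poly_sum poly_monom left_diff_distrib)
  qed
  hence "(\<Prod>w\<in>{w::complex. w ^ n = 1} - {1}. [:-w, 1:]) = (\<Sum>i<n. monom 1 i)" using 1 by (metis mult_left_cancel one_neq_zero pCons_eq_0_iff)
  hence "poly (\<Prod>w\<in>{w::complex. w ^ n = 1} - {1}. [:-w, 1:]) 1 = poly (\<Sum>i<n. monom 1 i) 1" by simp
  thus ?thesis by (simp add: poly_prod poly_sum poly_monom)
qed

text \<open>The size condition of \<open>no_prime\<close>; it fails at 5, where 25 > 16.\<close>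

lemma prime_square_less: "p \<ge> 7 \<Longrightarrow> (p::nat)\<^sup>2 < 2 ^ (p - 1)"
proof (induction p rule: nat_induct_at_least)
  case (Suc n)
  have "(Suc n)\<^sup>2 \<le> 2 * n\<^sup>2"
  proof -
    have "7 * n \<le> n * n" using Suc.hyps by simp
    hence "2 * n + 1 \<le> n * n" using Suc.hyps by linarith
    thus ?thesis by (simp add: power2_eq_square)
  qed
  also have "\<dots> < 2 * 2 ^ (n - 1)" using Suc.IH by simp
  also have "\<dots> = 2 ^ (Suc n - 1)" using Suc.hyps by (cases n) auto
  finally show ?case .
qed simp

section \<open>Excluding the orders 16, 12, 9, the primes from 7 on, and 5\<close>

context core
begin

lemma power_sum_K:
  assumes "z \<noteq> 0" "z + inverse z \<in> K"
  shows "z ^ n + inverse (z ^ n) \<in> K"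
proof -
  \<comment> \<open>The recursion has two steps, so two consecutive values are carried
    along.\<close>
  have "z ^ n + inverse (z ^ n) \<in> K \<and> z ^ Suc n + inverse (z ^ Suc n) \<in> K"
  proof (induction n)
    case 0
    show ?case using assms subfield_numeral[OF subfield_K, of "num.Bit0 num.One"] by simp
  next
    case (Suc n)
    have "z ^ Suc (Suc n) + inverse (z ^ Suc (Suc n)) =
      (z + inverse z) * (z ^ Suc n + inverse (z ^ Suc n)) - (z ^ n + inverse (z ^ n))"
      using assms(1) by (simp add: field_simps)
    also have "\<dots> \<in> K" using Suc assms(2) by (intro subfield_diff[OF subfield_K] subfield_mult[OF subfield_K]) auto
    finally show ?case using Suc by simp
  qed
  thus ?thesis ..
qed

lemma cos_OK: "z ^ n = 1 \<Longrightarrow> n > 0 \<Longrightarrow> z + inverse z \<in> K \<Longrightarrow> z + inverse z \<in> OK K"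
  using algebraic_int_root_of_unity[of z n] algebraic_int_root_of_unity[of "inverse z" n]
  unfolding OK_def algebraic_integer_iff by (auto simp: power_inverse)

lemma unitI: "x \<in> OK K \<Longrightarrow> y \<in> OK K \<Longrightarrow> x * y = 1 \<Longrightarrow> x \<in> units K"
  unfolding units_def using inverse_unique[of x y] by auto

lemma OK_of_square: "x \<in> K \<Longrightarrow> x\<^sup>2 \<in> OK K \<Longrightarrow> x \<in> OK K"
  using algebraic_int_of_power[of x 2] unfolding OK_def algebraic_integer_iff by auto

lemma q_minus_1_unit: "q - 1 \<in> units K"
  by (rule unitI[of _ "1 + q"]) (use qq in \<open>auto intro: OK_diff OK_add q_OK OK_1 simp: algebra_simps\<close>)

text \<open>For a primitive 16th root of unity, c^2 - 2 = z^2 + z^(-2) is a square root of 2, so c^2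
  is 2 + q or 2 - q, in both cases \<open>q\<close> times a unit.\<close>

lemma no_16:
  assumes z: "z ^ 8 = -1" "z + inverse z \<in> K"
  shows False
proof -
  have z0: "z \<noteq> 0" using z(1) by auto
  have "z ^ 16 = (z ^ 8) ^ 2" by (simp flip: power_mult)
  hence OK: "z + inverse z \<in> OK K" using cos_OK[of z 16] z by simp
  define c where "c = z + inverse z"
  define p where "p = c\<^sup>2 - 2"
  have "p\<^sup>2 * z ^ 4 = 2 * z ^ 4 + (z ^ 8 + 1)"
    unfolding p_def c_def using z0 by (simp add: field_simps power2_eq_square power4_eq_xxxx) (simp add: eval_nat_numeral)
  hence "p\<^sup>2 = q\<^sup>2" using z0 z(1) q2 by simp
  hence "p = q \<or> p = - q" by (simp add: power2_eq_iff)
  hence "c\<^sup>2 = q * (1 + q) \<or> c\<^sup>2 = q * (q - 1)" unfolding p_def using qq by (auto simp: algebra_simps)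
  thus False using no_root_of_q OK eps_unit q_minus_1_unit unfolding c_def by blast
qed

text \<open>The element \<open>y\<close> is a conjugate of (sqrt 6 + sqrt 2) / 2 = 2 cos (pi / 12),
  a unit with square 2 + t. The square of 1 + y is \<open>q\<close> times the unit y (t + q),
  against \<open>no_root_of_q\<close>.\<close>

lemma no_sqrt3:
  assumes t: "t \<in> K" "t\<^sup>2 = 3"
  shows False
proof -
  have tt: "t * t = 3" using t(2) by (simp add: power2_eq_square)
  have tO: "t \<in> OK K" by (rule OK_of_square[OF t(1)]) (simp add: t(2) OK_numeral)
  define y where "y = q * (t + 1) / 2"
  have yK: "y \<in> K" unfolding y_def using t(1) qK
    by (intro subfield_divide[OF subfield_K] subfield_mult[OF subfield_K] subfield_add[OF subfield_K] subfield_1[OF subfield_K] subfield_numeral[OF subfield_K])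
  have y2: "y\<^sup>2 = 2 + t" unfolding y_def power_divide power_mult_distrib q2 using tt
    by (simp add: power2_eq_square algebra_simps)
  have yO: "y \<in> OK K" by (rule OK_of_square[OF yK]) (unfold y2, intro OK_add OK_numeral tO)
  have yu: "y \<in> units K"
  proof (rule unitI[OF yO])
    show "y * (2 - t) \<in> OK K" by (intro OK_mult OK_diff OK_numeral tO yO)
    have "y * (y * (2 - t)) = y\<^sup>2 * (2 - t)" by (simp add: power2_eq_square)
    also have "\<dots> = 1" unfolding y2 using tt by (simp add: algebra_simps)
    finally show "y * (y * (2 - t)) = 1" .
  qed
  have tq: "t + q \<in> units K"
    by (rule unitI[of _ "t - q"]) (use qq tt in \<open>auto intro!: OK_add OK_diff tO q_OK simp: algebra_simps\<close>)
  have qy: "q * y = t + 1" unfolding y_def using qq by (simp add: field_simps)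
  have "(1 + y)\<^sup>2 = 1 + 2 * y + y\<^sup>2" by (simp add: power2_eq_square algebra_simps)
  also have "2 * y = q * (q * y)" using qq by (metis mult.assoc)
  also have "1 + q * (q * y) + y\<^sup>2 = (q * y) * (t + q)" unfolding qy y2 using tt by (simp add: algebra_simps)
  finally have "(1 + y)\<^sup>2 = q * (y * (t + q))" by (simp add: mult.assoc)
  moreover have "1 + y \<in> OK K" by (intro OK_add OK_1 yO)
  ultimately show False using no_root_of_q units_mult[OF yu tq] by blast
qed

text \<open>Squaring turns the norm of \<delta> into 2^d and leaves an even integer equal to an odd
  one. The cofactor \<open>m\<close> allows for a norm that merely divides the power of
  \<open>n\<close>.\<close>

lemma Nm_delta_times_ne_odd:
  assumes n: "odd (n::nat)" and k: "k > 0" and N: "\<bar>Nm (2 + q)\<bar> ^ k * \<bar>of_int m\<bar> = real n ^ e"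
  shows False
proof -
  have "(\<bar>Nm (2 + q)\<bar> ^ k * \<bar>of_int m\<bar>)\<^sup>2 = (\<bar>Nm (2 + q)\<bar>\<^sup>2) ^ k * \<bar>of_int m\<bar>\<^sup>2"
    by (simp only: power_mult_distrib power_mult[symmetric] mult.commute)
  also have "\<dots> = 2 ^ (d * k) * (of_int m)\<^sup>2" using Nm_delta by (simp add: power_mult)
  finally have "of_int (2 ^ (d * k) * m\<^sup>2) = (of_int (int n ^ (e * 2)) :: real)"
    unfolding N by (simp add: power_mult)
  hence "2 ^ (d * k) * m\<^sup>2 = int n ^ (e * 2)" by (simp only: of_int_eq_iff)
  moreover have "even ((2::int) ^ (d * k) * m\<^sup>2)" using d_pos k by simp
  moreover have "odd (int n ^ (e * 2))" using n by simp
  ultimately show False by simp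
qed

text \<open>The absolute norm of \<open>x\<close> is n^(d i / k), strictly between 1 and 2^d. By
  \<open>small_norm\<close> it would be 1 or that of \<delta>, and the latter is excluded by
  parity.\<close>

lemma no_small_over_odd:
  assumes x: "x \<in> OK K" and v: "v \<in> units K" and n: "odd (n::nat)" "n > 1"
    and k: "k > 0" and e: "x ^ k = of_nat n ^ i * v" and i: "i > 0" and small: "n ^ i < 2 ^ k"
  shows False
proof -
  have N: "\<bar>Nm x\<bar> ^ k = real n ^ (d * i)"
  proof -
    have nn: "(of_nat n :: complex) ^ i = of_int (int n ^ i)" by simp
    have "\<bar>Nm x\<bar> ^ k = \<bar>Nm (x ^ k)\<bar>" by (simp add: Nm_power OK_K[OF x] power_abs)
    also have "\<dots> = \<bar>of_int (int n ^ i) ^ d\<bar> * \<bar>Nm v\<bar>"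
      unfolding e nn Nm_mult[OF subfield_of_int[OF subfield_K] units_K[OF v]] Nm_of_int abs_mult ..
    also have "\<dots> = real n ^ (d * i)" using Nm_units[OF v] by (simp add: power_mult[symmetric] mult.commute)
    finally show ?thesis .
  qed
  have gt: "real n ^ (d * i) > 1" using n d_pos i by (intro one_less_power) auto
  have x0: "x \<noteq> 0" using N gt Nm_eq_0[OF OK_K[OF x]] k by (auto simp: power_0_left)
  have "\<bar>Nm x\<bar> ^ k < (2 ^ d) ^ k"
  proof -
    have "real (n ^ i) < real (2 ^ k)" using small by (simp only: of_nat_less_iff)
    hence "real (n ^ i) ^ d < real (2 ^ k) ^ d" using d_pos by (intro power_strict_mono) auto
    thus ?thesis unfolding N by (simp add: power_mult[symmetric] mult.commute)
  qed
  hence "\<bar>Nm x\<bar> < 2 ^ d" by (rule power_less_imp_less_base) simp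
  from small_norm[OF x x0 this] obtain u where u: "u \<in> units K" "x = u \<or> x = (2 + q) * u" by auto
  from u(2) show False
  proof
    assume "x = u"
    thus False using N gt Nm_units[OF u(1)] by simp
  next
    assume "x = (2 + q) * u"
    hence "\<bar>Nm x\<bar> = \<bar>Nm (2 + q)\<bar>" using Nm_mult[OF OK_K[OF delta_OK] units_K[OF u(1)]] Nm_units[OF u(1)] by (simp add: abs_mult)
    thus False using Nm_delta_times_ne_odd[OF n(1) k, of 1 "d * i"] N by simp
  qed
qed

text \<open>Here \<open>c\<close> is a root of X^3 - 3 X + 1, in whose field 3 is totally ramified:
  2 - c and 1 + c are associates and (2 - c)(1 + c)^2 = 3, so (2 - c)^3 is 3 times a unit, with 3 <
  2^3.\<close>

lemma no_9:
  assumes z: "z ^ 6 + z ^ 3 + 1 = 0" "z + inverse z \<in> K"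
  shows False
proof -
  have z0: "z \<noteq> 0" using z(1) by auto
  have "z ^ 9 - 1 = (z ^ 3 - 1) * (z ^ 6 + z ^ 3 + 1)" by (simp add: algebra_simps flip: power_add)
  hence OK: "z + inverse z \<in> OK K" using cos_OK[of z 9] z by simp
  define c where "c = z + inverse z"
  have cO: "c \<in> OK K" using OK unfolding c_def .
  have "(c ^ 3 - 3 * c + 1) * z ^ 3 = z ^ 6 + z ^ 3 + 1"
    unfolding c_def using z0 by (simp add: field_simps power2_eq_square power3_eq_cube) (simp add: eval_nat_numeral)
  hence c3: "c ^ 3 - 3 * c + 1 = 0" using z z0 by simp
  have u1: "c \<in> units K"
  proof (rule unitI[OF cO])
    show "3 - c\<^sup>2 \<in> OK K" by (intro OK_diff OK_numeral OK_power cO)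
    have "c * (3 - c\<^sup>2) = 1 - (c ^ 3 - 3 * c + 1)" by (simp add: algebra_simps eval_nat_numeral)
    thus "c * (3 - c\<^sup>2) = 1" unfolding c3 by simp
  qed
  have u2: "c + 2 \<in> units K"
  proof (rule unitI)
    show "c + 2 \<in> OK K" by (intro OK_add OK_numeral cO)
    \<comment> \<open>\<open>c + 2\<close> is a root of X^3 - 6 X^2 + 9 X - 1, which displays its
      inverse.\<close>
    show "(c + 2)\<^sup>2 - 6 * (c + 2) + 9 \<in> OK K" by (intro OK_diff OK_mult OK_add OK_numeral OK_power cO)
    have "(c + 2) * ((c + 2)\<^sup>2 - 6 * (c + 2) + 9) = 1 + (c ^ 3 - 3 * c + 1)"
      by (simp add: algebra_simps eval_nat_numeral)
    thus "(c + 2) * ((c + 2)\<^sup>2 - 6 * (c + 2) + 9) = 1" unfolding c3 by simp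
  qed
  have "(2 - c) * (c * (c + 2)) = 1 + c - (c ^ 3 - 3 * c + 1)" by (simp add: algebra_simps eval_nat_numeral)
  hence e1: "(2 - c) * (c * (c + 2)) = 1 + c" unfolding c3 by simp
  have "(2 - c) * (1 + c)\<^sup>2 = 3 - (c ^ 3 - 3 * c + 1)" by (simp add: algebra_simps eval_nat_numeral)
  hence e2: "(2 - c) * (1 + c)\<^sup>2 = 3" unfolding c3 by simp
  have "(2 - c) ^ 3 * (c * (c + 2))\<^sup>2 = (2 - c) * ((2 - c) * (c * (c + 2)))\<^sup>2"
    by (simp add: power_mult_distrib eval_nat_numeral mult_ac)
  hence e: "(2 - c) ^ 3 * (c * (c + 2))\<^sup>2 = 3" unfolding e1 e2 .
  have nz: "c * (c + 2) \<noteq> 0" using units_nz u1 u2 by simp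
  have "(2 - c) ^ 3 = of_nat 3 ^ 1 * (inverse (c * (c + 2)))\<^sup>2" using e nz by (simp add: field_simps)
  moreover have "(inverse (c * (c + 2)))\<^sup>2 \<in> units K" by (intro units_power units_inverse units_mult u1 u2)
  moreover have "2 - c \<in> OK K" by (intro OK_diff OK_numeral cO)
  ultimately show False using no_small_over_odd[of "2 - c" _ 3 3 1] by auto
qed

text \<open>In the cyclotomic ring, p is (1 - z)^(p-1) times a unit. Since \<alpha> = -(1 - z)^2 /
  z, its power with exponent p - 1 is p^2 times a unit, and p^2 < 2^(p-1).\<close>

lemma no_prime:
  assumes p: "prime (p::nat)" "p \<ge> 7" and z: "z ^ p = 1" "z \<noteq> 1" "z + inverse z \<in> K"
  shows False
proof -
  have p0: "p > 0" using p by simp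
  have odd: "odd p" using p prime_odd_nat by auto
  have z0: "z \<noteq> 0" using z(1) p0 by (metis power_0_left less_numeral_extra(3) zero_neq_one)
  define \<alpha> where "\<alpha> = 2 - (z + inverse z)"
  have aO: "\<alpha> \<in> OK K" unfolding \<alpha>_def using cos_OK[OF z(1) p0 z(3)] by (intro OK_diff OK_numeral)
  define W where "W = {w::complex. w ^ p = 1} - {1}"
  have W: "finite W" "card W = p - 1" unfolding W_def using finite_roots_unity[of p] p0 card_roots_unity_eq[of p]
    by (auto simp: card_Diff_singleton)
  define U where "U = (\<Prod>w\<in>W. (1 - w) / (1 - z))"
  \<comment> \<open>Any two nontrivial p-th roots of unity are powers of each other, so these
    quotients are integral in both directions: they are cyclotomic units.\<close>
  have quot: "algebraic_int ((1 - w) / (1 - y))" if wy: "w \<in> W" "y \<in> W" for w y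
  proof -
    have y: "y ^ p = 1" "y \<noteq> 1" and w: "w ^ p = 1" using wy unfolding W_def by auto
    obtain j where j: "w = y ^ j" using prime_root_of_unity_power[OF p(1) y w] by auto
    have "(1 - w) / (1 - y) = (\<Sum>i<j. y ^ i)" unfolding j one_diff_power_eq using y(2) by simp
    thus ?thesis using algebraic_int_root_of_unity[OF y(1) p0] by auto
  qed
  have zW: "z \<in> W" unfolding W_def using z by simp
  have U1: "algebraic_int U" unfolding U_def using quot zW by auto
  have "inverse U = (\<Prod>w\<in>W. (1 - z) / (1 - w))" unfolding U_def by (simp add: prod_inversef[symmetric] o_def)
  hence U2: "algebraic_int (inverse U)" using quot zW by auto
  have z1: "1 - z \<noteq> 0" using z(2) by simp
  have "U = (\<Prod>w\<in>W. 1 - w) / (1 - z) ^ (p - 1)" unfolding U_def by (simp add: prod_dividef W(2))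
  also have "(\<Prod>w\<in>W. 1 - w) = of_nat p" unfolding W_def by (rule prod_one_minus_roots_of_unity[OF p0])
  finally have UE: "(1 - z) ^ (p - 1) * U = of_nat p" using z1 by (simp add: field_simps)
  have U0: "U \<noteq> 0" using UE p0 by auto
  have "\<alpha> = - ((1 - z)\<^sup>2 * inverse z)" unfolding \<alpha>_def using z0 by (simp add: field_simps power2_eq_square)
  hence "\<alpha> ^ (p - 1) = ((1 - z)\<^sup>2 * inverse z) ^ (p - 1)" using odd by (simp add: power_minus_even)
  also have "\<dots> = ((1 - z) ^ (p - 1))\<^sup>2 * inverse (z ^ (p - 1))"
    by (simp add: power_mult_distrib power_mult[symmetric] mult.commute power_inverse)
  also have "inverse (z ^ (p - 1)) = z"
  proof -
    have "z ^ (p - 1) * z = 1" using z(1) p0 by (metis power_minus_mult)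
    thus ?thesis by (rule inverse_unique)
  qed
  also have "(1 - z) ^ (p - 1) = of_nat p * inverse U" using UE U0 by (simp add: field_simps)
  also have "(of_nat p * inverse U)\<^sup>2 * z = of_nat p ^ 2 * ((inverse U)\<^sup>2 * z)" by (simp add: power_mult_distrib)
  finally have ae: "\<alpha> ^ (p - 1) = of_nat p ^ 2 * ((inverse U)\<^sup>2 * z)" .
  define V where "V = (inverse U)\<^sup>2 * z"
  \<comment> \<open>The factors of \<open>V\<close> come from the cyclotomic field, but
    \<open>V\<close> itself lies in \<open>K\<close> as a quotient of elements of
    \<open>K\<close>.\<close>
  have "V = \<alpha> ^ (p - 1) / of_nat p ^ 2" using ae p0 unfolding V_def by simp
  hence VK: "V \<in> K" using OK_K[OF aO]
    by (auto intro!: subfield_divide[OF subfield_K] subfield_power[OF subfield_K] subfield_of_nat[OF subfield_K])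
  have "algebraic_int V" unfolding V_def using U2 algebraic_int_root_of_unity[OF z(1) p0] by auto
  moreover have "inverse V = U\<^sup>2 * inverse z" unfolding V_def by (simp add: power_inverse)
  hence "algebraic_int (inverse V)"
    using U1 algebraic_int_root_of_unity[of "inverse z" p] z(1) p0 by (auto simp: power_inverse)
  moreover have "V \<noteq> 0" unfolding V_def using U0 z0 by simp
  ultimately have "V \<in> units K" unfolding units_def OK_def algebraic_integer_iff using VK subfield_inverse[OF subfield_K] by auto
  from no_small_over_odd[OF aO this odd _ _ ae[folded V_def]] show False
    using p prime_square_less[OF p(2)] by auto
qed

text \<open>\<open>q'\<close> will be \<open>q\<close> or its negative, since either factor of 3 =
  (t + q)(t - q) may be the small one. The case of \<delta> times a unit fails by parity, as the
  norm divides 3^d.\<close>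

lemma no_5_aux:
  assumes t: "t \<in> OK K" "t\<^sup>2 = 5" and q': "q' \<in> OK K" "q'\<^sup>2 = 2" and small: "\<bar>Nm (t + q')\<bar> < 2 ^ d"
  shows False
proof -
  have m3: "(t + q') * (t - q') = 3" using t(2) q'(2) by (simp add: power2_eq_square algebra_simps)
  have pO: "t + q' \<in> OK K" "t - q' \<in> OK K" by (intro OK_add OK_diff t q')+
  have p0: "t + q' \<noteq> 0" using m3 by auto
  have N3: "\<bar>Nm (t + q')\<bar> * \<bar>Nm (t - q')\<bar> = 3 ^ d"
    using Nm_mult[OF OK_K[OF pO(1)] OK_K[OF pO(2)]] Nm_of_int[of 3] m3 by (simp add: abs_mult[symmetric])
  obtain u where u: "u \<in> units K" "t + q' = u \<or> t + q' = (2 + q) * u" using small_norm[OF pO(1) p0 small] by auto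
  from u(2) show False
  proof
    assume "t + q' = u"
    hence iO: "inverse (t + q') \<in> OK K" using u(1) unfolding units_def by auto
    \<comment> \<open>The conjugates of \<open>y\<close> are among \<open>(- 2 \<plusminus> 2 * sqrt 10) / 9\<close>, all of absolute value below 1.\<close>
    define y where "y = (inverse (t + q'))\<^sup>2 - 1"
    have yO: "y \<in> OK K" unfolding y_def by (intro OK_diff OK_power iO OK_1)
    have iv: "inverse (t + q') = (t - q') / 3" using m3 p0 by (simp add: field_simps)
    hence y9: "9 * y = - 2 - 2 * (t * q')"
    proof -
      have "9 * y = (t - q')\<^sup>2 - 9" unfolding y_def iv by (simp add: power_divide)
      thus ?thesis unfolding power2_diff t(2) q'(2) by simp
    qed
    have tqK: "t * q' \<in> K" using OK_K t q' by (auto intro: subfield_mult[OF subfield_K])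
    have small_y: "\<bar>s r y\<bar> < 1" and y_nz: "s r y \<noteq> 0" if r: "r \<in> R" for r
    proof -
      define T where "T = s r (t * q')"
      have "(t * q')\<^sup>2 = 10" using t(2) q'(2) by (simp add: power_mult_distrib)
      hence T2: "T\<^sup>2 = 10" unfolding T_def using s_power[OF r tqK, of 2] s_numeral[OF r] by metis
      have "9 * s r y = s r (9 * y)" using r yO by (simp add: s_mult s_numeral subfield_numeral[OF subfield_K] OK_K)
      also have "\<dots> = - 2 - 2 * T" unfolding y9 T_def using r tqK subfield_numeral[OF subfield_K]
        by (simp add: s_diff s_minus s_mult s_numeral subfield_mult[OF subfield_K] subfield_minus[OF subfield_K])
      finally have e: "9 * s r y = - 2 - 2 * T" .
      have "\<bar>T\<bar>\<^sup>2 < (7/2)\<^sup>2" using T2 by (simp add: power2_eq_square)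
      hence "\<bar>T\<bar> < 7/2" by (rule power2_less_imp_less) simp
      thus "\<bar>s r y\<bar> < 1" using e by linarith
      show "s r y \<noteq> 0"
      proof
        assume "s r y = 0"
        hence "T = -1" using e by simp
        thus False using T2 by simp
      qed
    qed
    have "y \<noteq> 0" using y_nz[OF \<theta>R] s_0[OF \<theta>R] by auto
    hence "\<bar>Nm y\<bar> \<ge> 1" using Nm_ge_1 yO by blast
    moreover have "\<bar>Nm y\<bar> < 1"
    proof -
      have "\<bar>Nm y\<bar> = \<bar>s \<theta> y\<bar> * (\<Prod>r\<in>R - {\<theta>}. \<bar>s r y\<bar>)"
        unfolding Nm_def abs_prod by (rule prod.remove[OF finite_R \<theta>R])
      also have "\<dots> \<le> \<bar>s \<theta> y\<bar> * 1"
        by (intro mult_left_mono prod_le_1) (use small_y in \<open>auto intro: less_imp_le\<close>)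
      finally show ?thesis using small_y[OF \<theta>R] by simp
    qed
    ultimately show False by simp
  next
    assume "t + q' = (2 + q) * u"
    hence "\<bar>Nm (t + q')\<bar> = \<bar>Nm (2 + q)\<bar>" using Nm_mult[OF OK_K[OF delta_OK] units_K[OF u(1)]] Nm_units[OF u(1)] by (simp add: abs_mult)
    moreover obtain m where "Nm (t - q') = of_int m" using Nm_int[OF pO(2)] by auto
    ultimately show False using N3 Nm_delta_times_ne_odd[of 3 1 m d] by simp
  qed
qed

text \<open>The element used in \<open>no_prime\<close> is too large for p = 5. Instead t = 2 (z +
  1/z) + 1 is a square root of 5 and (t + q)(t - q) = 3; as 3 < 4, one factor has absolute norm
  below 2^d.\<close>

lemma no_5:
  assumes z: "z ^ 5 = 1" "z \<noteq> 1" "z + inverse z \<in> K"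
  shows False
proof -
  have z0: "z \<noteq> 0" using z(1) by auto
  have gO: "z + inverse z \<in> OK K" using cos_OK[of z 5] z by simp
  define t where "t = 2 * (z + inverse z) + 1"
  have tO: "t \<in> OK K" unfolding t_def by (rule OK_add[OF OK_mult[OF OK_numeral gO] OK_1])
  have "(z - 1) * (z ^ 4 + z ^ 3 + z\<^sup>2 + z + 1) = z ^ 5 - 1" by (simp add: algebra_simps eval_nat_numeral)
  hence s: "z ^ 4 + z ^ 3 + z\<^sup>2 + z + 1 = 0" using z by simp
  have "(t\<^sup>2 - 5) * z\<^sup>2 = 4 * (z ^ 4 + z ^ 3 + z\<^sup>2 + z + 1)"
    unfolding t_def using z0 by (simp add: field_simps eval_nat_numeral)
  hence t2: "t\<^sup>2 = 5" using s z0 by simp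
  have "(t + q) * (t + - q) = 3" using t2 q2 by (simp add: power2_eq_square algebra_simps)
  hence N3: "\<bar>Nm (t + q)\<bar> * \<bar>Nm (t + - q)\<bar> = 3 ^ d"
    using Nm_mult[OF OK_K[OF OK_add[OF tO q_OK]] OK_K[OF OK_add[OF tO OK_minus[OF q_OK]]]] Nm_of_int[of 3]
    by (simp add: abs_mult[symmetric])
  have "\<bar>Nm (t + q)\<bar> < 2 ^ d \<or> \<bar>Nm (t + - q)\<bar> < 2 ^ d"
  proof (rule ccontr)
    assume "\<not> ?thesis"
    hence "2 ^ d * 2 ^ d \<le> \<bar>Nm (t + q)\<bar> * \<bar>Nm (t + - q)\<bar>" by (intro mult_mono) auto
    hence "(4::real) ^ d \<le> 3 ^ d" unfolding N3 by (simp add: power_mult_distrib[symmetric])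
    moreover have "(3::real) ^ d < 4 ^ d" using d_pos by (intro power_strict_mono) auto
    ultimately show False by simp
  qed
  thus False using no_5_aux[OF tO t2 q_OK q2] no_5_aux[OF tO t2 OK_minus[OF q_OK]] q2 by auto
qed


end

section \<open>Reduction of every order to the excluded ones\<close>

definition zeta :: "nat \<Rightarrow> complex" where "zeta n = cis (2 * pi / n)"

lemma zeta_nz: "zeta n \<noteq> 0" unfolding zeta_def by simp

lemma zeta_power_self: "n > 0 \<Longrightarrow> zeta n ^ n = 1"
  unfolding zeta_def DeMoivre by simp

lemma zeta_power_mult: "m > 0 \<Longrightarrow> n > 0 \<Longrightarrow> zeta (n * m) ^ m = zeta n"
  unfolding zeta_def DeMoivre by (simp add: field_simps)

lemma zeta_power_ne_1: "0 < j \<Longrightarrow> j < n \<Longrightarrow> zeta n ^ j \<noteq> 1"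
proof
  assume j: "0 < j" "j < n" and e: "zeta n ^ j = 1"
  have inj: "inj_on (\<lambda>k. cis (2 * pi * real k / real n)) {..<n}"
    using bij_betw_roots_unity[of n] j unfolding bij_betw_def by auto
  have "zeta n ^ j = cis (2 * pi * real j / real n)" unfolding zeta_def DeMoivre by (simp add: mult_ac)
  hence "cis (2 * pi * real j / real n) = cis (2 * pi * real 0 / real n)" using e by simp
  hence "j = 0" by (rule inj_onD[OF inj]) (use j in auto)
  thus False using j by simp
qed

lemma F_zeta: "F k = gen_field (zeta k + inverse (zeta k))"
proof -
  have "exp (2 * complex_of_real pi * \<i> / of_nat k) = zeta k"
    unfolding zeta_def cis_conv_exp by (simp add: mult_ac)
  thus ?thesis unfolding F_def by simp
qed

lemma gen_field_self: "a \<in> gen_field a" unfolding gen_field_def by auto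

lemma gen_field_subset: "subfield L \<Longrightarrow> a \<in> L \<Longrightarrow> gen_field a \<subseteq> L" unfolding gen_field_def by auto

lemma subfield_gen_field: "subfield (gen_field a)"
  unfolding gen_field_def subfield_def by blast

lemma gen_field_Rats: "a \<in> \<rat> \<Longrightarrow> gen_field a = \<rat>"
  using gen_field_subset[OF subfield_rat] subfield_Rats[OF subfield_gen_field] by blast

lemma zeta_power_half: "n > 0 \<Longrightarrow> zeta (2 * n) ^ n = -1"
  unfolding zeta_def DeMoivre by simp

lemma zeta_small_fields:
  assumes "k \<in> {1, 2, 3, 4, 6}" shows "F k = \<rat>"
proof -
  have cs: "zeta k + inverse (zeta k) = of_real (2 * cos (2 * pi / k))"
    unfolding zeta_def by (simp add: complex_eq_iff)
  have "2 * cos (2 * pi / k) \<in> {2, -2, -1, 0, 1}"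
    using assms cos_120 cos_60 by auto
  hence "zeta k + inverse (zeta k) \<in> complex_of_real ` {2, -2, -1, 0, 1}" unfolding cs by (rule imageI)
  hence "zeta k + inverse (zeta k) \<in> \<rat>" by auto
  thus ?thesis unfolding F_zeta by (rule gen_field_Rats)
qed

lemma F_8: "F 8 = gen_field sqrt2"
proof -
  have "zeta 8 + inverse (zeta 8) = of_real (2 * cos (2 * pi / 8))"
    unfolding zeta_def by (simp add: complex_eq_iff)
  also have "cos (2 * pi / 8) = sqrt 2 / 2" using cos_45 by simp
  finally show ?thesis unfolding F_zeta by simp
qed

text \<open>Avoiding these divisors leaves k = 2^a 3^b with a <= 3 and b <= 1, where b = 1 forces a
  <= 1; that is the list of the hypothesis. On it \<open>F k\<close> is the rational field or, for
  8, the field of \<open>sqrt2\<close>.\<close>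

lemma divisor_cases:
  assumes k: "k > 0" "k \<notin> {1, 2, 3, 4, 6, 8::nat}"
  shows "16 dvd k \<or> 12 dvd k \<or> 9 dvd k \<or> 5 dvd k \<or> (\<exists>p. prime p \<and> p \<ge> 7 \<and> p dvd k)"
proof (rule ccontr)
  assume n: "\<not> ?thesis"
  obtain m where m: "k = 2 ^ multiplicity 2 k * m" "\<not> 2 dvd m"
    using multiplicity_decompose'[of k 2] k by auto
  have m0: "m \<noteq> 0" using m(2) by (metis dvd_0_right)
  obtain l where l: "m = 3 ^ multiplicity 3 m * l" "\<not> 3 dvd l"
    using multiplicity_decompose'[of m 3] m0 by auto
  have "l = 1"
  proof (rule ccontr)
    assume "l \<noteq> 1"
    then obtain p where p: "prime p" "p dvd l" using prime_factor_nat by blast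
    have pm: "p dvd m" using p(2) by (subst l(1)) simp
    have pk: "p dvd k" using pm by (subst m(1)) simp
    have "p \<noteq> 2" "p \<noteq> 3" using p(2) pm m(2) l(2) by auto
    moreover have "p \<noteq> 5" using n pk by auto
    moreover have "p < 7" using n pk p(1) by (meson not_less)
    moreover have "p \<noteq> 4" "p \<noteq> 6"
      using p(1) prime_nat_iff[of 4] prime_nat_iff[of 6] by (auto simp: dvd_def dest!: spec[of _ 2])
    moreover have "p \<ge> 2" using p(1) prime_ge_2_nat by blast
    ultimately show False by linarith
  qed
  define a b where "a = multiplicity 2 k" and "b = multiplicity 3 m"
  have kab: "k = 2 ^ a * 3 ^ b" using m(1) l(1) \<open>l = 1\<close> unfolding a_def b_def by simp
  have "\<not> 4 \<le> a"
  proof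
    assume "4 \<le> a"
    hence "(2::nat) ^ 4 dvd 2 ^ a" by (rule le_imp_power_dvd)
    thus False using n unfolding kab by (auto intro: dvd_mult2)
  qed
  moreover have "\<not> 2 \<le> b"
  proof
    assume "2 \<le> b"
    hence "(3::nat) ^ 2 dvd 3 ^ b" by (rule le_imp_power_dvd)
    thus False using n unfolding kab by (auto intro: dvd_mult)
  qed
  moreover have "\<not> (2 \<le> a \<and> 1 \<le> b)"
  proof
    assume "2 \<le> a \<and> 1 \<le> b"
    hence "(2::nat) ^ 2 * 3 ^ 1 dvd 2 ^ a * 3 ^ b" by (intro mult_dvd_mono le_imp_power_dvd) auto
    thus False using n unfolding kab by auto
  qed
  ultimately have "a \<in> {0,1,2,3} \<and> b \<in> {0,1} \<and> (a \<le> 1 \<or> b = 0)" by auto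
  thus False using k(2) unfolding kab by auto
qed

context core
begin

text \<open>\<open>power_sum_K\<close> passes from \<open>k\<close> to each of its divisors, so a
  single divisor from \<open>divisor_cases\<close> gives the contradiction.\<close>

lemma no_real_cyclotomic_subfield:
  assumes k: "k \<ge> 1" "F k \<subseteq> K" "F k \<noteq> \<rat>" "F k \<noteq> gen_field sqrt2"
  shows False
proof -
  have kz: "zeta k + inverse (zeta k) \<in> K" using k(2) gen_field_self unfolding F_zeta by blast
  have zK: "zeta n + inverse (zeta n) \<in> K" if "n dvd k" for n
  proof -
    obtain m where m: "k = n * m" using \<open>n dvd k\<close> by auto
    hence "zeta k ^ m = zeta n" using zeta_power_mult[of m n] k(1) by simp
    thus ?thesis using power_sum_K[OF zeta_nz kz, of m] by simp
  qed
  have "k \<notin> {1, 2, 3, 4, 6, 8}" using k(3,4) zeta_small_fields[of k] F_8 by auto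
  hence "16 dvd k \<or> 12 dvd k \<or> 9 dvd k \<or> 5 dvd k \<or> (\<exists>p. prime p \<and> p \<ge> 7 \<and> p dvd k)"
    using divisor_cases[of k] k(1) by simp
  thus False
  proof (elim disjE)
    assume "16 dvd k"
    thus False using no_16[of "zeta 16"] zK zeta_power_half[of 8] by simp
  next
    assume "12 dvd k"
    define z where "z = zeta 12"
    have "z ^ 6 = -1" unfolding z_def using zeta_power_half[of 6] by simp
    \<comment> \<open>The second factor is the 12th cyclotomic polynomial; its vanishing amounts to
      (z + 1/z)^2 = 3.\<close>
    moreover have "z ^ 6 + 1 = (z\<^sup>2 + 1) * (z ^ 4 - z\<^sup>2 + 1)" by (simp add: algebra_simps eval_nat_numeral)
    moreover have "z\<^sup>2 + 1 \<noteq> 0"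
    proof
      assume "z\<^sup>2 + 1 = 0"
      hence "z\<^sup>2 = -1" by (simp add: eq_neg_iff_add_eq_0)
      moreover have "z ^ 4 = (z\<^sup>2)\<^sup>2" by simp
      ultimately have "z ^ 4 = 1" by simp
      thus False using zeta_power_ne_1[of 4 12] unfolding z_def by simp
    qed
    ultimately have e: "z ^ 4 - z\<^sup>2 + 1 = 0" by simp
    have z0: "z \<noteq> 0" unfolding z_def by (rule zeta_nz)
    have "((z + inverse z)\<^sup>2 - 3) * z\<^sup>2 = z ^ 4 - z\<^sup>2 + 1"
      using z0 by (simp add: field_simps eval_nat_numeral)
    hence "(z + inverse z)\<^sup>2 = 3" using e z0 by simp
    thus False using no_sqrt3 zK[OF \<open>12 dvd k\<close>] unfolding z_def by blast
  next
    assume "9 dvd k"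
    define z where "z = zeta 9"
    have "(z ^ 3 - 1) * (z ^ 6 + z ^ 3 + 1) = z ^ 9 - 1" by (simp add: algebra_simps eval_nat_numeral)
    hence "z ^ 6 + z ^ 3 + 1 = 0" using zeta_power_self[of 9] zeta_power_ne_1[of 3 9] unfolding z_def by simp
    thus False using no_9 zK[OF \<open>9 dvd k\<close>] unfolding z_def by blast
  next
    assume "5 dvd k"
    thus False using no_5[of "zeta 5"] zK zeta_power_self[of 5] zeta_power_ne_1[of 1 5] by simp
  next
    assume "\<exists>p. prime p \<and> p \<ge> 7 \<and> p dvd k"
    then obtain p where p: "prime p" "p \<ge> 7" "p dvd k" by auto
    thus False using no_prime[OF p(1,2), of "zeta p"] zK zeta_power_self[of p] zeta_power_ne_1[of 1 p] by simp
  qed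
qed

end

section \<open>The ring of integers of the real quadratic base field\<close>

lemma sqrt2_sq: "sqrt2\<^sup>2 = 2" and sqrt2_mult: "sqrt2 * sqrt2 = 2" and sqrt2_mult': "sqrt2 * (sqrt2 * x) = 2 * x"
  by (simp_all flip: of_real_power of_real_mult mult.assoc)

lemma algebraic_int_sqrt2: "algebraic_int sqrt2"
  by (rule algebraic_int_of_power[of _ 2]) (simp_all add: sqrt2_sq)

lemma sqrt2_irrational: "sqrt2 \<notin> \<rat>"
proof
  assume "sqrt2 \<in> \<rat>"
  hence "sqrt2 \<in> \<int>" using rational_algebraic_int_is_int algebraic_int_sqrt2 by blast
  then obtain n where n: "sqrt2 = of_int n" by (auto elim: Ints_cases)
  have "(of_int (n * n) :: complex) = of_int 2" using sqrt2_mult unfolding n by simp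
  hence n2: "n * n = 2" by (simp only: of_int_eq_iff)
  have "\<not> \<bar>n\<bar> \<ge> 2"
  proof
    assume "\<bar>n\<bar> \<ge> 2"
    hence "2 * 2 \<le> \<bar>n\<bar> * \<bar>n\<bar>" by (intro mult_mono) auto
    thus False using n2 by (simp add: abs_mult[symmetric])
  qed
  hence "n \<in> {-1, 0, 1}" by auto
  thus False using n2 by auto
qed

lemma rat_sqrt2_eq:
  assumes "a \<in> \<rat>" "b \<in> \<rat>" "a' \<in> \<rat>" "b' \<in> \<rat>" "a + b * sqrt2 = a' + b' * sqrt2"
  shows "a = a' \<and> b = b'"
proof -
  have e: "(b - b') * sqrt2 = a' - a" using assms(5) by (simp add: algebra_simps)
  have "b = b'"
  proof (rule ccontr)
    assume "b \<noteq> b'"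
    hence "sqrt2 = (a' - a) / (b - b')" using e by (simp add: field_simps)
    thus False using sqrt2_irrational assms(1-4) by auto
  qed
  thus ?thesis using e by simp
qed

abbreviation F0 where "F0 \<equiv> gen_field sqrt2"

lemma sqrt2_field: "subfield {a + b * sqrt2 | a b. a \<in> \<rat> \<and> b \<in> \<rat>}" (is "subfield ?L")
  unfolding subfield_def
proof (intro conjI ballI impI)
  have mem: "a + b * sqrt2 \<in> ?L" if "a \<in> \<rat>" "b \<in> \<rat>" for a b using that by blast
  show "0 \<in> ?L" using mem[of 0 0] by simp
  show "1 \<in> ?L" using mem[of 1 0] by simp
  fix x assume "x \<in> ?L"
  then obtain a b where x: "a \<in> \<rat>" "b \<in> \<rat>" "x = a + b * sqrt2" by blast
  show "- x \<in> ?L" using mem[of "-a" "-b"] x by simp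
  show "inverse x \<in> ?L" if "x \<noteq> 0"
  proof -
    define n where "n = a * a - 2 * b * b"
    have p: "(a + b * sqrt2) * (a - b * sqrt2) = n" unfolding n_def by (simp add: algebra_simps sqrt2_mult sqrt2_mult')
    have "a - b * sqrt2 \<noteq> 0"
      using rat_sqrt2_eq[of a "-b" 0 0] x that by auto
    hence n0: "n \<noteq> 0" unfolding p[symmetric] using that x(3) by simp
    have "x * ((a - b * sqrt2) / n) = 1" unfolding x(3) using p n0 by simp
    hence "inverse x = (a - b * sqrt2) / n" by (rule inverse_unique)
    hence "inverse x = a / n + (- b / n) * sqrt2" by (simp add: diff_divide_distrib)
    moreover have "n \<in> \<rat>" unfolding n_def using x by auto
    ultimately show ?thesis using mem[of "a / n" "- b / n"] x by simp
  qed
  fix y assume "y \<in> ?L"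
  then obtain c d where y: "c \<in> \<rat>" "d \<in> \<rat>" "y = c + d * sqrt2" by blast
  have e: "x + y = (a + c) + (b + d) * sqrt2" unfolding x y by (simp add: algebra_simps)
  show "x + y \<in> ?L" unfolding e by (rule mem) (use x y in auto)
  have e: "x * y = (a * c + 2 * b * d) + (a * d + b * c) * sqrt2"
    unfolding x y by (simp add: algebra_simps sqrt2_mult sqrt2_mult')
  show "x * y \<in> ?L" unfolding e by (rule mem) (use x y in auto)
qed

lemma F0_iff: "x \<in> F0 \<longleftrightarrow> (\<exists>a b. a \<in> \<rat> \<and> b \<in> \<rat> \<and> x = a + b * sqrt2)"
proof
  assume "x \<in> F0"
  moreover have "sqrt2 \<in> {a + b * sqrt2 | a b. a \<in> \<rat> \<and> b \<in> \<rat>}"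
    by (rule CollectI, rule exI[of _ 0], rule exI[of _ 1]) simp
  ultimately show "\<exists>a b. a \<in> \<rat> \<and> b \<in> \<rat> \<and> x = a + b * sqrt2"
    using gen_field_subset[OF sqrt2_field] by blast
next
  assume "\<exists>a b. a \<in> \<rat> \<and> b \<in> \<rat> \<and> x = a + b * sqrt2"
  thus "x \<in> F0" using subfield_Rats[OF subfield_gen_field] gen_field_self subfield_gen_field
    by (auto intro!: subfield_add subfield_mult)
qed

text \<open>Galois conjugation on \<open>F0\<close>, well defined there by
  \<open>rat_sqrt2_eq\<close>.\<close>

definition cj :: "complex \<Rightarrow> complex" where
  "cj x = (THE y. \<exists>a b. a \<in> \<rat> \<and> b \<in> \<rat> \<and> x = a + b * sqrt2 \<and> y = a - b * sqrt2)"

lemma cj: "a \<in> \<rat> \<Longrightarrow> b \<in> \<rat> \<Longrightarrow> cj (a + b * sqrt2) = a - b * sqrt2"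
  unfolding cj_def
proof (rule the_equality)
  assume ab: "a \<in> \<rat>" "b \<in> \<rat>"
  thus "\<exists>a' b'. a' \<in> \<rat> \<and> b' \<in> \<rat> \<and> a + b * sqrt2 = a' + b' * sqrt2 \<and> a - b * sqrt2 = a' - b' * sqrt2"
    by (intro exI[of _ a] exI[of _ b]) simp
  fix y assume "\<exists>a' b'. a' \<in> \<rat> \<and> b' \<in> \<rat> \<and> a + b * sqrt2 = a' + b' * sqrt2 \<and> y = a' - b' * sqrt2"
  then obtain a' b' where y: "a' \<in> \<rat>" "b' \<in> \<rat>" "a + b * sqrt2 = a' + b' * sqrt2" "y = a' - b' * sqrt2" by (elim exE conjE)
  show "y = a - b * sqrt2" using rat_sqrt2_eq[OF ab y(1-3)] y(4) by simp
qed

lemma embedding_cj: "embedding F0 cj"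
  unfolding embedding_def
proof (intro conjI ballI)
  show "cj 1 = 1" using cj[of 1 0] by simp
  fix x y assume "x \<in> F0" "y \<in> F0"
  then obtain a b c d where x: "a \<in> \<rat>" "b \<in> \<rat>" "x = a + b * sqrt2" and y: "c \<in> \<rat>" "d \<in> \<rat>" "y = c + d * sqrt2"
    unfolding F0_iff by blast
  have c: "cj x = a - b * sqrt2" "cj y = c - d * sqrt2" unfolding x(3) y(3) by (intro cj x y)+
  have e: "x + y = (a + c) + (b + d) * sqrt2" unfolding x y by (simp add: algebra_simps)
  have "cj (x + y) = (a + c) - (b + d) * sqrt2" unfolding e by (rule cj) (use x y in auto)
  thus "cj (x + y) = cj x + cj y" unfolding c by (simp add: algebra_simps)
  have e: "x * y = (a * c + 2 * b * d) + (a * d + b * c) * sqrt2"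
    unfolding x y by (simp add: algebra_simps sqrt2_mult sqrt2_mult')
  have "cj (x * y) = (a * c + 2 * b * d) - (a * d + b * c) * sqrt2"
    unfolding e by (rule cj) (use x y in auto)
  thus "cj (x * y) = cj x * cj y" unfolding c
    by (simp add: algebra_simps sqrt2_mult sqrt2_mult')
qed

lemma embedding_id: "embedding L (\<lambda>x. x)" unfolding embedding_def by simp

text \<open>Coordinates in Z[sqrt 2]; by \<open>e2_eq_iff\<close> an equation in this ring becomes a
  pair of integer equations.\<close>

definition e2 :: "int \<Rightarrow> int \<Rightarrow> complex" where "e2 a b = of_int a + of_int b * sqrt2"

lemma e2_eq_iff: "e2 a b = e2 c d \<longleftrightarrow> a = c \<and> b = d"
  unfolding e2_def using rat_sqrt2_eq[of "of_int a" "of_int b" "of_int c" "of_int d"] by auto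

lemma e2_add: "e2 a b + e2 c d = e2 (a + c) (b + d)"
  and e2_diff: "e2 a b - e2 c d = e2 (a - c) (b - d)"
  and e2_minus: "- e2 a b = e2 (- a) (- b)"
  and e2_mult: "e2 a b * e2 c d = e2 (a * c + 2 * b * d) (a * d + b * c)"
  unfolding e2_def by (simp_all add: algebra_simps sqrt2_mult sqrt2_mult')

lemma e2_square: "(e2 a b)\<^sup>2 = e2 (a * a + 2 * b * b) (2 * a * b)"
  unfolding power2_eq_square e2_mult by (simp add: mult_ac)

lemma e2_0: "e2 0 0 = 0" and e2_num: "e2 (numeral n) 0 = numeral n"
  unfolding e2_def by simp_all

lemma e2_F0: "e2 a b \<in> F0" unfolding F0_iff e2_def by (intro exI[of _ "of_int a"] exI[of _ "of_int b"]) auto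

lemma cj_e2: "cj (e2 a b) = e2 a (- b)" unfolding e2_def using cj[of "of_int a" "of_int b"] by simp

lemma algebraic_int_e2: "algebraic_int (e2 a b)"
  unfolding e2_def using algebraic_int_sqrt2 by auto

text \<open>For x = a + b sqrt 2, the trace makes 2 a integral and (x - cj x) sqrt 2 makes 4 b
  integral. Calling these n and k, integrality of the norm reads 2 n^2 - k^2 = 8 l, and three parity
  steps make a and b integral.\<close>

lemma OK_F0: "x \<in> OK F0 \<longleftrightarrow> (\<exists>a b. x = e2 a b)"
proof
  assume x: "x \<in> OK F0"
  hence xF: "x \<in> F0" and xi: "algebraic_int x" unfolding OK_def algebraic_integer_iff by auto
  obtain a b where ab: "a \<in> \<rat>" "b \<in> \<rat>" "x = a + b * sqrt2" using xF unfolding F0_iff by blast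
  have cx: "cj x = a - b * sqrt2" unfolding ab(3) by (rule cj[OF ab(1,2)])
  have ci: "algebraic_int (cj x)"
    by (rule emb_algebraic_int[OF subfield_gen_field embedding_cj xF xi])
  have "x + cj x = 2 * a" using cx ab(3) by simp
  hence "algebraic_int (2 * a)" using xi ci by (metis algebraic_int_add)
  hence "2 * a \<in> \<int>" using ab(1) by (intro rational_algebraic_int_is_int) auto
  then obtain n where n: "2 * a = of_int n" by (auto elim: Ints_cases)
  have "x - cj x = 2 * b * sqrt2" using cx ab(3) by simp
  hence "(x - cj x) * sqrt2 = 4 * b" by (simp add: mult.assoc sqrt2_mult)
  hence "algebraic_int (4 * b)" using xi ci algebraic_int_sqrt2 by (metis algebraic_int_diff algebraic_int_mult)
  hence "4 * b \<in> \<int>" using ab(2) by (intro rational_algebraic_int_is_int) auto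
  then obtain k where k: "4 * b = of_int k" by (auto elim: Ints_cases)
  have "x * cj x = (a + b * sqrt2) * (a - b * sqrt2)" using cx ab(3) by simp
  also have "\<dots> = a * a - 2 * b * b" by (simp add: algebra_simps sqrt2_mult sqrt2_mult')
  finally have "x * cj x = a * a - 2 * b * b" .
  hence "algebraic_int (a * a - 2 * b * b)" using xi ci by (metis algebraic_int_mult)
  hence "a * a - 2 * b * b \<in> \<int>" using ab by (intro rational_algebraic_int_is_int) auto
  then obtain l where l: "a * a - 2 * b * b = of_int l" by (auto elim: Ints_cases)
  have "of_int (2 * (n * n) - k * k) = (of_int (8 * l) :: complex)"
  proof -
    have "of_int (2 * (n * n) - k * k) = 2 * ((2 * a) * (2 * a)) - (4 * b) * (4 * b)" unfolding n k by simp
    also have "\<dots> = 8 * (a * a - 2 * b * b)" by (simp add: algebra_simps)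
    finally show ?thesis unfolding l by simp
  qed
  hence e: "2 * (n * n) - k * k = 8 * l" by (simp only: of_int_eq_iff)
  have "k * k = 2 * (n * n - 4 * l)" using e by simp
  hence "even (k * k)" by (rule dvdI)
  then obtain j where j: "k = 2 * j" by (auto elim: evenE)
  have e2: "n * n - 2 * (j * j) = 4 * l" using e unfolding j by simp
  have "n * n = 2 * (j * j + 2 * l)" using e2 by simp
  hence "even (n * n)" by (rule dvdI)
  then obtain i where i: "n = 2 * i" by (auto elim: evenE)
  have "j * j = 2 * (i * i - l)" using e2 unfolding i by simp
  hence "even (j * j)" by (rule dvdI)
  then obtain h where h: "j = 2 * h" by (auto elim: evenE)
  have "a = of_int i" "b = of_int h" using n k unfolding i j h by simp_all
  thus "\<exists>a b. x = e2 a b" unfolding ab(3) e2_def by blast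
next
  assume "\<exists>a b. x = e2 a b"
  thus "x \<in> OK F0" unfolding OK_def algebraic_integer_iff using algebraic_int_e2 e2_F0 by auto
qed

lemma e2_real: "e2 a b = complex_of_real (a + b * sqrt 2)"
  unfolding e2_def by simp

lemma totally_positive_e2:
  "totally_positive F0 (e2 a b) \<longleftrightarrow> 0 < a + b * sqrt 2 \<and> 0 < a - b * sqrt 2"
proof
  assume t: "totally_positive F0 (e2 a b)"
  have "Re (e2 a b) > 0" using t embedding_id[of F0] unfolding totally_positive_def by auto
  moreover have "Re (cj (e2 a b)) > 0" using t embedding_cj unfolding totally_positive_def by auto
  ultimately show "0 < a + b * sqrt 2 \<and> 0 < a - b * sqrt 2" unfolding cj_e2 by (simp add: e2_real)
next
  assume p: "0 < a + b * sqrt 2 \<and> 0 < a - b * sqrt 2"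
  show "totally_positive F0 (e2 a b)" unfolding totally_positive_def
  proof (intro conjI allI impI e2_F0)
    fix \<tau> assume \<tau>: "embedding F0 \<tau>"
    note subfield_K = subfield_gen_field[of sqrt2]
    have "(\<tau> sqrt2)\<^sup>2 = \<tau> (sqrt2 ^ 2)" using emb_power[OF subfield_K \<tau> gen_field_self] by simp
    also have "\<dots> = sqrt2\<^sup>2" unfolding sqrt2_sq using emb_of_nat[OF subfield_K \<tau>, of 2] by simp
    finally have "\<tau> sqrt2 = sqrt2 \<or> \<tau> sqrt2 = - sqrt2" by (simp add: power2_eq_iff)
    moreover have "\<tau> (e2 a b) = of_int a + of_int b * \<tau> sqrt2" unfolding e2_def
      using emb_add[OF subfield_K \<tau>] emb_mult[OF subfield_K \<tau>] emb_of_int[OF subfield_K \<tau>]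
      by (simp add: subfield_of_int[OF subfield_K] subfield_mult[OF subfield_K] gen_field_self)
    ultimately have "\<tau> (e2 a b) = e2 a b \<or> \<tau> (e2 a b) = e2 a (- b)" unfolding e2_def by auto
    thus "\<tau> (e2 a b) \<in> \<real>" "Re (\<tau> (e2 a b)) > 0" using p by (auto simp: e2_real)
  qed
qed

lemma OK_plus_e2: "e2 a b \<in> OK_plus F0 \<longleftrightarrow> 0 < a + b * sqrt 2 \<and> 0 < a - b * sqrt 2"
  unfolding OK_plus_def using totally_positive_e2 OK_F0 by auto

lemma sqrt2_bounds: "1.414 < sqrt 2" "sqrt 2 < 1.415"
proof -
  show "1.414 < sqrt 2" by (rule real_less_rsqrt) (simp add: power2_eq_square)
  show "sqrt 2 < 1.415" by (rule real_less_lsqrt) (simp_all add: power2_eq_square)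
qed

definition nonneg2 :: "complex \<Rightarrow> bool" where
  "nonneg2 x \<longleftrightarrow> (\<exists>a b. x = e2 a b \<and> 0 \<le> a + b * sqrt 2 \<and> 0 \<le> a - b * sqrt 2)"

lemma nonneg2_e2: "nonneg2 (e2 a b) \<longleftrightarrow> 0 \<le> a + b * sqrt 2 \<and> 0 \<le> a - b * sqrt 2"
  unfolding nonneg2_def by (auto simp: e2_eq_iff)

text \<open>Adding the bounds at the two embeddings cancels sqrt 2 and leaves an integer inequality
  with finitely many solutions; the separate bounds then discard the spurious ones.\<close>

lemma nonneg2_square_bound:
  assumes "nonneg2 (e2 c d - (e2 a b)\<^sup>2)"
  shows "real_of_int a * of_int a + 2 * (of_int b * of_int b) + 2 * (of_int a * of_int b) * sqrt 2 \<le> of_int c + of_int d * sqrt 2"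
    "real_of_int a * of_int a + 2 * (of_int b * of_int b) - 2 * (of_int a * of_int b) * sqrt 2 \<le> of_int c - of_int d * sqrt 2" "a * a + 2 * (b * b) \<le> c"
proof -
  have n: "0 \<le> real_of_int (c - (a * a + 2 * b * b)) + real_of_int (d - 2 * a * b) * sqrt 2"
    "0 \<le> real_of_int (c - (a * a + 2 * b * b)) - real_of_int (d - 2 * a * b) * sqrt 2"
    using assms unfolding e2_square e2_diff nonneg2_e2 by auto
  show 1: "real_of_int a * of_int a + 2 * (of_int b * of_int b) + 2 * (of_int a * of_int b) * sqrt 2 \<le> of_int c + of_int d * sqrt 2"
    using n(1) by (simp add: algebra_simps)
  show 2: "real_of_int a * of_int a + 2 * (of_int b * of_int b) - 2 * (of_int a * of_int b) * sqrt 2 \<le> of_int c - of_int d * sqrt 2"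
    using n(2) by (simp add: algebra_simps)
  have "real_of_int (a * a + 2 * (b * b)) \<le> real_of_int c" using 1 2 by simp
  thus "a * a + 2 * (b * b) \<le> c" by (simp only: of_int_le_iff)
qed

text \<open>The bound 6 is the rational part of 3 \<delta> = 6 + 3 sqrt 2, the largest of the values
  compared with squares.\<close>

lemma small_int_cases:
  assumes "a * a + 2 * (b * b) \<le> (6::int)"
  shows "a \<in> {-2, -1, 0, 1, 2}" "b \<in> {-1, 0, 1}"
proof -
  have "\<bar>a\<bar> \<le> 2"
  proof (rule ccontr)
    assume "\<not> \<bar>a\<bar> \<le> 2"
    hence "3 * 3 \<le> \<bar>a\<bar> * \<bar>a\<bar>" by (intro mult_mono) auto
    moreover have "0 \<le> b * b" by simp
    ultimately show False using assms by (simp add: abs_mult[symmetric])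
  qed
  thus "a \<in> {-2, -1, 0, 1, 2}" by auto
  have "\<bar>b\<bar> \<le> 1"
  proof (rule ccontr)
    assume "\<not> \<bar>b\<bar> \<le> 1"
    hence "2 * 2 \<le> \<bar>b\<bar> * \<bar>b\<bar>" by (intro mult_mono) auto
    moreover have "0 \<le> a * a" by simp
    ultimately show False using assms by (simp add: abs_mult[symmetric])
  qed
  thus "b \<in> {-1, 0, 1}" by auto
qed

lemma square_below_delta: "nonneg2 (e2 2 1 - (e2 a b)\<^sup>2) \<Longrightarrow> a = 0 \<and> b = 0"
proof -
  assume "nonneg2 (e2 2 1 - (e2 a b)\<^sup>2)"
  note n = nonneg2_square_bound[OF this]
  have "a * a + 2 * (b * b) \<le> 6" using n(3) by simp
  from small_int_cases[OF this] have "a \<in> {-2, -1, 0, 1, 2}" "b \<in> {-1, 0, 1}" .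
  thus ?thesis using n sqrt2_bounds by (elim insertE emptyE) simp_all
qed

lemma square_below_3: "nonneg2 (e2 3 0 - (e2 a b)\<^sup>2) \<Longrightarrow> (a, b) \<in> {(0,0), (1,0), (-1,0), (0,1), (0,-1)}"
proof -
  assume "nonneg2 (e2 3 0 - (e2 a b)\<^sup>2)"
  note n = nonneg2_square_bound[OF this]
  have "a * a + 2 * (b * b) \<le> 6" using n(3) by simp
  from small_int_cases[OF this] have "a \<in> {-2, -1, 0, 1, 2}" "b \<in> {-1, 0, 1}" .
  thus ?thesis using n sqrt2_bounds by (elim insertE emptyE) simp_all
qed

lemma square_below_2delta: "nonneg2 (e2 4 2 - (e2 a b)\<^sup>2) \<Longrightarrow> (a, b) \<in> {(0,0), (1,0), (-1,0), (1,1), (-1,-1)}"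
proof -
  assume "nonneg2 (e2 4 2 - (e2 a b)\<^sup>2)"
  note n = nonneg2_square_bound[OF this]
  have "a * a + 2 * (b * b) \<le> 6" using n(3) by simp
  from small_int_cases[OF this] have "a \<in> {-2, -1, 0, 1, 2}" "b \<in> {-1, 0, 1}" .
  thus ?thesis using n sqrt2_bounds by (elim insertE emptyE) simp_all
qed

lemma square_below_3delta: "nonneg2 (e2 6 3 - (e2 a b)\<^sup>2) \<Longrightarrow> (a, b) \<in> {(0,0), (1,0), (-1,0), (1,1), (-1,-1)}"
proof -
  assume "nonneg2 (e2 6 3 - (e2 a b)\<^sup>2)"
  note n = nonneg2_square_bound[OF this]
  have "a * a + 2 * (b * b) \<le> 6" using n(3) by simp
  from small_int_cases[OF this] have "a \<in> {-2, -1, 0, 1, 2}" "b \<in> {-1, 0, 1}" .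
  thus ?thesis using n sqrt2_bounds by (elim insertE emptyE) simp_all
qed

text \<open>Satisfied by squarefree elements, the only ones it is applied to.\<close>

definition sqf :: "complex \<Rightarrow> bool" where
  "sqf D \<longleftrightarrow> (\<forall>X\<in>OK F0. \<forall>T\<in>OK F0. X\<^sup>2 = D * T \<longrightarrow> (\<exists>Y\<in>OK F0. X = D * Y))"

lemma sqfI:
  assumes "\<And>x1 x2 t1 t2. x1 * x1 + 2 * x2 * x2 = d1 * t1 + 2 * d2 * t2 \<Longrightarrow> 2 * x1 * x2 = d1 * t2 + d2 * t1 \<Longrightarrow>
      \<exists>y1 y2. x1 = d1 * y1 + 2 * d2 * y2 \<and> x2 = d1 * y2 + d2 * y1"
  shows "sqf (e2 d1 d2)"
  unfolding sqf_def
proof (intro ballI impI)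
  fix X T assume "X \<in> OK F0" "T \<in> OK F0" and e: "X\<^sup>2 = e2 d1 d2 * T"
  then obtain x1 x2 t1 t2 where x: "X = e2 x1 x2" "T = e2 t1 t2" unfolding OK_F0 by auto
  from e have "x1 * x1 + 2 * x2 * x2 = d1 * t1 + 2 * d2 * t2" "2 * x1 * x2 = d1 * t2 + d2 * t1"
    unfolding x e2_square e2_mult e2_eq_iff by auto
  from assms[OF this] obtain y1 y2 where "x1 = d1 * y1 + 2 * d2 * y2" "x2 = d1 * y2 + d2 * y1" by auto
  hence "X = e2 d1 d2 * e2 y1 y2" unfolding x e2_mult by simp
  moreover have "e2 y1 y2 \<in> OK F0" unfolding OK_F0 by (intro exI) (rule refl)
  ultimately show "\<exists>Y\<in>OK F0. X = e2 d1 d2 * Y" by (rule bexI)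
qed

lemma sqf_delta: "sqf (e2 2 1)"
proof (rule sqfI)
  fix x1 x2 t1 t2 :: int
  assume e: "x1 * x1 + 2 * x2 * x2 = 2 * t1 + 2 * 1 * t2"
  have "x1 * x1 = 2 * (t1 + t2 - x2 * x2)" using e by simp
  hence "even (x1 * x1)" by (rule dvdI)
  then obtain h where h: "x1 = 2 * h" by (auto elim: evenE)
  \<comment> \<open>The witnesses are the coordinates of (x1 + x2 sqrt 2) / (2 + sqrt 2).\<close>
  show "\<exists>y1 y2. x1 = 2 * y1 + 2 * 1 * y2 \<and> x2 = 2 * y2 + 1 * y1"
    by (rule exI[of _ "2 * h - x2"], rule exI[of _ "x2 - h"]) (simp add: h)
qed

lemma sqf_1: "sqf (e2 1 0)"
  by (rule sqfI) (auto intro: exI)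

text \<open>This is a unit, with inverse 3 - 2 sqrt 2.\<close>

lemma sqf_eps: "sqf (e2 3 2)"
proof (rule sqfI)
  fix x1 x2 :: int
  show "\<exists>y1 y2. x1 = 3 * y1 + 2 * 2 * y2 \<and> x2 = 3 * y2 + 2 * y1"
    by (rule exI[of _ "3 * x1 - 4 * x2"], rule exI[of _ "3 * x2 - 2 * x1"]) simp
qed

lemma prime_7_dvd_square: "7 dvd (x * x :: int) \<Longrightarrow> 7 dvd x"
proof -
  have "prime (7::int)" by simp
  thus "7 dvd (x * x :: int) \<Longrightarrow> 7 dvd x" using prime_dvd_mult_iff by blast
qed

text \<open>5 + 3 sqrt 2 has norm 7, and divisibility by it means vanishing modulo 7 after sending
  sqrt 2 to 3. It is the discriminant for n = 3 and m = 1 up to sign.\<close>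

lemma sqf_5_3: "sqf (e2 5 3)"
proof (rule sqfI)
  fix x1 x2 t1 t2 :: int
  assume e: "x1 * x1 + 2 * x2 * x2 = 5 * t1 + 2 * 3 * t2" "2 * x1 * x2 = 5 * t2 + 3 * t1"
  have "(x1 + 3 * x2) * (x1 + 3 * x2) = (x1 * x1 + 2 * x2 * x2) + 3 * (2 * x1 * x2) + 7 * (x2 * x2)"
    by (simp add: algebra_simps)
  also have "\<dots> = 7 * (2 * t1 + 3 * t2 + x2 * x2)" unfolding e by simp
  finally have "7 dvd (x1 + 3 * x2) * (x1 + 3 * x2)" by (rule dvdI)
  hence "7 dvd x1 + 3 * x2" by (rule prime_7_dvd_square)
  then obtain h where h: "x1 = 7 * h - 3 * x2" by (metis add_diff_cancel_right' dvd_def)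
  show "\<exists>y1 y2. x1 = 5 * y1 + 2 * 3 * y2 \<and> x2 = 5 * y2 + 3 * y1"
    by (rule exI[of _ "5 * h - 3 * x2"], rule exI[of _ "2 * x2 - 3 * h"]) (simp add: h)
qed

text \<open>Again norm 7, now with sqrt 2 sent to 4. This is the discriminant for n = 3 and m = 1 +
  sqrt 2 up to sign.\<close>

lemma sqf_3_1: "sqf (e2 3 1)"
proof (rule sqfI)
  fix x1 x2 t1 t2 :: int
  assume e: "x1 * x1 + 2 * x2 * x2 = 3 * t1 + 2 * 1 * t2" "2 * x1 * x2 = 3 * t2 + 1 * t1"
  have "(x1 + 4 * x2) * (x1 + 4 * x2) = (x1 * x1 + 2 * x2 * x2) + 4 * (2 * x1 * x2) + 14 * (x2 * x2)"
    by (simp add: algebra_simps)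
  also have "\<dots> = 7 * (t1 + 2 * t2 + 2 * (x2 * x2))" unfolding e by simp
  finally have "7 dvd (x1 + 4 * x2) * (x1 + 4 * x2)" by (rule dvdI)
  hence "7 dvd x1 + 4 * x2" by (rule prime_7_dvd_square)
  then obtain h where h: "x1 = 7 * h - 4 * x2" by (metis add_diff_cancel_right' dvd_def)
  show "\<exists>y1 y2. x1 = 3 * y1 + 2 * 1 * y2 \<and> x2 = 3 * y2 + 1 * y1"
    by (rule exI[of _ "3 * h - 2 * x2"], rule exI[of _ "x2 - h"]) (simp add: h)
qed

lemma OK_F0_add: "x \<in> OK F0 \<Longrightarrow> y \<in> OK F0 \<Longrightarrow> x + y \<in> OK F0"
  and OK_F0_diff: "x \<in> OK F0 \<Longrightarrow> y \<in> OK F0 \<Longrightarrow> x - y \<in> OK F0"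
  and OK_F0_mult: "x \<in> OK F0 \<Longrightarrow> y \<in> OK F0 \<Longrightarrow> x * y \<in> OK F0"
  and OK_F0_power: "x \<in> OK F0 \<Longrightarrow> x ^ n \<in> OK F0"
  and OK_F0_e2: "e2 a b \<in> OK F0"
  unfolding OK_def using algebraic_int_e2 e2_F0 subfield_gen_field
  by (auto simp: algebraic_integer_iff intro: subfield_add subfield_mult subfield_diff subfield_power)

section \<open>Ternary forms over the base field\<close>

type_synonym vec3 = "complex \<times> complex \<times> complex"

fun vadd :: "vec3 \<Rightarrow> vec3 \<Rightarrow> vec3" where "vadd (x, y, z) (x', y', z') = (x + x', y + y', z + z')"
fun vsc :: "complex \<Rightarrow> vec3 \<Rightarrow> vec3" where "vsc k (x, y, z) = (k * x, k * y, k * z)"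
fun dot :: "vec3 \<Rightarrow> vec3 \<Rightarrow> complex" where "dot (x, y, z) (x', y', z') = x * x' + y * y' + z * z'"
fun det3 :: "vec3 \<Rightarrow> vec3 \<Rightarrow> vec3 \<Rightarrow> complex" where
  "det3 (x, y, z) (x', y', z') (x'', y'', z'') =
     x * (y' * z'' - z' * y'') - y * (x' * z'' - z' * x'') + z * (x' * y'' - y' * x'')"

definition comb :: "complex \<Rightarrow> vec3 \<Rightarrow> complex \<Rightarrow> vec3 \<Rightarrow> complex \<Rightarrow> vec3 \<Rightarrow> vec3" where
  "comb k p l q m r = vadd (vsc k p) (vadd (vsc l q) (vsc m r))"

lemma cramer:
  assumes "det3 p q r \<noteq> 0"
  shows "\<exists>k l m. w = comb k p l q m r"
proof -
  obtain p1 p2 p3 where p: "p = (p1, p2, p3)" by (cases p)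
  obtain q1 q2 q3 where q: "q = (q1, q2, q3)" by (cases q)
  obtain r1 r2 r3 where r: "r = (r1, r2, r3)" by (cases r)
  obtain w1 w2 w3 where w: "w = (w1, w2, w3)" by (cases w)
  define D where "D = det3 p q r"
  have D: "D \<noteq> 0" using assms unfolding D_def .
  have "D * w1 = det3 w q r * p1 + det3 p w r * q1 + det3 p q w * r1"
    "D * w2 = det3 w q r * p2 + det3 p w r * q2 + det3 p q w * r2"
    "D * w3 = det3 w q r * p3 + det3 p w r * q3 + det3 p q w * r3"
    unfolding D_def p q r w by (simp_all add: algebra_simps)
  hence "w1 = det3 w q r / D * p1 + det3 p w r / D * q1 + det3 p q w / D * r1"
    "w2 = det3 w q r / D * p2 + det3 p w r / D * q2 + det3 p q w / D * r2"
    "w3 = det3 w q r / D * p3 + det3 p w r / D * q3 + det3 p q w / D * r3"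
    using D by (simp_all add: field_simps)
  hence "w = comb (det3 w q r / D) p (det3 p w r / D) q (det3 p q w / D) r"
    unfolding comb_def p q r w by (simp add: add.assoc)
  thus ?thesis by blast
qed

text \<open>Multiplicativity of the determinant; with the second triple transformed by
  \<open>Gv\<close>, the right-hand side is a Gram determinant.\<close>

lemma det3_dot:
  "det3 p q r * det3 p' q' r' =
     dot p p' * (dot q q' * dot r r' - dot q r' * dot r q')
   - dot p q' * (dot q p' * dot r r' - dot q r' * dot r p')
   + dot p r' * (dot q p' * dot r q' - dot q q' * dot r p')"
proof -
  obtain p1 p2 p3 q1 q2 q3 r1 r2 r3 where 1: "p = (p1, p2, p3)" "q = (q1, q2, q3)" "r = (r1, r2, r3)"
    by (cases p; cases q; cases r)
  obtain s1 s2 s3 t1 t2 t3 u1 u2 u3 where 2: "p' = (s1, s2, s3)" "q' = (t1, t2, t3)" "r' = (u1, u2, u3)"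
    by (cases p'; cases q'; cases r')
  show ?thesis unfolding 1 2 by (simp add: algebra_simps)
qed

text \<open>-1 is not a square modulo 3.\<close>

lemma three_dvd_sum_squares: "3 dvd x * x + y * y \<Longrightarrow> 3 dvd x \<and> 3 dvd (y::int)"
proof -
  assume "3 dvd x * x + y * y"
  hence "(x * x + y * y) mod 3 = 0" by (rule dvd_imp_mod_0)
  moreover have "((x mod 3) * (x mod 3) + (y mod 3) * (y mod 3)) mod 3 = (x * x + y * y) mod 3"
    by (intro mod_add_cong mod_mult_cong) simp_all
  ultimately have 0: "((x mod 3) * (x mod 3) + (y mod 3) * (y mod 3)) mod 3 = 0" by (simp only:)
  have "x mod 3 = 0 \<or> x mod 3 = 1 \<or> x mod 3 = 2" "y mod 3 = 0 \<or> y mod 3 = 1 \<or> y mod 3 = 2" by presburger+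
  hence "x mod 3 = 0 \<and> y mod 3 = 0" using 0 by (elim disjE) (simp_all only:, simp_all)
  thus ?thesis using mod_0_imp_dvd by blast
qed

text \<open>These are the coordinates of x^2 + \<delta> y^2 + 3 z^2 = 3 \<delta>. Modulo 3 it says
  x^2 = -\<delta> y^2; taking norms, with norm 2 for \<delta>, makes Na^2 + Ny^2 divisible by 3. So
  3 divides both norms and, being prime in Z[sqrt 2], divides x and y. Then z^2 = \<delta> modulo 3,
  which a check of residues excludes.\<close>

lemma no_solution_3delta:
  assumes e: "a1 * a1 + 2 * a2 * a2 + (2 * (y1 * y1 + 2 * y2 * y2) + 2 * (2 * y1 * y2)) + 3 * (z1 * z1 + 2 * z2 * z2) = (6::int)"
    "2 * a1 * a2 + ((y1 * y1 + 2 * y2 * y2) + 2 * (2 * y1 * y2)) + 3 * (2 * z1 * z2) = 3"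
  shows False
proof -
  define S T where "S = y1 * y1 + 2 * y2 * y2" and "T = 2 * y1 * y2"
  define u v where "u = 2 - (z1 * z1 + 2 * z2 * z2)" and "v = 1 - 2 * z1 * z2"
  have A: "a1 * a1 + 2 * a2 * a2 = 3 * u - 2 * S - 2 * T" "2 * a1 * a2 = 3 * v - S - 2 * T"
    using e unfolding u_def v_def S_def T_def by simp_all
  define Na Ny where "Na = a1 * a1 - 2 * a2 * a2" and "Ny = y1 * y1 - 2 * y2 * y2"
  have "Na * Na = (a1 * a1 + 2 * a2 * a2) * (a1 * a1 + 2 * a2 * a2) - 2 * ((2 * a1 * a2) * (2 * a1 * a2))"
    unfolding Na_def by (simp add: algebra_simps)
  also have "\<dots> = 3 * (3 * u * u - 4 * u * (S + T) - 6 * v * v + 4 * v * (S + 2 * T)) + 2 * (S * S - 2 * T * T)"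
    unfolding A by (simp add: algebra_simps)
  also have "S * S - 2 * T * T = Ny * Ny" unfolding S_def T_def Ny_def by (simp add: algebra_simps)
  finally have "Na * Na + Ny * Ny = 3 * (3 * u * u - 4 * u * (S + T) - 6 * v * v + 4 * v * (S + 2 * T) + Ny * Ny)" by simp
  hence "3 dvd Na * Na + Ny * Ny" by (rule dvdI)
  from three_dvd_sum_squares[OF this] have d: "3 dvd Na" "3 dvd Ny" by simp_all
  have "a1 * a1 + a2 * a2 = Na + 3 * (a2 * a2)" "y1 * y1 + y2 * y2 = Ny + 3 * (y2 * y2)"
    unfolding Na_def Ny_def by simp_all
  hence dd: "3 dvd a1 * a1 + a2 * a2" "3 dvd y1 * y1 + y2 * y2" using d by simp_all
  obtain b1 b2 x1 x2 where s: "a1 = 3 * b1" "a2 = 3 * b2" "y1 = 3 * x1" "y2 = 3 * x2"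
    using three_dvd_sum_squares[OF dd(1)] three_dvd_sum_squares[OF dd(2)] by (elim conjE dvdE)
  have "z1 * z1 + 2 * z2 * z2 = 2 + 3 * (- (b1 * b1 + 2 * b2 * b2 + (2 * (x1 * x1 + 2 * x2 * x2) + 2 * (2 * x1 * x2))))"
    using e(1) unfolding s by simp
  hence m1: "(z1 * z1 + 2 * z2 * z2) mod 3 = 2" by (simp only: mod_mult_self2) simp
  have "2 * z1 * z2 = 1 + 3 * (- (2 * b1 * b2 + ((x1 * x1 + 2 * x2 * x2) + 2 * (2 * x1 * x2))))"
    using e(2) unfolding s by simp
  hence m2: "(2 * z1 * z2) mod 3 = 1" by (simp only: mod_mult_self2) simp
  have n1: "((z1 mod 3) * (z1 mod 3) + 2 * (z2 mod 3) * (z2 mod 3)) mod 3 = 2"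
    by (rule trans[OF _ m1]) (intro mod_add_cong mod_mult_cong; simp)
  have n2: "(2 * (z1 mod 3) * (z2 mod 3)) mod 3 = 1"
    by (rule trans[OF _ m2]) (intro mod_mult_cong; simp)
  have "z1 mod 3 = 0 \<or> z1 mod 3 = 1 \<or> z1 mod 3 = 2" "z2 mod 3 = 0 \<or> z2 mod 3 = 1 \<or> z2 mod 3 = 2" by presburger+
  thus False using n1 n2 by (elim disjE) (simp_all only:, simp_all)
qed

abbreviation O2 where "O2 \<equiv> OK F0"

text \<open>3 stays prime in Z[sqrt 2] and does not divide \<delta>.\<close>

lemma three_dvd_delta_square:
  assumes "Z \<in> O2" "T \<in> O2" "(2 + sqrt2) * Z\<^sup>2 = 3 * T"
  shows "\<exists>z\<in>O2. Z = 3 * z"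
proof -
  obtain z1 z2 t1 t2 where Z: "Z = e2 z1 z2" and T: "T = e2 t1 t2" using assms unfolding OK_F0 by auto
  define s t where "s = z1 * z1 + 2 * z2 * z2" and "t = 2 * z1 * z2"
  have "e2 2 1 * e2 s t = e2 3 0 * e2 t1 t2"
    using assms(3) unfolding Z T e2_square s_def t_def by (simp add: e2_def)
  hence e: "2 * s + 2 * t = 3 * t1" "s + 2 * t = 3 * t2" unfolding e2_mult e2_eq_iff by auto
  have "s = 3 * (t1 - t2)" using e by presburger
  hence "z1 * z1 - z2 * z2 = 3 * (t1 - t2 - z2 * z2)" unfolding s_def by simp
  hence "3 dvd z1 * z1 - z2 * z2" by (rule dvdI)
  moreover have "4 * (z1 * z2) = 3 * (2 * t2 - t1)" using e unfolding t_def by simp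
  hence "3 dvd 4 * (z1 * z2)" by (rule dvdI)
  hence "3 dvd z1 * z2" by presburger
  hence "3 dvd z1 \<or> 3 dvd z2" using prime_dvd_mult_iff[of "3::int"] by simp
  ultimately have "3 dvd z1 * z1 + z2 * z2"
  proof (elim disjE)
    assume "3 dvd z1 * z1 - z2 * z2" "3 dvd z1"
    moreover have "z1 * z1 + z2 * z2 = 2 * z1 * z1 - (z1 * z1 - z2 * z2)" by simp
    ultimately show ?thesis by (metis dvd_diff dvd_mult)
  next
    assume "3 dvd z1 * z1 - z2 * z2" "3 dvd z2"
    moreover have "z1 * z1 + z2 * z2 = (z1 * z1 - z2 * z2) + 2 * z2 * z2" by simp
    ultimately show ?thesis by (metis dvd_add dvd_mult)
  qed
  from three_dvd_sum_squares[OF this] obtain h1 h2 where "z1 = 3 * h1" "z2 = 3 * h2" by (elim conjE dvdE)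
  hence "Z = 3 * e2 h1 h2" unfolding Z e2_def by simp
  thus ?thesis using OK_F0_e2 by blast
qed

text \<open>A pair \<open>(n, m)\<close> stands for the form \<open>x\<^sup>2 + (2 + sqrt2) y\<^sup>2 + 2 m y z + n z\<^sup>2\<close>.\<close>

definition frames :: "(complex \<times> complex) set" where
  "frames = {(1, 0), (2, 1), (2, -1), (2, 1 + sqrt2), (2, - (1 + sqrt2)),
             (3, 1), (3, -1), (3, 1 + sqrt2), (3, - (1 + sqrt2))}"

text \<open>The doubled off-diagonal coefficients express classicality: the bilinear form
  \<open>bl\<close> is integral on integral vectors.\<close>

locale tern =
  fixes a b c d e f :: complex
  assumes coeffs: "{a, b, c, d, e, f} \<subseteq> O2"
    and rep: "\<alpha> \<in> OK_plus F0 \<Longrightarrow> \<exists>x\<in>O2. \<exists>y\<in>O2. \<exists>z\<in>O2. \<alpha> = tform a b c (2 * d) (2 * e) (2 * f) x y z"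
    and pos: "x \<in> F0 \<Longrightarrow> y \<in> F0 \<Longrightarrow> z \<in> F0 \<Longrightarrow> (x, y, z) \<noteq> (0, 0, 0) \<Longrightarrow>
                totally_positive F0 (tform a b c (2 * d) (2 * e) (2 * f) x y z)"
begin

fun Gv :: "vec3 \<Rightarrow> vec3" where
  "Gv (x, y, z) = (a * x + d * y + e * z, d * x + b * y + f * z, e * x + f * y + c * z)"

definition bl :: "vec3 \<Rightarrow> vec3 \<Rightarrow> complex" where "bl u v = dot u (Gv v)"

abbreviation V where "V \<equiv> O2 \<times> O2 \<times> O2"

lemma bl_sym: "bl u v = bl v u"
  unfolding bl_def by (cases u; cases v) (simp add: algebra_simps)

lemma bl_add: "bl (vadd u v) w = bl u w + bl v w"
  unfolding bl_def by (cases u; cases v; cases w) (simp add: algebra_simps)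

lemma bl_sc: "bl (vsc k u) w = k * bl u w"
  unfolding bl_def by (cases u; cases w) (simp add: algebra_simps)

lemma bl_add': "bl w (vadd u v) = bl w u + bl w v" and bl_sc': "bl w (vsc k u) = k * bl w u"
  using bl_sym bl_add bl_sc by metis+

lemmas bl_simps = bl_add bl_sc bl_add' bl_sc'

lemma bl_tform: "bl (x, y, z) (x, y, z) = tform a b c (2 * d) (2 * e) (2 * f) x y z"
  unfolding bl_def tform_def by (simp add: algebra_simps power2_eq_square)

lemma bl_V: "u \<in> V \<Longrightarrow> v \<in> V \<Longrightarrow> bl u v \<in> O2"
  unfolding bl_def using coeffs by (cases u; cases v) (auto intro!: OK_F0_add OK_F0_mult)

lemma V_add: "u \<in> V \<Longrightarrow> v \<in> V \<Longrightarrow> vadd u v \<in> V"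
  by (cases u; cases v) (auto intro: OK_F0_add)

lemma V_sc: "k \<in> O2 \<Longrightarrow> u \<in> V \<Longrightarrow> vsc k u \<in> V"
  by (cases u) (auto intro: OK_F0_mult)

lemma bl_nonneg: "v \<in> V \<Longrightarrow> nonneg2 (bl v v)"
proof -
  assume v: "v \<in> V"
  obtain x y z where xyz: "v = (x, y, z)" by (cases v)
  obtain i j where ij: "bl v v = e2 i j" using bl_V[OF v v] OK_F0 by blast
  show ?thesis
  proof (cases "v = (0, 0, 0)")
    case True
    hence "bl v v = e2 0 0" unfolding bl_def e2_def by simp
    thus ?thesis by (simp only: nonneg2_e2) simp
  next
    case False
    have "totally_positive F0 (bl v v)"
      unfolding xyz bl_tform by (rule pos) (use v False xyz in \<open>auto simp: OK_def\<close>)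
    thus ?thesis unfolding ij totally_positive_e2 nonneg2_e2 by simp
  qed
qed

lemma rep_V: "\<alpha> \<in> OK_plus F0 \<Longrightarrow> \<exists>v\<in>V. bl v v = \<alpha>"
  using rep[of \<alpha>] bl_tform by (metis mem_Sigma_iff)

text \<open>Start from vectors of values 1, \<delta> and 3. As \<open>p\<close> has value 1,
  projecting away from it preserves integrality, and the projections have totally nonnegative
  values. No nonzero square fits below \<delta>, so \<open>q\<close> is already orthogonal to
  \<open>p\<close>; 3 minus a square below it is 1, 2 or 3. Finally the discriminant of
  \<open>q\<close> and \<open>r\<close> is totally nonnegative, which limits
  \<open>bl q r\<close>.\<close>

lemma frame_ex:
  "\<exists>p q r i j k. p \<in> V \<and> q \<in> V \<and> r \<in> V \<and> bl p p = 1 \<and> bl p q = 0 \<and> bl p r = 0 \<and>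
     bl q q = e2 2 1 \<and> bl q r = e2 j k \<and> bl r r = e2 i 0 \<and>
     (i, j, k) \<in> {(1,0,0), (2,0,0), (2,1,0), (2,-1,0), (2,1,1), (2,-1,-1),
                  (3,0,0), (3,1,0), (3,-1,0), (3,1,1), (3,-1,-1)}"
proof -
  have "e2 1 0 \<in> OK_plus F0" "e2 2 1 \<in> OK_plus F0" "e2 3 0 \<in> OK_plus F0"
    unfolding OK_plus_e2 using sqrt2_bounds by simp_all
  then obtain p q v where V: "p \<in> V" "q \<in> V" "v \<in> V"
    and Q: "bl p p = e2 1 0" "bl q q = e2 2 1" "bl v v = e2 3 0" using rep_V by metis
  have p1: "bl p p = 1" using Q(1) by (simp add: e2_def)
  obtain g h where gh: "bl p q = e2 g h" using bl_V[OF V(1,2)] OK_F0 by blast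
  have "vadd q (vsc (- e2 g h) p) \<in> V" using V by (intro V_add V_sc) (simp_all add: e2_minus OK_F0_e2)
  from bl_nonneg[OF this] have "nonneg2 (e2 2 1 - (e2 g h)\<^sup>2)"
    by (simp add: bl_simps Q(2) p1 gh bl_sym[of q p] power2_eq_square)
  hence "g = 0" "h = 0" using square_below_delta by auto
  hence pq: "bl p q = 0" using gh by (simp add: e2_def)
  obtain g h where gh: "bl p v = e2 g h" using bl_V[OF V(1,3)] OK_F0 by blast
  define r where "r = vadd v (vsc (- e2 g h) p)"
  have rV: "r \<in> V" unfolding r_def using V by (intro V_add V_sc) (simp_all add: e2_minus OK_F0_e2)
  have rr: "bl r r = e2 3 0 - (e2 g h)\<^sup>2"
    unfolding r_def by (simp add: bl_simps Q(3) p1 gh bl_sym[of v p] power2_eq_square)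
  have "nonneg2 (e2 3 0 - (e2 g h)\<^sup>2)" using bl_nonneg[OF rV] unfolding rr .
  hence "(g, h) \<in> {(0,0), (1,0), (-1,0), (0,1), (0,-1)}" by (rule square_below_3)
  hence i: "\<exists>i\<in>{1, 2, 3}. bl r r = e2 i 0" unfolding rr e2_square e2_diff by auto
  then obtain i where i: "i \<in> {1, 2, 3}" "bl r r = e2 i 0" by auto
  have pr: "bl p r = 0" unfolding r_def by (simp add: bl_simps gh p1)
  obtain j k where jk: "bl q r = e2 j k" using bl_V[OF V(2) rV] OK_F0 by blast
  define D where "D = e2 2 1 * e2 i 0 - (e2 j k)\<^sup>2"
  \<comment> \<open>The component of \<open>r\<close> orthogonal to \<open>q\<close>, scaled by
    \<delta> to clear denominators; its value is \<delta> times the discriminant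
    \<open>D\<close>.\<close>
  define u where "u = vadd (vsc (e2 2 1) r) (vsc (- e2 j k) q)"
  have "u \<in> V" unfolding u_def using V rV by (intro V_add V_sc) (simp_all add: e2_minus OK_F0_e2)
  moreover have "bl u u = e2 2 1 * D"
    unfolding u_def D_def by (simp add: bl_simps Q(2) i(2) jk bl_sym[of r q] power2_eq_square algebra_simps)
  ultimately have nn: "nonneg2 (e2 2 1 * D)" using bl_nonneg by metis
  obtain s t where st: "D = e2 s t" unfolding D_def e2_square e2_mult e2_diff by blast
  have "0 \<le> (2 + sqrt 2) * (s + t * sqrt 2)" "0 \<le> (2 - sqrt 2) * (s - t * sqrt 2)"
    using nn unfolding st e2_mult nonneg2_e2 by (simp_all add: algebra_simps)
  hence "0 \<le> s + t * sqrt 2" "0 \<le> s - t * sqrt 2"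
    using sqrt2_bounds by (simp_all add: zero_le_mult_iff)
  hence nD: "nonneg2 (e2 2 1 * e2 i 0 - (e2 j k)\<^sup>2)" using st nonneg2_e2 unfolding D_def by metis
  have "(i, j, k) \<in> {(1,0,0), (2,0,0), (2,1,0), (2,-1,0), (2,1,1), (2,-1,-1),
                  (3,0,0), (3,1,0), (3,-1,0), (3,1,1), (3,-1,-1)}"
    using i(1)
  proof (elim insertE emptyE)
    assume i: "i = 1"
    have "nonneg2 (e2 2 1 - (e2 j k)\<^sup>2)" using nD unfolding i e2_mult by simp
    thus ?thesis using square_below_delta i by auto
  next
    assume i: "i = 2"
    have "nonneg2 (e2 4 2 - (e2 j k)\<^sup>2)" using nD unfolding i e2_mult by simp
    thus ?thesis using square_below_2delta i by auto
  next
    assume i: "i = 3"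
    have "nonneg2 (e2 6 3 - (e2 j k)\<^sup>2)" using nD unfolding i e2_mult by simp
    thus ?thesis using square_below_3delta i by auto
  qed
  thus ?thesis
    by (intro exI[of _ p] exI[of _ q] exI[of _ r] exI[of _ i] exI[of _ j] exI[of _ k] conjI V(1,2) rV p1 pq pr Q(2) jk i(2))
qed

context
  fixes p q r and n m :: complex
  assumes V: "p \<in> V" "q \<in> V" "r \<in> V"
    and gram: "bl p p = 1" "bl p q = 0" "bl p r = 0" "bl q q = 2 + sqrt2" "bl q r = m" "bl r r = n"
    and D: "(2 + sqrt2) * n - m\<^sup>2 \<noteq> 0"
begin

lemma frame_coords: "\<exists>k l h. w = comb k p l q h r"
proof (rule cramer)
  have "det3 p q r * det3 (Gv p) (Gv q) (Gv r) = (2 + sqrt2) * n - m\<^sup>2"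
    unfolding det3_dot bl_def[symmetric] using gram
    by (simp add: bl_sym[of q p] bl_sym[of r p] bl_sym[of r q] power2_eq_square)
  thus "det3 p q r \<noteq> 0" using D by auto
qed

lemma bl_comb:
  assumes "w = comb k p l q h r"
  shows "bl w p = k" "bl w q = (2 + sqrt2) * l + m * h" "bl w r = m * l + n * h"
    "bl w w = k\<^sup>2 + ((2 + sqrt2) * l\<^sup>2 + 2 * m * l * h + n * h\<^sup>2)"
  unfolding assms comb_def
  by (simp_all add: bl_simps gram bl_sym[of q p] bl_sym[of r p] bl_sym[of r q] power2_eq_square algebra_simps)

text \<open>By Cramer's rule \<Delta> l and \<Delta> h are integral, and the value of
  \<open>w\<close> shows that their squares are \<Delta> times integral elements. So
  \<open>sqf\<close> lets \<Delta> be divided out, and the frame spans all of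
  \<open>V\<close>.\<close>

lemma coords_sqf:
  assumes sq: "sqf ((2 + sqrt2) * n - m\<^sup>2)" and nm: "n \<in> O2" "m \<in> O2" and w: "w \<in> V"
  shows "\<exists>k\<in>O2. \<exists>l\<in>O2. \<exists>h\<in>O2. w = comb k p l q h r"
proof -
  obtain k l h where c: "w = comb k p l q h r" using frame_coords by blast
  note b = bl_comb[OF c]
  define Y Z W where "Y = bl w q" and "Z = bl w r" and "W = bl w w - k\<^sup>2"
  define \<Delta> where "\<Delta> = (2 + sqrt2) * n - m\<^sup>2"
  have kO: "k \<in> O2" using bl_V[OF w V(1)] b(1) by simp
  have YO: "Y \<in> O2" and ZO: "Z \<in> O2" unfolding Y_def Z_def using bl_V w V by auto
  have WO: "W \<in> O2" unfolding W_def using bl_V w kO by (intro OK_F0_diff OK_F0_power) auto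
  have dO: "2 + sqrt2 \<in> O2" using OK_F0_e2[of 2 1] by (simp add: e2_def)
  have e1: "n * Y - m * Z = \<Delta> * l" "(2 + sqrt2) * Z - m * Y = \<Delta> * h"
    unfolding Y_def Z_def b \<Delta>_def by (simp_all add: algebra_simps power2_eq_square)
  have e2: "n * W - Z\<^sup>2 = \<Delta> * l\<^sup>2" "(2 + sqrt2) * W - Y\<^sup>2 = \<Delta> * h\<^sup>2"
    unfolding Y_def Z_def W_def b \<Delta>_def by (simp_all add: algebra_simps power2_eq_square)
  have "(n * Y - m * Z)\<^sup>2 = \<Delta> * (n * W - Z\<^sup>2)" "((2 + sqrt2) * Z - m * Y)\<^sup>2 = \<Delta> * ((2 + sqrt2) * W - Y\<^sup>2)"
    unfolding e1 e2 by (simp_all add: power2_eq_square mult_ac)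
  moreover have "n * Y - m * Z \<in> O2" "n * W - Z\<^sup>2 \<in> O2" "(2 + sqrt2) * Z - m * Y \<in> O2" "(2 + sqrt2) * W - Y\<^sup>2 \<in> O2"
    by (intro OK_F0_diff OK_F0_mult OK_F0_power nm dO YO ZO WO)+
  ultimately obtain l' h' where "l' \<in> O2" "h' \<in> O2" "n * Y - m * Z = \<Delta> * l'" "(2 + sqrt2) * Z - m * Y = \<Delta> * h'"
    using sq unfolding sqf_def \<Delta>_def[symmetric] by metis
  hence "l \<in> O2" "h \<in> O2" using e1 D unfolding \<Delta>_def[symmetric] by auto
  thus ?thesis using kO c by blast
qed

end

text \<open>Two frames get separate treatment: for (2, 0) the discriminant 2 \<delta> has a square
  factor, and (3, 0) cannot occur.\<close>

lemma good_frame: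
  "\<exists>p q r n m. bl p p = 1 \<and> bl p q = 0 \<and> bl p r = 0 \<and> bl q q = 2 + sqrt2 \<and> bl q r = m \<and> bl r r = n \<and>
     (n, m) \<in> frames \<and> (\<forall>w\<in>V. \<exists>k\<in>O2. \<exists>l\<in>O2. \<exists>h\<in>O2. w = comb k p l q h r)"
proof -
  obtain p q r i j k where V: "p \<in> V" "q \<in> V" "r \<in> V"
    and g: "bl p p = 1" "bl p q = 0" "bl p r = 0" "bl q q = e2 2 1" "bl q r = e2 j k" "bl r r = e2 i 0"
    and ijk: "(i, j, k) \<in> {(1,0,0), (2,0,0), (2,1,0), (2,-1,0), (2,1,1), (2,-1,-1),
                  (3,0,0), (3,1,0), (3,-1,0), (3,1,1), (3,-1,-1)}"
    using frame_ex by (elim exE conjE)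
  have d: "e2 2 1 = 2 + sqrt2" unfolding e2_def by simp
  note g' = g(1-3) g(4)[unfolded d] g(5,6)
  define \<Delta> where "\<Delta> = e2 2 1 * e2 i 0 - (e2 j k)\<^sup>2"
  have De: "\<Delta> = e2 (2 * i - j * j - 2 * k * k) (i - 2 * j * k)"
    unfolding \<Delta>_def e2_square e2_mult e2_diff by (simp add: algebra_simps)
  have D0: "(2 + sqrt2) * e2 i 0 - (e2 j k)\<^sup>2 \<noteq> 0"
    unfolding d[symmetric] \<Delta>_def[symmetric] De e2_0[symmetric] e2_eq_iff using ijk by auto
  have dnz: "2 + sqrt2 \<noteq> 0" unfolding d[symmetric] e2_0[symmetric] e2_eq_iff by simp
  have dd: "(2 - sqrt2) * (2 + sqrt2) = 2" by (simp add: algebra_simps sqrt2_mult)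
  consider (a) "(i, j, k) \<notin> {(2,0,0), (3,0,0)}" | (b) "(i, j, k) = (2,0,0)" | (c) "(i, j, k) = (3,0,0)" by blast
  thus ?thesis
  proof cases
    case a
    have "sqf \<Delta>" unfolding De using ijk a sqf_delta sqf_1 sqf_eps sqf_5_3 sqf_3_1 by auto
    hence sq: "sqf ((2 + sqrt2) * e2 i 0 - (e2 j k)\<^sup>2)" unfolding \<Delta>_def d .
    have ev: "e2 1 0 = 1" "e2 2 0 = 2" "e2 3 0 = 3" "e2 0 0 = 0" "e2 (-1) 0 = -1" "e2 1 1 = 1 + sqrt2"
      "e2 (-1) (-1) = - (1 + sqrt2)" by (simp_all add: e2_def)
    have "(e2 i 0, e2 j k) \<in> frames"
      using ijk a unfolding frames_def by (elim insertE emptyE) (simp_all only: Pair_inject ev insert_iff simp_thms prod.inject)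
    moreover have "\<forall>w\<in>V. \<exists>k\<in>O2. \<exists>l\<in>O2. \<exists>h\<in>O2. w = comb k p l q h r"
      by (intro ballI coords_sqf[OF V g' D0 sq] OK_F0_e2)
    ultimately show ?thesis
      by (intro exI[of _ p] exI[of _ q] exI[of _ r] exI[of _ "e2 i 0"] exI[of _ "e2 j k"] conjI g')
  next
    case b
    hence n: "e2 i 0 = 2" and m: "e2 j k = 0" by (simp_all add: e2_def)
    \<comment> \<open>The vectors may span a sublattice of index \<open>sqrt2\<close>; replacing \<open>r\<close> by \<open>r / sqrt2\<close> makes up for it, whether
      or not that vector is integral.\<close>
    define r' where "r' = vsc (sqrt2 / 2) r"
    have "bl r' r' = 1" "bl q r' = 0" "bl p r' = 0" unfolding r'_def bl_simps g' m n
      by (simp_all add: sqrt2_mult)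
    moreover have "(1, 0) \<in> frames" unfolding frames_def by simp
    moreover have "\<exists>k\<in>O2. \<exists>l\<in>O2. \<exists>h\<in>O2. w = comb k p l q h r'" if w: "w \<in> V" for w
    proof -
      obtain u l h where c: "w = comb u p l q h r" using frame_coords[OF V g' D0] by blast
      note bc = bl_comb[OF V g' D0 c, unfolded m n]
      have uO: "u \<in> O2" using bl_V[OF w V(1)] bc(1) by simp
      define Y Z W where "Y = bl w q" and "Z = bl w r" and "W = bl w w - u\<^sup>2"
      have YO: "Y \<in> O2" and ZO: "Z \<in> O2" unfolding Y_def Z_def using bl_V w V by auto
      have WO: "W \<in> O2" unfolding W_def using bl_V w uO by (intro OK_F0_diff OK_F0_power) auto
      have Y: "Y = (2 + sqrt2) * l" and Z: "Z = 2 * h" and W: "W = (2 + sqrt2) * l\<^sup>2 + 2 * h\<^sup>2"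
        unfolding Y_def Z_def W_def bc by simp_all
      have "(2 - sqrt2) * Y\<^sup>2 = ((2 - sqrt2) * (2 + sqrt2)) * ((2 + sqrt2) * l\<^sup>2)"
        unfolding Y by (simp add: power2_eq_square mult_ac)
      hence "(2 - sqrt2) * Y\<^sup>2 = 2 * ((2 + sqrt2) * l\<^sup>2)" unfolding dd .
      \<comment> \<open>In coordinates this makes the rational part of \<open>Z\<close> even, so
        \<open>Z\<close> is \<open>sqrt2\<close> times an integer, which becomes the coordinate
        along \<open>r'\<close>.\<close>
      hence ZZ: "Z\<^sup>2 = 2 * W - (2 - sqrt2) * Y\<^sup>2" unfolding Z W by (simp add: power2_eq_square algebra_simps)
      obtain z1 z2 y1 y2 w1 w2 where e: "Z = e2 z1 z2" "Y = e2 y1 y2" "W = e2 w1 w2"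
        using ZO YO WO unfolding OK_F0 by auto
      have "e2 (z1 * z1 + 2 * z2 * z2) (2 * z1 * z2) = e2 2 0 * e2 w1 w2 - e2 2 (-1) * e2 (y1 * y1 + 2 * y2 * y2) (2 * y1 * y2)"
        using ZZ unfolding e e2_square by (simp add: e2_def)
      hence "z1 * z1 + 2 * z2 * z2 = 2 * w1 - (2 * (y1 * y1 + 2 * y2 * y2) - 2 * (2 * y1 * y2))"
        unfolding e2_mult e2_diff e2_eq_iff by simp
      hence "z1 * z1 = 2 * (w1 - z2 * z2 - (y1 * y1 + 2 * y2 * y2) + 2 * y1 * y2)" by simp
      hence "even (z1 * z1)" by (rule dvdI)
      then obtain g where gz: "z1 = 2 * g" by (auto elim: evenE)
      define h' where "h' = e2 z2 g"
      have h'O: "h' \<in> O2" unfolding h'_def by (rule OK_F0_e2)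
      have Zh: "Z = sqrt2 * h'" unfolding e h'_def gz e2_def by (simp add: algebra_simps sqrt2_mult sqrt2_mult')
      have "h = Z / 2" unfolding Z by simp
      hence hh: "h = sqrt2 / 2 * h'" unfolding Zh by simp
      have "Y\<^sup>2 = (2 + sqrt2) * (W - h'\<^sup>2)"
        unfolding Y W hh by (simp add: power2_eq_square algebra_simps sqrt2_mult sqrt2_mult')
      then obtain l' where l': "l' \<in> O2" "Y = (2 + sqrt2) * l'"
        using sqf_delta YO OK_F0_diff[OF WO OK_F0_power[OF h'O, of 2]] unfolding sqf_def d by metis
      hence "l = l'" using Y dnz by simp
      moreover have "w = comb u p l q h' r'"
      proof -
        obtain r1 r2 r3 where "r = (r1, r2, r3)" by (cases r)
        thus ?thesis unfolding c hh comb_def r'_def by (simp add: mult_ac)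
      qed
      ultimately show ?thesis by (intro bexI[OF _ uO] bexI[OF _ l'(1)] bexI[OF _ h'O]) simp
    qed
    ultimately show ?thesis
      by (intro exI[of _ p] exI[of _ q] exI[of _ r'] exI[of _ 1] exI[of _ 0] conjI ballI g'(1,2,4))
  next
    case c
    hence n: "e2 i 0 = 3" and m: "e2 j k = 0" by (simp_all add: e2_def)
    \<comment> \<open>The value tested is 3 \<delta>. A vector representing it turns out to have
      integral coordinates in the frame, against \<open>no_solution_3delta\<close>.\<close>
    have "e2 6 3 \<in> OK_plus F0" unfolding OK_plus_e2 using sqrt2_bounds by simp
    then obtain w where w: "w \<in> V" "bl w w = e2 6 3" using rep_V by blast
    obtain u l h where c: "w = comb u p l q h r" using frame_coords[OF V g' D0] by blast
    note bc = bl_comb[OF V g' D0 c, unfolded m n]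
    have uO: "u \<in> O2" using bl_V[OF w(1) V(1)] bc(1) by simp
    define Y Z where "Y = bl w q" and "Z = bl w r"
    have YO: "Y \<in> O2" and ZO: "Z \<in> O2" unfolding Y_def Z_def using bl_V w V by auto
    have dO: "2 + sqrt2 \<in> O2" using OK_F0_e2[of 2 1] unfolding d .
    have Y: "Y = (2 + sqrt2) * l" and Z: "Z = 3 * h" and W: "e2 6 3 - u\<^sup>2 = (2 + sqrt2) * l\<^sup>2 + 3 * h\<^sup>2"
      using bc w(2) unfolding Y_def Z_def by simp_all
    have "(2 + sqrt2) * Z\<^sup>2 = 3 * ((2 + sqrt2) * (e2 6 3 - u\<^sup>2) - Y\<^sup>2)"
      unfolding W Y Z by (simp add: power2_eq_square algebra_simps)
    moreover have "(2 + sqrt2) * (e2 6 3 - u\<^sup>2) - Y\<^sup>2 \<in> O2"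
      by (intro OK_F0_diff OK_F0_mult OK_F0_power OK_F0_e2 dO uO YO)
    ultimately obtain z where z: "z \<in> O2" "Z = 3 * z" using three_dvd_delta_square[OF ZO] by blast
    have hO: "h \<in> O2" using z Z by simp
    have "Y\<^sup>2 = (2 + sqrt2) * (e2 6 3 - u\<^sup>2 - 3 * h\<^sup>2)"
      unfolding W Y by (simp add: power2_eq_square algebra_simps)
    moreover have "e2 6 3 - u\<^sup>2 - 3 * h\<^sup>2 \<in> O2" using OK_F0_e2[of 3 0] hO uO
      by (intro OK_F0_diff OK_F0_mult OK_F0_power OK_F0_e2) (simp_all add: e2_num)
    ultimately obtain l' where l': "l' \<in> O2" "Y = (2 + sqrt2) * l'"
      using sqf_delta YO unfolding sqf_def d by metis
    hence lO: "l \<in> O2" using Y dnz by simp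
    obtain u1 u2 l1 l2 h1 h2 where e: "u = e2 u1 u2" "l = e2 l1 l2" "h = e2 h1 h2"
      using uO lO hO unfolding OK_F0 by auto
    have "e2 6 3 = (e2 u1 u2)\<^sup>2 + e2 2 1 * (e2 l1 l2)\<^sup>2 + e2 3 0 * (e2 h1 h2)\<^sup>2"
      using W unfolding e d e2_num by (simp add: algebra_simps)
    hence "u1 * u1 + 2 * u2 * u2 + (2 * (l1 * l1 + 2 * l2 * l2) + 2 * (2 * l1 * l2)) + 3 * (h1 * h1 + 2 * h2 * h2) = 6"
      "2 * u1 * u2 + ((l1 * l1 + 2 * l2 * l2) + 2 * (2 * l1 * l2)) + 3 * (2 * h1 * h2) = 3"
      unfolding e2_square e2_mult e2_add e2_eq_iff by simp_all
    thus ?thesis using no_solution_3delta by blast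
  qed
qed

end

section \<open>The universal forms\<close>

text \<open>This is all that is used about universality over \<open>K\<close>.\<close>

definition delta_form :: "complex set \<Rightarrow> bool" where
  "delta_form K \<longleftrightarrow> (\<forall>\<alpha>\<in>OK_plus K. \<exists>x w t A B. {x, w, t, A, B} \<subseteq> OK K \<and>
        \<alpha> = x\<^sup>2 + w\<^sup>2 + (2 + sqrt2) * t \<and> 2 * ((2 + sqrt2) * t) = A\<^sup>2 + B\<^sup>2)"

definition represents_frame :: "complex set \<Rightarrow> complex \<Rightarrow> complex \<Rightarrow> bool" where
  "represents_frame K n m \<longleftrightarrow> (\<forall>\<alpha>\<in>OK_plus K. \<exists>x\<in>OK K. \<exists>y\<in>OK K. \<exists>z\<in>OK K.
      \<alpha> = x\<^sup>2 + ((2 + sqrt2) * y\<^sup>2 + 2 * m * y * z + n * z\<^sup>2))"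

lemma delta_formI:
  assumes "\<And>\<alpha>. \<alpha> \<in> OK_plus K \<Longrightarrow> \<exists>x w t A B. x \<in> OK K \<and> w \<in> OK K \<and> t \<in> OK K \<and> A \<in> OK K \<and> B \<in> OK K \<and>
        \<alpha> = x\<^sup>2 + w\<^sup>2 + (2 + sqrt2) * t \<and> 2 * ((2 + sqrt2) * t) = A\<^sup>2 + B\<^sup>2"
  shows "delta_form K"
  unfolding delta_form_def
proof
  fix \<alpha> assume "\<alpha> \<in> OK_plus K"
  from assms[OF this] obtain x w t A B where "x \<in> OK K" "w \<in> OK K" "t \<in> OK K" "A \<in> OK K" "B \<in> OK K"
    "\<alpha> = x\<^sup>2 + w\<^sup>2 + (2 + sqrt2) * t" "2 * ((2 + sqrt2) * t) = A\<^sup>2 + B\<^sup>2" by (elim exE conjE)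
  thus "\<exists>x w t A B. {x, w, t, A, B} \<subseteq> OK K \<and>
        \<alpha> = x\<^sup>2 + w\<^sup>2 + (2 + sqrt2) * t \<and> 2 * ((2 + sqrt2) * t) = A\<^sup>2 + B\<^sup>2"
    by (intro exI[of _ x] exI[of _ w] exI[of _ t] exI[of _ A] exI[of _ B]) simp
qed

context tr_field
begin

lemma sqrt2_OK: "sqrt2 \<in> K \<Longrightarrow> sqrt2 \<in> OK K"
  unfolding OK_def algebraic_integer_iff using algebraic_int_sqrt2 by simp

text \<open>The identities \<delta> (2 - sqrt 2) = 2 and \<delta> sqrt 2 = 2 (1 + sqrt 2) let
  \<delta> be factored out of the mixed terms, and 2 \<delta> = 1 + (1 + sqrt 2)^2 supplies the two
  squares. The parameter \<open>k\<close> is 0 for n = 2 and 1 for n = 3; negating z changes the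
  sign of m.\<close>

lemma delta_form_frame:
  assumes q: "sqrt2 \<in> K" and nm: "(n, m) \<in> frames" and rep: "represents_frame K n m"
  shows "delta_form K"
proof (rule delta_formI)
  let ?P = "\<lambda>\<alpha>. \<exists>x w t A B. x \<in> OK K \<and> w \<in> OK K \<and> t \<in> OK K \<and> A \<in> OK K \<and> B \<in> OK K \<and>
        \<alpha> = x\<^sup>2 + w\<^sup>2 + (2 + sqrt2) * t \<and> 2 * ((2 + sqrt2) * t) = A\<^sup>2 + B\<^sup>2"
  note cl = sqrt2_OK[OF q] OK_add OK_mult OK_diff OK_power OK_numeral OK_1 OK_0
  note alg = power2_eq_square algebra_simps sqrt2_mult sqrt2_mult'
  have m0: "?P (x\<^sup>2 + ((2 + sqrt2) * y\<^sup>2 + 2 * 0 * y * z + 1 * z\<^sup>2))"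
    if O: "x \<in> OK K" "y \<in> OK K" "z \<in> OK K" for x y z
    by (rule exI[of _ x], rule exI[of _ z], rule exI[of _ "y\<^sup>2"],
        rule exI[of _ y], rule exI[of _ "(1 + sqrt2) * y"], intro conjI cl O)
      (simp_all add: alg)
  have m1: "?P (x\<^sup>2 + ((2 + sqrt2) * y\<^sup>2 + 2 * 1 * y * z + (2 + k\<^sup>2) * z\<^sup>2))"
    if O: "x \<in> OK K" "y \<in> OK K" "z \<in> OK K" "k \<in> OK K" for x y z k
    by (rule exI[of _ x], rule exI[of _ "k * z"], rule exI[of _ "y\<^sup>2 + (2 - sqrt2) * y * z + (2 - sqrt2) * z\<^sup>2"],
        rule exI[of _ "y + 2 * z"], rule exI[of _ "(1 + sqrt2) * y"], intro conjI cl O)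
      (simp_all add: alg)
  have m2: "?P (x\<^sup>2 + ((2 + sqrt2) * y\<^sup>2 + 2 * (1 + sqrt2) * y * z + (2 + k\<^sup>2) * z\<^sup>2))"
    if O: "x \<in> OK K" "y \<in> OK K" "z \<in> OK K" "k \<in> OK K" for x y z k
    by (rule exI[of _ x], rule exI[of _ "k * z"], rule exI[of _ "y\<^sup>2 + sqrt2 * y * z + (2 - sqrt2) * z\<^sup>2"],
        rule exI[of _ y], rule exI[of _ "(1 + sqrt2) * y + 2 * z"], intro conjI cl O)
      (simp_all add: alg)
  fix \<alpha> assume "\<alpha> \<in> OK_plus K"
  then obtain x y z where O: "x \<in> OK K" "y \<in> OK K" "z \<in> OK K"
    and a: "\<alpha> = x\<^sup>2 + ((2 + sqrt2) * y\<^sup>2 + 2 * m * y * z + n * z\<^sup>2)" using rep unfolding represents_frame_def by blast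
  have mz: "- z \<in> OK K" using OK_minus O by blast
  have neg: "\<alpha> = x\<^sup>2 + ((2 + sqrt2) * y\<^sup>2 + 2 * - m * y * (- z) + n * (- z)\<^sup>2)" unfolding a by simp
  have "(n = 1 \<and> m = 0) \<or> (n = 2 + 0\<^sup>2 \<or> n = 2 + 1\<^sup>2) \<and> (m = 1 \<or> m = 1 + sqrt2 \<or> - m = 1 \<or> - m = 1 + sqrt2)"
    using nm unfolding frames_def by auto
  thus "?P \<alpha>"
  proof (elim disjE conjE)
    assume "n = 1" "m = 0"
    thus ?thesis unfolding a using m0[OF O] by simp
  qed (use m1[OF O OK_0] m1[OF O OK_1] m2[OF O OK_0] m2[OF O OK_1] a
        m1[OF O(1,2) mz OK_0] m1[OF O(1,2) mz OK_1] m2[OF O(1,2) mz OK_0] m2[OF O(1,2) mz OK_1] neg in \<open>simp_all only:\<close>)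
qed

lemma universal_rep: "universal K Q \<Longrightarrow> \<alpha> \<in> OK_plus K \<Longrightarrow> \<exists>x\<in>OK K. \<exists>y\<in>OK K. \<exists>z\<in>OK K. \<alpha> = Q x y z"
proof -
  assume u: "universal K Q" and "\<alpha> \<in> OK_plus K"
  hence "\<alpha> \<in> {Q x y z | x y z. x \<in> OK K \<and> y \<in> OK K \<and> z \<in> OK K \<and> (x, y, z) \<noteq> (0, 0, 0)}"
    unfolding universal_def by simp
  thus ?thesis by blast
qed

lemma delta_form_universal:
  assumes q: "sqrt2 \<in> K" and fr: "(n, m) \<in> frames" and u: "universal K Q"
    and Q: "\<And>x y z. x \<in> OK K \<Longrightarrow> y \<in> OK K \<Longrightarrow> z \<in> OK K \<Longrightarrow> \<exists>X\<in>OK K. \<exists>Y\<in>OK K. \<exists>Z\<in>OK K.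
      Q x y z = X\<^sup>2 + ((2 + sqrt2) * Y\<^sup>2 + 2 * m * Y * Z + n * Z\<^sup>2)"
  shows "delta_form K"
proof (rule delta_form_frame[OF q fr], unfold represents_frame_def, rule)
  fix \<alpha> assume "\<alpha> \<in> OK_plus K"
  from universal_rep[OF u this] obtain x y z where "x \<in> OK K" "y \<in> OK K" "z \<in> OK K" "\<alpha> = Q x y z" by (elim bexE)
  thus "\<exists>X\<in>OK K. \<exists>Y\<in>OK K. \<exists>Z\<in>OK K. \<alpha> = X\<^sup>2 + ((2 + sqrt2) * Y\<^sup>2 + 2 * m * Y * Z + n * Z\<^sup>2)"
    using Q by simp
qed

lemma delta_form_Q1: "sqrt2 \<in> K \<Longrightarrow> universal K (tform 1 1 (2 + sqrt2) 0 0 0) \<Longrightarrow> delta_form K"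
proof (rule delta_form_universal[where n = 1 and m = 0 and Q = "tform 1 1 (2 + sqrt2) 0 0 0"])
  fix x y z assume "x \<in> OK K" "y \<in> OK K" "z \<in> OK K"
  thus "\<exists>X\<in>OK K. \<exists>Y\<in>OK K. \<exists>Z\<in>OK K.
      tform 1 1 (2 + sqrt2) 0 0 0 x y z = X\<^sup>2 + ((2 + sqrt2) * Y\<^sup>2 + 2 * 0 * Y * Z + 1 * Z\<^sup>2)"
    by (intro bexI[of _ x] bexI[of _ z] bexI[of _ y]) (simp_all add: tform_def)
qed (auto simp: frames_def)

lemma delta_form_Q2: "sqrt2 \<in> K \<Longrightarrow> universal K (tform 1 (2 + sqrt2) (2 - sqrt2) 0 0 2) \<Longrightarrow> delta_form K"
proof (rule delta_form_universal[where n = 2 and m = "- (1 + sqrt2)" and Q = "tform 1 (2 + sqrt2) (2 - sqrt2) 0 0 2"])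
  fix x y z assume "x \<in> OK K" "y \<in> OK K" "z \<in> OK K"
  \<comment> \<open>Shifting y by z turns the mixed coefficient into 2 \<delta> - 2 (1 + sqrt 2) =
    2.\<close>
  thus "\<exists>X\<in>OK K. \<exists>Y\<in>OK K. \<exists>Z\<in>OK K.
      tform 1 (2 + sqrt2) (2 - sqrt2) 0 0 2 x y z = X\<^sup>2 + ((2 + sqrt2) * Y\<^sup>2 + 2 * - (1 + sqrt2) * Y * Z + 2 * Z\<^sup>2)"
    by (intro bexI[of _ x] bexI[of _ "y + z"] bexI[of _ z] OK_add)
      (simp_all add: tform_def power2_eq_square algebra_simps sqrt2_mult sqrt2_mult')
qed (auto simp: frames_def)

lemma delta_form_Q3: "sqrt2 \<in> K \<Longrightarrow> universal K (tform 1 (2 + sqrt2) 3 0 0 2) \<Longrightarrow> delta_form K"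
proof (rule delta_form_universal[where n = 3 and m = 1 and Q = "tform 1 (2 + sqrt2) 3 0 0 2"])
  fix x y z assume "x \<in> OK K" "y \<in> OK K" "z \<in> OK K"
  thus "\<exists>X\<in>OK K. \<exists>Y\<in>OK K. \<exists>Z\<in>OK K.
      tform 1 (2 + sqrt2) 3 0 0 2 x y z = X\<^sup>2 + ((2 + sqrt2) * Y\<^sup>2 + 2 * 1 * Y * Z + 3 * Z\<^sup>2)"
    by (intro bexI[of _ x] bexI[of _ y] bexI[of _ z]) (simp_all add: tform_def)
qed (auto simp: frames_def)

lemma delta_form_Q3': "sqrt2 \<in> K \<Longrightarrow> universal K (tform 1 (2 - sqrt2) 3 0 0 2) \<Longrightarrow> delta_form K"
proof (rule delta_form_universal[where n = 3 and m = "1 + sqrt2" and Q = "tform 1 (2 - sqrt2) 3 0 0 2"])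
  fix x y z assume "sqrt2 \<in> K" "x \<in> OK K" "y \<in> OK K" "z \<in> OK K"
  \<comment> \<open>The rescaling of y by a unit rests on 2 - sqrt 2 = \<delta> (sqrt 2 - 1)^2 and
    (1 + sqrt 2)(sqrt 2 - 1) = 1.\<close>
  thus "\<exists>X\<in>OK K. \<exists>Y\<in>OK K. \<exists>Z\<in>OK K.
      tform 1 (2 - sqrt2) 3 0 0 2 x y z = X\<^sup>2 + ((2 + sqrt2) * Y\<^sup>2 + 2 * (1 + sqrt2) * Y * Z + 3 * Z\<^sup>2)"
    by (intro bexI[of _ x] bexI[of _ "(sqrt2 - 1) * y"] bexI[of _ z] OK_mult OK_diff sqrt2_OK OK_1)
      (simp_all add: tform_def power2_eq_square algebra_simps sqrt2_mult sqrt2_mult')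
qed (auto simp: frames_def)

lemma O2_OK: "sqrt2 \<in> K \<Longrightarrow> O2 \<subseteq> OK K"
  using gen_field_subset[OF subfield_K] unfolding OK_def by auto

text \<open>Universality over \<open>F0\<close> provides the frame. The standard basis vectors have
  coordinates in \<open>O2\<close> with respect to it, and these are integral over \<open>K\<close>
  too; so a representation over \<open>K\<close> by the given form becomes one by the frame
  form.\<close>

lemma delta_form_classical:
  assumes q: "sqrt2 \<in> K" and cl: "classical O2 a11 a22 a33 a12 a13 a23"
    and u0: "universal F0 (tform a11 a22 a33 a12 a13 a23)" and u: "universal K (tform a11 a22 a33 a12 a13 a23)"
  shows "delta_form K"
proof -
  obtain e1 e2 e3 where e: "a12 = 2 * e1" "a13 = 2 * e2" "a23 = 2 * e3"
    and O: "{a11, a22, a33, e1, e2, e3} \<subseteq> O2" using cl unfolding classical_def by auto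
  interpret t: tern a11 a22 a33 e1 e2 e3
  proof
    show "{a11, a22, a33, e1, e2, e3} \<subseteq> O2" by fact
    fix \<alpha> assume "\<alpha> \<in> OK_plus F0"
    hence "\<alpha> \<in> {tform a11 a22 a33 a12 a13 a23 x y z | x y z. x \<in> O2 \<and> y \<in> O2 \<and> z \<in> O2 \<and> (x, y, z) \<noteq> (0, 0, 0)}"
      using u0 unfolding universal_def by simp
    thus "\<exists>x\<in>O2. \<exists>y\<in>O2. \<exists>z\<in>O2. \<alpha> = tform a11 a22 a33 (2 * e1) (2 * e2) (2 * e3) x y z"
      unfolding e by blast
  next
    fix x y z assume "x \<in> F0" "y \<in> F0" "z \<in> F0" "(x, y, z) \<noteq> (0, 0, 0)"
    thus "totally_positive F0 (tform a11 a22 a33 (2 * e1) (2 * e2) (2 * e3) x y z)"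
      using u0 unfolding universal_def positive_definite_def e by blast
  qed
  obtain p q' r n m where g: "t.bl p p = 1" "t.bl p q' = 0" "t.bl p r = 0" "t.bl q' q' = 2 + sqrt2" "t.bl q' r = m" "t.bl r r = n"
    and fr: "(n, m) \<in> frames" and co: "\<forall>w\<in>t.V. \<exists>k\<in>O2. \<exists>l\<in>O2. \<exists>h\<in>O2. w = comb k p l q' h r"
    using t.good_frame by (elim exE conjE)
  have O01: "0 \<in> O2" "1 \<in> O2" using OK_F0_e2[of 0 0] OK_F0_e2[of 1 0] by (simp_all add: e2_def)
  have "(1, 0, 0) \<in> t.V" "(0, 1, 0) \<in> t.V" "(0, 0, 1) \<in> t.V" using O01 by auto
  then obtain k1 l1 h1 k2 l2 h2 k3 l3 h3 where
    c: "(1, 0, 0) = comb k1 p l1 q' h1 r" "(0, 1, 0) = comb k2 p l2 q' h2 r" "(0, 0, 1) = comb k3 p l3 q' h3 r"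
    and in2: "k1 \<in> O2" "l1 \<in> O2" "h1 \<in> O2" "k2 \<in> O2" "l2 \<in> O2" "h2 \<in> O2" "k3 \<in> O2" "l3 \<in> O2" "h3 \<in> O2"
    using co by meson
  note inK = in2[THEN subsetD[OF O2_OK[OF q]]]
  show ?thesis
  proof (rule delta_form_frame[OF q fr], unfold represents_frame_def, rule)
    fix \<alpha> assume "\<alpha> \<in> OK_plus K"
    from universal_rep[OF u this] obtain x y z where xyz: "x \<in> OK K" "y \<in> OK K" "z \<in> OK K"
      and a: "\<alpha> = tform a11 a22 a33 a12 a13 a23 x y z" by (elim bexE)
    define X Y Z where "X = x * k1 + y * k2 + z * k3" and "Y = x * l1 + y * l2 + z * l3" and "Z = x * h1 + y * h2 + z * h3"
    have XYZ: "X \<in> OK K" "Y \<in> OK K" "Z \<in> OK K" unfolding X_def Y_def Z_def by (intro OK_add OK_mult inK xyz)+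
    have "(x, y, z) = vadd (vsc x (1, 0, 0)) (vadd (vsc y (0, 1, 0)) (vsc z (0, 0, 1)))" by simp
    also have "\<dots> = comb X p Y q' Z r"
      unfolding c X_def Y_def Z_def comb_def by (cases p; cases q'; cases r) (simp add: algebra_simps)
    finally have w: "(x, y, z) = comb X p Y q' Z r" .
    have "\<alpha> = t.bl (x, y, z) (x, y, z)" unfolding a t.bl_tform e ..
    also have "\<dots> = X\<^sup>2 + ((2 + sqrt2) * Y\<^sup>2 + 2 * m * Y * Z + n * Z\<^sup>2)"
      unfolding w comb_def
      by (simp add: t.bl_simps g t.bl_sym[of q' p] t.bl_sym[of r p] t.bl_sym[of r q'] power2_eq_square algebra_simps)
    finally show "\<exists>x\<in>OK K. \<exists>y\<in>OK K. \<exists>z\<in>OK K. \<alpha> = x\<^sup>2 + ((2 + sqrt2) * y\<^sup>2 + 2 * m * y * z + n * z\<^sup>2)"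
      using XYZ by blast
  qed
qed

lemma delta_form_contradiction:
  assumes q: "sqrt2 \<in> K" and number_field_K: "delta_form K"
    and abcd: "(\<exists>A\<in>unit_quotient K. \<exists>B\<in>unit_quotient K. A \<noteq> B)
         \<or> (\<exists>\<alpha>\<in>OK_plus K. 2 * \<alpha> \<notin> sum_four_squares K)
         \<or> (\<exists>\<alpha>. indecomposable K \<alpha> \<and>
               \<alpha> \<notin> unit_squares K \<union> (\<lambda>\<eta>. (2 + sqrt2) * \<eta>) ` unit_squares K)
         \<or> (\<exists>k::nat. k \<ge> 1 \<and> F k \<subseteq> K \<and> F k \<noteq> \<rat> \<and> F k \<noteq> gen_field sqrt2)"
  shows False
proof -
  interpret core K \<theta> sqrt2
    by unfold_locales (use q number_field_K sqrt2_sq in \<open>auto simp: delta_form_def\<close>)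
  from abcd show False using unit_quotient_unique double_sum_four_squares indecomposable_unit_squares no_real_cyclotomic_subfield by (elim disjE) blast+
qed

end

theorem theorem3p11:
  fixes K :: "complex set"
  assumes "totally_real_field K"
    and "sqrt2 \<in> K"
    and "(\<exists>A\<in>unit_quotient K. \<exists>B\<in>unit_quotient K. A \<noteq> B)
         \<or> (\<exists>\<alpha>\<in>OK_plus K. 2 * \<alpha> \<notin> sum_four_squares K)
         \<or> (\<exists>\<alpha>. indecomposable K \<alpha> \<and>
               \<alpha> \<notin> unit_squares K \<union> (\<lambda>\<eta>. (2 + sqrt2) * \<eta>) ` unit_squares K)
         \<or> (\<exists>k::nat. k \<ge> 1 \<and> F k \<subseteq> K \<and> F k \<noteq> \<rat> \<and> F k \<noteq> gen_field sqrt2)"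
  shows "(\<nexists>a11 a22 a33 a12 a13 a23.
            {a11, a22, a33, a12, a13, a23} \<subseteq> gen_field sqrt2 \<and>
            classical (OK (gen_field sqrt2)) a11 a22 a33 a12 a13 a23 \<and>
            universal (gen_field sqrt2) (tform a11 a22 a33 a12 a13 a23) \<and>
            universal K (tform a11 a22 a33 a12 a13 a23))
       \<and> \<not> universal K (tform 1 1 (2 + sqrt2) 0 0 0)
       \<and> \<not> universal K (tform 1 (2 + sqrt2) (2 - sqrt2) 0 0 2)
       \<and> \<not> universal K (tform 1 (2 + sqrt2) 3 0 0 2)
       \<and> \<not> universal K (tform 1 (2 - sqrt2) 3 0 0 2)"
proof -
  obtain \<theta> where "tr_field K \<theta>" using tr_field_ex[OF assms(1)] ..
  then interpret tr_field K \<theta> .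
  have "\<not> delta_form K" using delta_form_contradiction[OF assms(2) _ assms(3)] by blast
  thus ?thesis
    using delta_form_classical[OF assms(2)] delta_form_Q1[OF assms(2)] delta_form_Q2[OF assms(2)] delta_form_Q3[OF assms(2)] delta_form_Q3'[OF assms(2)]
    by blast
qed

end
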